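(* Assume the setting described in the context. For all regular partitionings $\mathcal T^h$ of $\Omega$ and all $\tau_n>0$, there exists a solution $W_A^n\in U_0^h$, $Q_A^n\in\underline S^h$ to the $n$-th step of $(\mathrm Q_A^{h,\tau})$. In addition, solutions satisfy $$\max_{n=0,\dots,N}\|W_A^n\|_{L^2(\Omega)}+\sum_{n=1}^N\|W_A^n-W_A^{n-1}\|_{L^2(\Omega)}^2+\sum_{n=1}^N\tau_n\|Q_A^n\|_{L^1(\Omega)}\le C,\qquad \max_{n=0,\dots,N}\|W_A^n\|_{W^{1,\infty}(\Omega)}\le C,$$ where $C$ is a positive constant independent of the mesh parameter $h$ and of the time step parameter $\tau$. Moreover, $(\mathrm Q_A^{h,\tau})$ is equivalent to $(\mathrm P_A^{h,\tau})$ together with $(\mathrm M_A^{h,\tau})$; that is, $\{W_A^n,Q_A^n\}_{n=1}^N$ solves $(\mathrm Q_A^{h,\tau})$ if and only if $\{W_A^n\}_{n=1}^N$ solves $(\mathrm P_A^{h,\tau})$ and $\{Q_A^n\}_{n=1}^N$ solves the associated problem $(\mathrm M_A^{h,\tau})$. Furthermore, for $n=1,\dots,N$, having obtained $W_A^n$, one has $Q_A^n=-\lambda_A^n\nabla W_A^n$, where $\lambda_A^n\in S^h_{\ge0}$ is a Lagrange multiplier associated with the gradient inequality constraint in $(\mathrm P_A^{h,\tau})$.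
   Context: Data. $d\in\{1,2\}$; $\Omega\subset\mathbb R^d$ is a bounded convex polygonal domain (an open interval if $d=1$) with Lipschitz boundary and outward unit normal $\nu$; $T>0$; $k_0>0$ and $\varepsilon>0$ are fixed constants; $f\in L^2(0,T;L^2(\Omega))$ is nonnegative; $w_0^\varepsilon\in W^{1,\infty}_0(\Omega)\cap C^1(\overline\Omega)$ satisfies $\nabla w_0^\varepsilon\cdot\nu<k_0$ on $\partial\Omega$. Here $W^{1,s}_0(\Omega)=\{\eta\in W^{1,s}(\Omega):\eta=0\text{ on }\partial\Omega\}$. $(\cdot,\cdot)$ is the $L^2(\Omega)$ inner product (also for vector functions). Mesh and spaces. $\{\mathcal T^h\}_{h>0}$ is a regular (shape-regular, conforming) family of partitionings of $\Omega$ into disjoint open simplices $\sigma$, $h=\max_{\sigma}\mathrm{diam}(\sigma)$. $S^h$ (resp. $\underline S^h$) is the space of functions on $\Omega$ that are constant on each $\sigma$ with values in $\mathbb R$ (resp. $\mathbb R^d$); $S^h_{\ge0}=\{\eta^h\in S^h:\eta^h\ge0\}$. $U^h$ is the space of continuous functions on $\overline\Omega$ affine on each $\sigma$, $U_0^h=U^h\cap W_0^{1,\infty}(\Omega)$. $\pi^h:C(\overline\Omega)\to U^h$ is nodal interpolation at the vertices; $P^h:L^1(\Omega)\to S^h$ is the elementwise mean, $P^hv|_\sigma=\frac1{|\sigma|}\int_\sigma v\,dx$. $(\eta,\chi)^h:=\sum_{\sigma\in\mathcal T^h}\frac{|\sigma|}{d+1}\sum_{j=1}^{d+1}\eta(x_j^\sigma)\chi(x_j^\sigma)$,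 with $x_j^\sigma$ the vertices of $\sigma$, and $|\eta^h|_h^2:=(\eta^h,\eta^h)^h$. With $w_0^{\varepsilon,h}:=P^h[\pi^hw_0^\varepsilon]$ and $k_{1,\sigma}^{\varepsilon,h}:=\max(k_0,|\nabla\pi^hw_0^\varepsilon|_\sigma|)$, $M_\varepsilon^h:S^h\to S^h$ is defined on each $\sigma$ by: $M_\varepsilon^h(\eta^h)=k_0$ if $\eta^h\ge w_0^{\varepsilon,h}+\varepsilon$; $=k_{1,\sigma}^{\varepsilon,h}+(k_0-k_{1,\sigma}^{\varepsilon,h})\frac{\eta^h-w_0^{\varepsilon,h}}{\varepsilon}$ if $\eta^h\in[w_0^{\varepsilon,h},w_0^{\varepsilon,h}+\varepsilon]$; $=k_{1,\sigma}^{\varepsilon,h}$ if $\eta^h\le w_0^{\varepsilon,h}$. Time discretization. $0=t_0<t_1<\dots<t_N=T$, $\tau_n=t_n-t_{n-1}$, $\tau=\max_n\tau_n$, $f^n:=\frac1{\tau_n}\int_{t_{n-1}}^{t_n}f(\cdot,t)\,dt$. Problem $(\mathrm Q_A^{h,\tau})$: with $W_A^0=\pi^hw_0^\varepsilon$, for $n=1,\dots,N$ find $W_A^n\in U_0^h$ and $Q_A^n\in\underline S^h$ such that $\left(\frac{W_A^n-W_A^{n-1}}{\tau_n},\eta^h\right)^h-(Q_A^n,\nabla\eta^h)=(f^n,\eta^h)$ for all $\eta^h\in U_0^h$, and $(M_\varepsilon^h(P^hW_A^n),|v^h|-|Q_A^n|)+(\nabla W_A^n,v^h-Q_A^n)\ge0$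 for all $v^h\in\underline S^h$. For $\chi^h\in U_0^h$ let $K^h(\chi^h):=\{\eta^h\in U_0^h:|\nabla\eta^h|\le M_\varepsilon^h(P^h\chi^h)\text{ a.e. in }\Omega\}$. Problem $(\mathrm P_A^{h,\tau})$: with $W_A^0=\pi^hw_0^\varepsilon$, for $n=1,\dots,N$ find $W_A^n\in K^h(W_A^n)$ such that $\left(\frac{W_A^n-W_A^{n-1}}{\tau_n},\eta^h-W_A^n\right)^h\ge(f^n,\eta^h-W_A^n)$ for all $\eta^h\in K^h(W_A^n)$. Problem $(\mathrm M_A^{h,\tau})$ (given $\{W_A^n\}_{n=1}^N$ solving $(\mathrm P_A^{h,\tau})$): for $n=1,\dots,N$ find $Q_A^n\in Z^{h,n}$ such that $(M_\varepsilon^h(P^hW_A^n),|Q_A^n|)\le(M_\varepsilon^h(P^hW_A^n),|v^h|)$ for all $v^h\in Z^{h,n}$, where $Z^{h,n}:=\{v^h\in\underline S^h:(v^h,\nabla\eta^h)=\left(\frac{W_A^n-W_A^{n-1}}{\tau_n},\eta^h\right)^h-(f^n,\eta^h)\ \forall\,\eta^h\in U_0^h\}$. Lagrange multiplier: $\lambda_A^n\in S^h_{\ge0}$ is a Lagrange multiplier associated with the gradient constraint at step $n$ of $(\mathrm P_A^{h,\tau})$ if $(W_A^n,\lambda_A^n)$ is a saddle point of $L^{h,n}(\eta^h,\mu^h):=\frac1{2\tau_n}|\eta^h-W_A^{n-1}|_h^2-(f^n,\eta^h)+\frac12\left(\mu^h,|\nabla\eta^h|^2-[M_\varepsilon^h(P^hW_A^n)]^2\right)$,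 that is, $L^{h,n}(W_A^n,\mu^h)\le L^{h,n}(W_A^n,\lambda_A^n)\le L^{h,n}(\eta^h,\lambda_A^n)$ for all $\eta^h\in U_0^h$, $\mu^h\in S^h_{\ge0}$. *)

theory Defs
  imports "HOL-Analysis.Analysis" "HOL-Probability.Essential_Supremum"
begin

section \<open>Domain\<close>

text \<open>In dimension one this says that the domain is a bounded open interval. The boundary of a
  bounded convex open set is automatically Lipschitz.\<close>

definition convex_polygonal_domain :: "'a::euclidean_space set \<Rightarrow> bool" where
  "convex_polygonal_domain \<Omega> \<longleftrightarrow> open \<Omega> \<and> convex \<Omega> \<and> \<Omega> \<noteq> {} \<and> polytope (closure \<Omega>)"

text \<open>For convex \<open>\<Omega>\<close>: the outward unit normal exists at a boundary point exactly when the unit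
  vector spanning the normal cone is unique, i.e. everywhere on the boundary except at the corners
  of a polygon.\<close>

definition outward_unit_normal :: "'a::euclidean_space set \<Rightarrow> 'a \<Rightarrow> 'a \<Rightarrow> bool" where
  "outward_unit_normal \<Omega> x \<nu> \<longleftrightarrow> x \<in> frontier \<Omega> \<and>
     (\<forall>\<mu>. norm \<mu> = 1 \<and> (\<forall>y\<in>\<Omega>. \<mu> \<bullet> (y - x) \<le> 0) \<longleftrightarrow> \<mu> = \<nu>)"

section \<open>Function spaces on the domain\<close>

text \<open>Functions on \<open>\<Omega>\<close> or its closure are total functions on the ambient space; integrals are
  Lebesgue integrals over \<open>\<Omega>\<close>.\<close>

definition L2_inner :: "'a::euclidean_space set \<Rightarrow> ('a \<Rightarrow> 'b::euclidean_space) \<Rightarrow> ('a \<Rightarrow> 'b) \<Rightarrow> real" where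
  "L2_inner \<Omega> u v = (LINT x:\<Omega>|lebesgue. u x \<bullet> v x)"

definition L2_norm :: "'a::euclidean_space set \<Rightarrow> ('a \<Rightarrow> 'b::euclidean_space) \<Rightarrow> real" where
  "L2_norm \<Omega> u = sqrt (L2_inner \<Omega> u u)"

definition L1_norm :: "'a::euclidean_space set \<Rightarrow> ('a \<Rightarrow> 'b::euclidean_space) \<Rightarrow> real" where
  "L1_norm \<Omega> u = (LINT x:\<Omega>|lebesgue. norm (u x))"

definition Linf_norm :: "'a::euclidean_space set \<Rightarrow> ('a \<Rightarrow> 'b::euclidean_space) \<Rightarrow> ereal" where
  "Linf_norm \<Omega> u = esssup (lebesgue_on \<Omega>) (\<lambda>x. ereal (norm (u x)))"

text \<open>\<open>C1_test_fun \<Omega> \<phi> g\<close>: \<open>\<phi>\<close> is a compactly supported \<open>C\<^sup>1\<close> function on \<open>\<Omega>\<close> with gradient \<open>g\<close>.\<close>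

definition C1_test_fun :: "'a::euclidean_space set \<Rightarrow> ('a \<Rightarrow> real) \<Rightarrow> ('a \<Rightarrow> 'a) \<Rightarrow> bool" where
  "C1_test_fun \<Omega> \<phi> g \<longleftrightarrow> (\<forall>x. GDERIV \<phi> x :> g x) \<and> continuous_on UNIV g \<and>
     compact (closure {x. \<phi> x \<noteq> 0}) \<and> closure {x. \<phi> x \<noteq> 0} \<subseteq> \<Omega>"

definition locally_integrable :: "'a::euclidean_space set \<Rightarrow> ('a \<Rightarrow> 'b::euclidean_space) \<Rightarrow> bool" where
  "locally_integrable \<Omega> u \<longleftrightarrow> (\<forall>K. compact K \<and> K \<subseteq> \<Omega> \<longrightarrow> set_integrable lebesgue K u)"

definition weak_gradient :: "'a::euclidean_space set \<Rightarrow> ('a \<Rightarrow> real) \<Rightarrow> ('a \<Rightarrow> 'a) \<Rightarrow> bool" where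
  "weak_gradient \<Omega> u G \<longleftrightarrow> locally_integrable \<Omega> u \<and> locally_integrable \<Omega> G \<and>
     (\<forall>\<phi> g. C1_test_fun \<Omega> \<phi> g \<longrightarrow>
        (LINT x:\<Omega>|lebesgue. u x *\<^sub>R g x) = - (LINT x:\<Omega>|lebesgue. \<phi> x *\<^sub>R G x))"

text \<open>The weak gradient is unique almost everywhere, so the infimum below is over a single value,
  or it is \<open>\<infinity>\<close> if there is no weak gradient.\<close>

definition W1inf_norm :: "'a::euclidean_space set \<Rightarrow> ('a \<Rightarrow> real) \<Rightarrow> ereal" where
  "W1inf_norm \<Omega> u = (INF G\<in>{G. weak_gradient \<Omega> u G}. max (Linf_norm \<Omega> u) (Linf_norm \<Omega> G))"

definition W1inf :: "'a::euclidean_space set \<Rightarrow> ('a \<Rightarrow> real) set" where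
  "W1inf \<Omega> = {u. W1inf_norm \<Omega> u < \<infinity>}"

text \<open>Elements of \<open>W\<^sup>1\<^sup>,\<^sup>\<infinity>\<close> have a unique representative continuous up to the boundary; boundary
  values are those of this representative.\<close>

definition W1inf_0 :: "'a::euclidean_space set \<Rightarrow> ('a \<Rightarrow> real) set" where
  "W1inf_0 \<Omega> = {u \<in> W1inf \<Omega>. continuous_on (closure \<Omega>) u \<and> (\<forall>x\<in>frontier \<Omega>. u x = 0)}"

text \<open>\<open>C1_closure \<Omega> u G\<close>: \<open>u\<close> is \<open>C\<^sup>1\<close> on the closure of \<open>\<Omega>\<close>, and \<open>G\<close> is its gradient, continuously
  extended to the boundary.\<close>

definition C1_closure :: "'a::euclidean_space set \<Rightarrow> ('a \<Rightarrow> real) \<Rightarrow> ('a \<Rightarrow> 'a) \<Rightarrow> bool" where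
  "C1_closure \<Omega> u G \<longleftrightarrow> continuous_on (closure \<Omega>) u \<and> continuous_on (closure \<Omega>) G \<and>
     (\<forall>x\<in>\<Omega>. GDERIV u x :> G x)"

text \<open>\<open>L\<^sup>2(0,T;L\<^sup>2(\<Omega>))\<close>, identified as usual with \<open>L\<^sup>2(\<Omega> \<times> (0,T))\<close>; the argument order is \<open>f(x,t)\<close>.\<close>

definition L2_L2 :: "'a::euclidean_space set \<Rightarrow> real \<Rightarrow> ('a \<Rightarrow> real \<Rightarrow> real) set" where
  "L2_L2 \<Omega> T = {f. set_borel_measurable lebesgue (\<Omega> \<times> {0<..<T}) (\<lambda>(x, t). f x t) \<and>
                   set_integrable lebesgue (\<Omega> \<times> {0<..<T}) (\<lambda>(x, t). (f x t)\<^sup>2)}"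

section \<open>Meshes\<close>

text \<open>The elements are open simplices of full dimension; \<open>triangulation\<close> expresses conformity: the
  closures of any two elements meet in a common (possibly empty) face.\<close>

definition mesh :: "'a::euclidean_space set \<Rightarrow> 'a set set \<Rightarrow> bool" where
  "mesh \<Omega> \<T> \<longleftrightarrow> finite \<T> \<and>
     (\<forall>\<sigma>\<in>\<T>. \<exists>K. int DIM('a) simplex K \<and> \<sigma> = interior K) \<and>
     pairwise disjnt \<T> \<and> triangulation (closure ` \<T>) \<and> closure \<Omega> = \<Union> (closure ` \<T>)"

definition inball_diameter :: "'a::euclidean_space set \<Rightarrow> real" where
  "inball_diameter \<sigma> = Sup {2 * r |r. 0 < r \<and> (\<exists>x. ball x r \<subseteq> \<sigma>)}"

text \<open>A family of meshes, as a set: the mesh parameter serves only as an index.\<close>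

definition regular_family :: "'a::euclidean_space set \<Rightarrow> 'a set set set \<Rightarrow> bool" where
  "regular_family \<Omega> F \<longleftrightarrow> (\<forall>\<T>\<in>F. mesh \<Omega> \<T>) \<and>
     (\<exists>\<kappa>>0. \<forall>\<T>\<in>F. \<forall>\<sigma>\<in>\<T>. diameter \<sigma> \<le> \<kappa> * inball_diameter \<sigma>)"

definition verts :: "'a::euclidean_space set \<Rightarrow> 'a set" where
  "verts \<sigma> = {p. p extreme_point_of (closure \<sigma>)}"

definition nodes :: "'a::euclidean_space set set \<Rightarrow> 'a set" where
  "nodes \<T> = (\<Union>\<sigma>\<in>\<T>. verts \<sigma>)"

section \<open>Finite element spaces\<close>

text \<open>Piecewise constant functions are defined almost everywhere only. We fix the representative
  that vanishes off the union of the open elements. Both \<open>S\<^sup>h\<close> (real values) and its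
  vector-valued counterpart are instances.\<close>

definition S_h :: "'a::euclidean_space set set \<Rightarrow> ('a \<Rightarrow> 'b::euclidean_space) set" where
  "S_h \<T> = {\<eta>. (\<forall>\<sigma>\<in>\<T>. \<eta> constant_on \<sigma>) \<and> (\<forall>x. x \<notin> \<Union>\<T> \<longrightarrow> \<eta> x = 0)}"

definition S_h_nonneg :: "'a::euclidean_space set set \<Rightarrow> ('a \<Rightarrow> real) set" where
  "S_h_nonneg \<T> = {\<eta> \<in> S_h \<T>. \<forall>x. 0 \<le> \<eta> x}"

text \<open>Functions on the closure of \<open>\<Omega>\<close> are represented by their extension by zero, so that equality in
  \<open>U\<^sup>h\<close> is equality of functions on the closure of \<open>\<Omega>\<close>.\<close>

definition U_h :: "'a::euclidean_space set \<Rightarrow> 'a set set \<Rightarrow> ('a \<Rightarrow> real) set" where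
  "U_h \<Omega> \<T> = {u. continuous_on (closure \<Omega>) u \<and>
      (\<forall>\<sigma>\<in>\<T>. \<exists>a b. \<forall>x\<in>\<sigma>. u x = a \<bullet> x + b) \<and> (\<forall>x. x \<notin> closure \<Omega> \<longrightarrow> u x = 0)}"

definition U0_h :: "'a::euclidean_space set \<Rightarrow> 'a set set \<Rightarrow> ('a \<Rightarrow> real) set" where
  "U0_h \<Omega> \<T> = U_h \<Omega> \<T> \<inter> W1inf_0 \<Omega>"

text \<open>The classical gradient. It is meaningful only at points of differentiability, hence almost
  everywhere for functions in \<open>U\<^sup>h\<close>.\<close>

definition grad :: "('a::euclidean_space \<Rightarrow> real) \<Rightarrow> 'a \<Rightarrow> 'a" where
  "grad u x = (THE D. GDERIV u x :> D)"

definition pi_h :: "'a::euclidean_space set \<Rightarrow> 'a set set \<Rightarrow> ('a \<Rightarrow> real) \<Rightarrow> 'a \<Rightarrow> real" where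
  "pi_h \<Omega> \<T> v = (THE u. u \<in> U_h \<Omega> \<T> \<and> (\<forall>p\<in>nodes \<T>. u p = v p))"

definition P_h :: "'a::euclidean_space set set \<Rightarrow> ('a \<Rightarrow> real) \<Rightarrow> 'a \<Rightarrow> real" where
  "P_h \<T> v x = (\<Sum>\<sigma>\<in>\<T>. indicat_real \<sigma> x * ((LINT y:\<sigma>|lebesgue. v y) / measure lebesgue \<sigma>))"

definition lumped :: "'a::euclidean_space set set \<Rightarrow> ('a \<Rightarrow> real) \<Rightarrow> ('a \<Rightarrow> real) \<Rightarrow> real" where
  "lumped \<T> \<eta> \<xi> =
     (\<Sum>\<sigma>\<in>\<T>. measure lebesgue \<sigma> / (real DIM('a) + 1) * (\<Sum>p\<in>verts \<sigma>. \<eta> p * \<xi> p))"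

definition M_h :: "'a::euclidean_space set \<Rightarrow> 'a set set \<Rightarrow> real \<Rightarrow> real \<Rightarrow> ('a \<Rightarrow> real)
    \<Rightarrow> ('a \<Rightarrow> real) \<Rightarrow> 'a \<Rightarrow> real" where
  "M_h \<Omega> \<T> k0 \<epsilon> w0 \<eta> x =
     (let w = P_h \<T> (pi_h \<Omega> \<T> w0) x;
          k1 = max k0 (norm (grad (pi_h \<Omega> \<T> w0) x))
      in if x \<notin> \<Union>\<T> then 0
         else if \<eta> x \<ge> w + \<epsilon> then k0
         else if \<eta> x \<ge> w then k1 + (k0 - k1) * ((\<eta> x - w) / \<epsilon>)
         else k1)"

section \<open>Discrete problems\<close>

definition time_partition :: "real \<Rightarrow> nat \<Rightarrow> (nat \<Rightarrow> real) \<Rightarrow> bool" where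
  "time_partition T N t \<longleftrightarrow> t 0 = 0 \<and> t N = T \<and> (\<forall>n<N. t n < t (Suc n))"

definition tau :: "(nat \<Rightarrow> real) \<Rightarrow> nat \<Rightarrow> real" where
  "tau t n = t n - t (n - 1)"

definition f_avg :: "('a \<Rightarrow> real \<Rightarrow> real) \<Rightarrow> (nat \<Rightarrow> real) \<Rightarrow> nat \<Rightarrow> 'a \<Rightarrow> real" where
  "f_avg f t n x = (1 / tau t n) * (LINT s:{t (n - 1)..t n}|lebesgue. f x s)"

text \<open>In the step predicates \<open>V\<close> is the previous iterate \<open>W\<^sup>n\<^sup>-\<^sup>1\<close>.\<close>

definition Q_step :: "'a::euclidean_space set \<Rightarrow> 'a set set \<Rightarrow> real \<Rightarrow> real \<Rightarrow> ('a \<Rightarrow> real)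
    \<Rightarrow> ('a \<Rightarrow> real \<Rightarrow> real) \<Rightarrow> (nat \<Rightarrow> real) \<Rightarrow> nat
    \<Rightarrow> ('a \<Rightarrow> real) \<Rightarrow> ('a \<Rightarrow> real) \<Rightarrow> ('a \<Rightarrow> 'a) \<Rightarrow> bool" where
  "Q_step \<Omega> \<T> k0 \<epsilon> w0 f t n V W Q \<longleftrightarrow>
     W \<in> U0_h \<Omega> \<T> \<and> Q \<in> S_h \<T> \<and>
     (\<forall>\<eta>\<in>U0_h \<Omega> \<T>.
        lumped \<T> (\<lambda>x. (W x - V x) / tau t n) \<eta> - L2_inner \<Omega> Q (grad \<eta>)
          = L2_inner \<Omega> (f_avg f t n) \<eta>) \<and>
     (\<forall>v\<in>S_h \<T>.
        L2_inner \<Omega> (M_h \<Omega> \<T> k0 \<epsilon> w0 (P_h \<T> W)) (\<lambda>x. norm (v x) - norm (Q x))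
          + L2_inner \<Omega> (grad W) (\<lambda>x. v x - Q x) \<ge> 0)"

definition solves_Q :: "'a::euclidean_space set \<Rightarrow> 'a set set \<Rightarrow> real \<Rightarrow> real \<Rightarrow> ('a \<Rightarrow> real)
    \<Rightarrow> ('a \<Rightarrow> real \<Rightarrow> real) \<Rightarrow> (nat \<Rightarrow> real) \<Rightarrow> nat
    \<Rightarrow> (nat \<Rightarrow> 'a \<Rightarrow> real) \<Rightarrow> (nat \<Rightarrow> 'a \<Rightarrow> 'a) \<Rightarrow> bool" where
  "solves_Q \<Omega> \<T> k0 \<epsilon> w0 f t N W Q \<longleftrightarrow>
     W 0 = pi_h \<Omega> \<T> w0 \<and> (\<forall>n\<in>{1..N}. Q_step \<Omega> \<T> k0 \<epsilon> w0 f t n (W (n - 1)) (W n) (Q n))"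

definition K_h :: "'a::euclidean_space set \<Rightarrow> 'a set set \<Rightarrow> real \<Rightarrow> real \<Rightarrow> ('a \<Rightarrow> real)
    \<Rightarrow> ('a \<Rightarrow> real) \<Rightarrow> ('a \<Rightarrow> real) set" where
  "K_h \<Omega> \<T> k0 \<epsilon> w0 \<xi> =
     {\<eta> \<in> U0_h \<Omega> \<T>. AE x in lebesgue_on \<Omega>. norm (grad \<eta> x) \<le> M_h \<Omega> \<T> k0 \<epsilon> w0 (P_h \<T> \<xi>) x}"

text \<open>The set \<open>K_h\<close> is only meant for arguments in \<open>U0_h\<close>; here this is implied by
  \<open>W n \<in> K_h \<dots> (W n)\<close>.\<close>

definition solves_P :: "'a::euclidean_space set \<Rightarrow> 'a set set \<Rightarrow> real \<Rightarrow> real \<Rightarrow> ('a \<Rightarrow> real)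
    \<Rightarrow> ('a \<Rightarrow> real \<Rightarrow> real) \<Rightarrow> (nat \<Rightarrow> real) \<Rightarrow> nat \<Rightarrow> (nat \<Rightarrow> 'a \<Rightarrow> real) \<Rightarrow> bool" where
  "solves_P \<Omega> \<T> k0 \<epsilon> w0 f t N W \<longleftrightarrow>
     W 0 = pi_h \<Omega> \<T> w0 \<and>
     (\<forall>n\<in>{1..N}. W n \<in> K_h \<Omega> \<T> k0 \<epsilon> w0 (W n) \<and>
        (\<forall>\<eta>\<in>K_h \<Omega> \<T> k0 \<epsilon> w0 (W n).
           lumped \<T> (\<lambda>x. (W n x - W (n - 1) x) / tau t n) (\<lambda>x. \<eta> x - W n x)
             \<ge> L2_inner \<Omega> (f_avg f t n) (\<lambda>x. \<eta> x - W n x)))"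

definition Z_h :: "'a::euclidean_space set \<Rightarrow> 'a set set \<Rightarrow> ('a \<Rightarrow> real \<Rightarrow> real) \<Rightarrow> (nat \<Rightarrow> real)
    \<Rightarrow> (nat \<Rightarrow> 'a \<Rightarrow> real) \<Rightarrow> nat \<Rightarrow> ('a \<Rightarrow> 'a) set" where
  "Z_h \<Omega> \<T> f t W n =
     {v \<in> S_h \<T>. \<forall>\<eta>\<in>U0_h \<Omega> \<T>.
        L2_inner \<Omega> v (grad \<eta>)
          = lumped \<T> (\<lambda>x. (W n x - W (n - 1) x) / tau t n) \<eta> - L2_inner \<Omega> (f_avg f t n) \<eta>}"

definition solves_M :: "'a::euclidean_space set \<Rightarrow> 'a set set \<Rightarrow> real \<Rightarrow> real \<Rightarrow> ('a \<Rightarrow> real)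
    \<Rightarrow> ('a \<Rightarrow> real \<Rightarrow> real) \<Rightarrow> (nat \<Rightarrow> real) \<Rightarrow> nat
    \<Rightarrow> (nat \<Rightarrow> 'a \<Rightarrow> real) \<Rightarrow> (nat \<Rightarrow> 'a \<Rightarrow> 'a) \<Rightarrow> bool" where
  "solves_M \<Omega> \<T> k0 \<epsilon> w0 f t N W Q \<longleftrightarrow>
     (\<forall>n\<in>{1..N}. Q n \<in> Z_h \<Omega> \<T> f t W n \<and>
        (\<forall>v\<in>Z_h \<Omega> \<T> f t W n.
           L2_inner \<Omega> (M_h \<Omega> \<T> k0 \<epsilon> w0 (P_h \<T> (W n))) (\<lambda>x. norm (Q n x))
             \<le> L2_inner \<Omega> (M_h \<Omega> \<T> k0 \<epsilon> w0 (P_h \<T> (W n))) (\<lambda>x. norm (v x))))"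

definition Lagrangian :: "'a::euclidean_space set \<Rightarrow> 'a set set \<Rightarrow> real \<Rightarrow> real \<Rightarrow> ('a \<Rightarrow> real)
    \<Rightarrow> ('a \<Rightarrow> real \<Rightarrow> real) \<Rightarrow> (nat \<Rightarrow> real) \<Rightarrow> (nat \<Rightarrow> 'a \<Rightarrow> real) \<Rightarrow> nat
    \<Rightarrow> ('a \<Rightarrow> real) \<Rightarrow> ('a \<Rightarrow> real) \<Rightarrow> real" where
  "Lagrangian \<Omega> \<T> k0 \<epsilon> w0 f t W n \<eta> \<mu> =
     1 / (2 * tau t n) * lumped \<T> (\<lambda>x. \<eta> x - W (n - 1) x) (\<lambda>x. \<eta> x - W (n - 1) x)
     - L2_inner \<Omega> (f_avg f t n) \<eta>
     + 1 / 2 * L2_inner \<Omega> \<mu>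
         (\<lambda>x. (norm (grad \<eta> x))\<^sup>2 - (M_h \<Omega> \<T> k0 \<epsilon> w0 (P_h \<T> (W n)) x)\<^sup>2)"

definition lagrange_multiplier :: "'a::euclidean_space set \<Rightarrow> 'a set set \<Rightarrow> real \<Rightarrow> real
    \<Rightarrow> ('a \<Rightarrow> real) \<Rightarrow> ('a \<Rightarrow> real \<Rightarrow> real) \<Rightarrow> (nat \<Rightarrow> real) \<Rightarrow> (nat \<Rightarrow> 'a \<Rightarrow> real) \<Rightarrow> nat
    \<Rightarrow> ('a \<Rightarrow> real) \<Rightarrow> bool" where
  "lagrange_multiplier \<Omega> \<T> k0 \<epsilon> w0 f t W n \<Lambda> \<longleftrightarrow>
     \<Lambda> \<in> S_h_nonneg \<T> \<and>
     (\<forall>\<mu>\<in>S_h_nonneg \<T>.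
        Lagrangian \<Omega> \<T> k0 \<epsilon> w0 f t W n (W n) \<mu> \<le> Lagrangian \<Omega> \<T> k0 \<epsilon> w0 f t W n (W n) \<Lambda>) \<and>
     (\<forall>\<eta>\<in>U0_h \<Omega> \<T>.
        Lagrangian \<Omega> \<T> k0 \<epsilon> w0 f t W n (W n) \<Lambda> \<le> Lagrangian \<Omega> \<T> k0 \<epsilon> w0 f t W n \<eta> \<Lambda>)"

end

theory Submission
  imports Defs
begin

text \<open>On each element the variational inequality for the flux says that \<open>|\<nabla>W| \<le> M\<close> and
  \<open>M |Q| + \<nabla>W \<cdot> Q = 0\<close>, i.e. \<open>Q = -\<lambda> \<nabla>W\<close> with \<open>\<lambda> = |Q| / M\<close> vanishing off the active set. A step is
  solved by the penalty fluxes \<open>Q\<^sub>p = -p (|\<nabla>W| - M(W))\<^sub>+ \<nabla>W / |\<nabla>W|\<close>: the penalised equation is a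
  coercive continuous system in the nodal values, hence has a zero by Brouwer's theorem, and since
  \<open>M \<ge> k\<^sub>0 > 0\<close> the energy identity bounds \<open>Q\<^sub>p\<close> uniformly in \<open>p\<close>, so one can let \<open>p\<close> tend to infinity.
  The same argument with \<open>M\<close> frozen produces multipliers for the primal problem. For the bounds, the
  energy identity tested with \<open>W\<^sup>n\<close> is combined with \<open>|\<nabla>W\<^sup>n| \<le> max k\<^sub>0 |\<nabla>\<pi>\<^sup>hw\<^sub>0|\<close>, and
  shape regularity bounds the latter by a multiple of the Lipschitz constant of \<open>w\<^sub>0\<close>.\<close>

section \<open>Zeros of coercive fields and the penalty limit\<close>

text \<open>The bound \<open>M_h\<close> is evaluated at the unknown \<open>W\<close>, so a step is
  a quasi-variational inequality: the admissible set moves with the solution. Brouwer only needs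
  \<open>M\<close> to vary continuously with the nodal values, and it does, because it sees
  \<open>W\<close> through element means alone. Mass lumping makes the zero order term diagonal;
  each nodal value is then controlled separately, which confines the zeros to a cube before anything
  is known about gradients. Nodal values and fluxes range over finite dimensional spaces, so
  boundedness suffices for the limit. Gradients, bounds and fluxes are constant on elements, so the
  variational inequality decouples: the duality gap \<open>M |Q| + \<nabla>W . Q\<close>,
  nonnegative by Cauchy-Schwarz for admissible \<open>W\<close>, has to vanish on each element.
  Uniformity of the constants rests on the supremum bound for \<open>W\<close>, which comes from the
  gradient constraint and the zero boundary values and not from the energy: with it the load enters
  only through its space-time L1 norm, and the energy estimates add up over the time steps with no
  growth factor.\<close>

lemma compact_Pi_UNIV:
  fixes S :: "'i \<Rightarrow> 'b::topological_space set"
  assumes "\<And>i. compact (S i)"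
  shows "compact (PiE UNIV S)"
proof -
  have "compactin (product_topology (\<lambda>i. euclidean) UNIV) (PiE UNIV S)"
    using assms by (auto simp: compactin_PiE)
  then show ?thesis
    by (simp add: euclidean_product_topology)
qed

lemma tendsto_fun_iff:
  fixes X :: "'c \<Rightarrow> 'i \<Rightarrow> 'b::topological_space"
  shows "(X \<longlongrightarrow> l) F \<longleftrightarrow> (\<forall>i. ((\<lambda>n. X n i) \<longlongrightarrow> l i) F)"
proof -
  have "(X \<longlongrightarrow> l) F \<longleftrightarrow> limitin (product_topology (\<lambda>i. euclidean) UNIV) X l F"
    by (simp add: euclidean_product_topology)
  also have "\<dots> \<longleftrightarrow> (\<forall>i. ((\<lambda>n. X n i) \<longlongrightarrow> l i) F)"
    by (simp add: limitin_componentwise)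
  finally show ?thesis .
qed

text \<open>The combinatorial core is \<open>kuhn_lemma\<close>: on ever finer grids of the cube, a
  0-1 labelling that records the sign of each \<open>g i\<close> has a cell in which every
  coordinate shows both labels. Vectors are functions on \<open>nat\<close>, since the number
  \<open>n\<close> of unknowns is a value and not a type; compactness of the cube is then that of a
  product.\<close>

lemma poincare_miranda:
  fixes g :: "nat \<Rightarrow> (nat \<Rightarrow> real) \<Rightarrow> real"
  assumes R: "R > 0"
    and cont: "\<And>i. i < n \<Longrightarrow> continuous_on UNIV (g i)"
    and lo: "\<And>i x. i < n \<Longrightarrow> (\<And>j. \<bar>x j\<bar> \<le> R) \<Longrightarrow> x i = - R \<Longrightarrow> 0 \<le> g i x"
    and hi: "\<And>i x. i < n \<Longrightarrow> (\<And>j. \<bar>x j\<bar> \<le> R) \<Longrightarrow> x i = R \<Longrightarrow> g i x \<le> 0"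
  obtains x where "\<And>j. \<bar>x j\<bar> \<le> R" "\<And>i. i < n \<Longrightarrow> g i x = 0"
proof -
  \<comment> \<open>Grid with \<open>Suc k\<close> intervals per direction. Coordinates from
    \<open>n\<close> on are held at 0, so that the bound by \<open>R\<close> holds for every
    \<open>j\<close>.\<close>
  define pt where "pt k y = (\<lambda>j. if j < n then - R + 2 * R * (real (y j) / real (Suc k)) else 0)"
    for k and y :: "nat \<Rightarrow> nat"
  have pt_bound: "\<bar>pt k y j\<bar> \<le> R" if "\<forall>i<n. y i \<le> Suc k" for k y j
  proof (cases "j < n")
    case True
    define u where "u = real (y j) / real (Suc k)"
    have "0 \<le> u" "u \<le> 1"
      using that True by (auto simp: u_def divide_simps simp del: of_nat_Suc)
    then have "0 \<le> R * u" "R * u \<le> R * 1"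
      using R by (auto intro!: mult_left_mono simp del: mult_1_right)
    then have "\<bar>- R + 2 * R * u\<bar> \<le> R"
      by simp
    then show ?thesis
      using True by (simp add: pt_def u_def)
  qed (use R in \<open>simp add: pt_def\<close>)
  \<comment> \<open>\<open>q\<close> is the lower corner of a grid cell; \<open>U i\<close> and
    \<open>V i\<close> are corners of the same cell at which \<open>g i\<close> has weakly opposite
    signs.\<close>
  define adj where "adj k q U V \<longleftrightarrow> (\<forall>i<n. q i < Suc k) \<and>
      (\<forall>i<n. (\<forall>j<n. q j \<le> U i j \<and> U i j \<le> q j + 1) \<and> (\<forall>j<n. q j \<le> V i j \<and> V i j \<le> q j + 1)
         \<and> 0 \<le> g i (pt k (U i)) \<and> g i (pt k (V i)) \<le> 0)" for k q U V
  have "\<exists>q U V. adj k q U V" for k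
  proof -
    \<comment> \<open>Kuhn's lemma prescribes label 0 on the face \<open>y i = 0\<close> and label 1
      on the opposite face; \<open>lo\<close> and \<open>hi\<close> guarantee that these forced
      labels still agree with the sign of \<open>g i\<close>.\<close>
    define label where "label y i = (if y i = 0 then 0 else if y i = Suc k then 1
        else if 0 \<le> g i (pt k y) then 0 else 1::nat)" for y :: "nat \<Rightarrow> nat" and i
    have label_cases: "label y i = 0 \<and> 0 \<le> g i (pt k y) \<or> label y i = 1 \<and> g i (pt k y) \<le> 0"
      if y: "\<forall>i<n. y i \<le> Suc k" and i: "i < n" for y i
    proof -
      consider "y i = 0" | "y i = Suc k" | "y i \<noteq> 0" "y i \<noteq> Suc k" by blast
      then show ?thesis
      proof cases
        case 1
        then have "pt k y i = - R" using i by (simp add: pt_def)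
        then have "0 \<le> g i (pt k y)" using lo[OF i] pt_bound[OF y] by blast
        then show ?thesis using 1 by (simp add: label_def)
      next
        case 2
        then have "pt k y i = R" using i by (simp add: pt_def del: of_nat_Suc)
        then have "g i (pt k y) \<le> 0" using hi[OF i] pt_bound[OF y] by blast
        then show ?thesis using 2 by (simp add: label_def)
      qed (auto simp: label_def)
    qed
    obtain q where q: "\<forall>i<n. q i < Suc k"
      and rs: "\<forall>i<n. \<exists>r s. (\<forall>j<n. q j \<le> r j \<and> r j \<le> q j + 1) \<and>
        (\<forall>j<n. q j \<le> s j \<and> s j \<le> q j + 1) \<and> label r i \<noteq> label s i"
      by (rule kuhn_lemma[of "Suc k" n label]) (auto simp: label_def)
    have "\<exists>u v. (\<forall>j<n. q j \<le> u j \<and> u j \<le> q j + 1) \<and> (\<forall>j<n. q j \<le> v j \<and> v j \<le> q j + 1)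
         \<and> 0 \<le> g i (pt k u) \<and> g i (pt k v) \<le> 0" if i: "i < n" for i
    proof -
      obtain r s where r: "\<forall>j<n. q j \<le> r j \<and> r j \<le> q j + 1"
        and s: "\<forall>j<n. q j \<le> s j \<and> s j \<le> q j + 1" and ne: "label r i \<noteq> label s i"
        using rs i by blast
      have "\<forall>j<n. r j \<le> Suc k" "\<forall>j<n. s j \<le> Suc k"
        using r s q by fastforce+
      from label_cases[OF this(1) i] label_cases[OF this(2) i] ne r s show ?thesis
        by metis
    qed
    then show ?thesis using q unfolding adj_def by metis
  qed
  then obtain q U V where "\<And>k. adj k (q k) (U k) (V k)"
    by metis
  then have q: "\<And>k i. i < n \<Longrightarrow> q k i < Suc k"
    and U: "\<And>k i j. i < n \<Longrightarrow> j < n \<Longrightarrow> q k j \<le> U k i j \<and> U k i j \<le> q k j + 1"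
    and V: "\<And>k i j. i < n \<Longrightarrow> j < n \<Longrightarrow> q k j \<le> V k i j \<and> V k i j \<le> q k j + 1"
    and gU: "\<And>k i. i < n \<Longrightarrow> 0 \<le> g i (pt k (U k i))"
    and gV: "\<And>k i. i < n \<Longrightarrow> g i (pt k (V k i)) \<le> 0"
    unfolding adj_def by blast+
  let ?K = "PiE UNIV (\<lambda>_. {- R..R}) :: (nat \<Rightarrow> real) set"
  have "compact ?K"
    by (rule compact_Pi_UNIV) simp
  then have "seq_compact ?K"
    by (simp only: compact_eq_seq_compact_metric)
  moreover have "\<forall>k. pt k (q k) \<in> ?K"
  proof
    fix k
    have "\<forall>i<n. q k i \<le> Suc k" using q less_imp_le by blast
    from pt_bound[OF this] show "pt k (q k) \<in> ?K"
      by (auto simp: PiE_iff abs_le_iff) (smt (verit))+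
  qed
  ultimately obtain x r where x: "x \<in> ?K" and r: "strict_mono r"
    and lim: "((\<lambda>k. pt k (q k)) \<circ> r) \<longlonglongrightarrow> x"
    unfolding seq_compact_def by metis
  \<comment> \<open>A corner of the cell differs from \<open>q\<close> by at most one grid width
    \<open>2 * R / Suc k\<close> per coordinate, so every choice of corners has the limit
    \<open>x\<close> of the lower corners.\<close>
  have close: "(\<lambda>k. pt (r k) (Y (r k))) \<longlonglongrightarrow> x"
    if Y: "\<And>k j. j < n \<Longrightarrow> q k j \<le> Y k j \<and> Y k j \<le> q k j + 1" for Y
    unfolding tendsto_fun_iff
  proof
    fix j
    have l: "(\<lambda>k. pt (r k) (q (r k)) j) \<longlonglongrightarrow> x j"
      using lim unfolding tendsto_fun_iff comp_def by blast
    have "(\<lambda>k. pt (r k) (Y (r k)) j - pt (r k) (q (r k)) j) \<longlonglongrightarrow> 0"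
    proof (rule Lim_null_comparison)
      have "(\<lambda>k. 2 * R * inverse (real (Suc k))) \<longlonglongrightarrow> 2 * R * 0"
        by (intro tendsto_intros LIMSEQ_inverse_real_of_nat)
      then show "((\<lambda>k. 2 * R * inverse (real (Suc k))) \<circ> r) \<longlonglongrightarrow> 0"
        using LIMSEQ_subseq_LIMSEQ r by fastforce
      show "\<forall>\<^sub>F k in sequentially. norm (pt (r k) (Y (r k)) j - pt (r k) (q (r k)) j)
          \<le> ((\<lambda>k. 2 * R * inverse (real (Suc k))) \<circ> r) k"
      proof (intro always_eventually allI)
        fix k
        show "norm (pt (r k) (Y (r k)) j - pt (r k) (q (r k)) j)
            \<le> ((\<lambda>k. 2 * R * inverse (real (Suc k))) \<circ> r) k"
        proof (cases "j < n")
          case True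
          define d where "d = real (Y (r k) j) - real (q (r k) j)"
          have d: "0 \<le> d" "d \<le> 1" using Y[OF True, of "r k"] by (auto simp: d_def)
          have "pt (r k) (Y (r k)) j - pt (r k) (q (r k)) j = 2 * R * inverse (real (Suc (r k))) * d"
            using True by (simp add: pt_def d_def divide_inverse algebra_simps del: of_nat_Suc)
          moreover have "2 * R * inverse (real (Suc (r k))) * d \<le> 2 * R * inverse (real (Suc (r k))) * 1"
            using d R by (intro mult_left_mono) auto
          ultimately show ?thesis using d R by (simp add: abs_mult)
        qed (use R in \<open>simp add: pt_def\<close>)
      qed
    qed
    from tendsto_add[OF this l] show "(\<lambda>k. pt (r k) (Y (r k)) j) \<longlonglongrightarrow> x j" by simp
  qed
  have "g i x = 0" if i: "i < n" for i
  proof (rule antisym)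
    have "(\<lambda>k. g i (pt (r k) (V (r k) i))) \<longlonglongrightarrow> g i x"
      by (rule continuous_on_tendsto_compose[OF cont[OF i] close]) (use V i in auto)
    then show "g i x \<le> 0" by (rule LIMSEQ_le_const2) (use gV i in auto)
    have "(\<lambda>k. g i (pt (r k) (U (r k) i))) \<longlonglongrightarrow> g i x"
      by (rule continuous_on_tendsto_compose[OF cont[OF i] close]) (use U i in auto)
    then show "0 \<le> g i x" by (rule LIMSEQ_le_const) (use gU i in auto)
  qed
  moreover have "\<bar>x j\<bar> \<le> R" for j using x by (auto simp: PiE_iff abs_le_iff minus_le_iff)
  ultimately show ?thesis using that by blast
qed

text \<open>A fixed point of \<open>x - F x\<close> truncated to the cube solves the variational
  inequality for \<open>F\<close> there, which forces \<open>F i x * x i \<le> 0\<close> for each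
  \<open>i\<close>. Positivity of the sum on the faces then excludes boundary points, and in the
  interior the truncation is inactive.\<close>

lemma coercive_zero:
  fixes F :: "nat \<Rightarrow> (nat \<Rightarrow> real) \<Rightarrow> real"
  assumes R: "R > 0"
    and cont: "\<And>i. i < n \<Longrightarrow> continuous_on UNIV (F i)"
    and pos: "\<And>x i. (\<And>j. \<bar>x j\<bar> \<le> R) \<Longrightarrow> i < n \<Longrightarrow> \<bar>x i\<bar> = R \<Longrightarrow> 0 < (\<Sum>i<n. F i x * x i)"
  obtains x where "\<And>j. \<bar>x j\<bar> \<le> R" "\<And>i. i < n \<Longrightarrow> F i x = 0"
proof -
  \<comment> \<open>The truncation yields the face conditions of \<open>poincare_miranda\<close>
    although no single component of \<open>F\<close> has a known sign.\<close>
  define g where "g i x = max (- R) (min R (x i - F i x)) - x i" for i x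
  have "continuous_on UNIV (g i)" if "i < n" for i
    unfolding g_def by (intro continuous_intros cont[OF that] continuous_on_product_coordinates)
  then obtain x where x: "\<And>j. \<bar>x j\<bar> \<le> R" and gx: "\<And>i. i < n \<Longrightarrow> g i x = 0"
    by (rule poincare_miranda[OF R, of n g]) (use R in \<open>auto simp: g_def\<close>)
  have le: "F i x * x i \<le> 0" and zero: "\<bar>x i\<bar> < R \<Longrightarrow> F i x = 0" if "i < n" for i
  proof -
    have "max (- R) (min R (x i - F i x)) = x i" using gx[OF that] by (simp add: g_def)
    then have "F i x = 0 \<or> x i = R \<and> F i x \<le> 0 \<or> x i = - R \<and> F i x \<ge> 0"
      using R by (auto simp: max_def min_def split: if_splits)
    then show "F i x * x i \<le> 0" "\<bar>x i\<bar> < R \<Longrightarrow> F i x = 0"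
      using R by (auto simp: mult_le_0_iff)
  qed
  have "\<bar>x i\<bar> < R" if "i < n" for i
  proof (rule ccontr)
    assume "\<not> \<bar>x i\<bar> < R"
    then have "0 < (\<Sum>i<n. F i x * x i)"
      using x[of i] by (intro pos[OF x that]) auto
    moreover have "(\<Sum>i<n. F i x * x i) \<le> 0"
      by (intro sum_nonpos) (use le in auto)
    ultimately show False by simp
  qed
  then show ?thesis using that x zero by blast
qed

text \<open>In the application \<open>i\<close> runs over inner nodes and \<open>j\<close> over
  elements: \<open>c i\<close> is a lumped mass divided by the time step, \<open>a j\<close> a
  volume, \<open>e i j\<close> the gradient of a hat function and \<open>D j x\<close> the gradient
  of the discrete function. What matters is that the bounds on \<open>x\<close> and \<open>q\<close>
  do not involve \<open>p\<close>.\<close>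

lemma penalized_system_solvable:
  fixes a b c :: "nat \<Rightarrow> real" and e :: "nat \<Rightarrow> nat \<Rightarrow> 'a::euclidean_space"
    and m :: "nat \<Rightarrow> (nat \<Rightarrow> real) \<Rightarrow> real" and n l :: nat
  defines "D \<equiv> \<lambda>j x. \<Sum>i<n. x i *\<^sub>R e i j"
  defines "B \<equiv> \<Sum>i<n. \<bar>b i\<bar>"
  defines "R \<equiv> 1 + (\<Sum>i<n. B / c i)"
  assumes a: "\<And>j. j < l \<Longrightarrow> 0 < a j" and c: "\<And>i. i < n \<Longrightarrow> 0 < c i"
    and k0: "0 < k0" and m_ge: "\<And>j x. j < l \<Longrightarrow> k0 \<le> m j x"
    and m_cont: "\<And>j. j < l \<Longrightarrow> continuous_on UNIV (m j)"
    and p: "0 < p"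
  obtains x q where
    "\<And>i. \<bar>x i\<bar> \<le> R"
    "\<And>j. j < l \<Longrightarrow> norm (q j) \<le> B * R / (a j * k0)"
    "\<And>i. i < n \<Longrightarrow> c i * x i - (\<Sum>j<l. a j * (q j \<bullet> e i j)) = b i"
    "\<And>j. j < l \<Longrightarrow> norm (D j x) \<le> m j x + norm (q j) / p"
    "\<And>j. j < l \<Longrightarrow> m j x * norm (q j) + D j x \<bullet> q j \<le> 0"
proof -
  \<comment> \<open>The denominator equals \<open>norm (D j x)\<close> wherever the numerator is
    nonzero; the maximum with the positive \<open>m j x\<close> keeps the coefficient continuous
    where \<open>D j x = 0\<close>.\<close>
  define \<theta> where "\<theta> j x = max (norm (D j x) - m j x) 0 / max (norm (D j x)) (m j x)" for j x
  define F where "F i x = c i * x i - b i + p * (\<Sum>j<l. a j * (\<theta> j x * (D j x \<bullet> e i j)))" for i x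
  have B: "0 \<le> B" by (simp add: B_def sum_nonneg)
  have Bc: "0 \<le> B / c i" if "i < n" for i using B c[OF that] by simp
  have R: "1 \<le> R" using Bc by (auto simp: R_def intro!: sum_nonneg)
  \<comment> \<open>This explains the choice of \<open>R\<close>: on a face
    \<open>\<bar>x i\<bar> = R\<close> the single term \<open>c i * R\<^sup>2\<close> already
    exceeds the load, which is at most \<open>B * R\<close>.\<close>
  have R_gt: "B < c i * R" if "i < n" for i
  proof -
    have "B / c i \<le> (\<Sum>i<n. B / c i)" using Bc that by (intro member_le_sum) auto
    then have "B / c i < R" by (simp add: R_def)
    then show ?thesis using c[OF that] by (simp add: field_simps)
  qed
  have m_pos: "0 < m j x" if "j < l" for j x using m_ge[OF that, of x] k0 by linarith
  have \<theta>: "0 \<le> \<theta> j x" if "j < l" for j x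
    using m_pos[OF that, of x] by (auto simp: \<theta>_def intro!: divide_nonneg_nonneg)
  have \<theta>_D: "\<theta> j x * norm (D j x) = max (norm (D j x) - m j x) 0" if "j < l" for j x
    using m_pos[OF that, of x] by (auto simp: \<theta>_def max_def)
  have D_cont: "continuous_on UNIV (D j)" for j
    unfolding D_def by (intro continuous_intros continuous_on_product_coordinates)
  have \<theta>_cont: "continuous_on UNIV (\<theta> j)" if "j < l" for j
    unfolding \<theta>_def
    by (intro continuous_intros D_cont m_cont[OF that]) (use m_pos[OF that] in \<open>smt (verit)\<close>)
  \<comment> \<open>\<open>D\<close> is linear in \<open>x\<close>, so testing with \<open>x\<close>
    itself turns the penalty into a nonnegative dissipation.\<close>
  have energy: "(\<Sum>i<n. F i x * x i)
      = (\<Sum>i<n. c i * (x i)\<^sup>2 - b i * x i) + p * (\<Sum>j<l. a j * (\<theta> j x * (norm (D j x))\<^sup>2))" for x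
  proof -
    have "(\<Sum>i<n. (\<Sum>j<l. a j * (\<theta> j x * (D j x \<bullet> e i j))) * x i)
        = (\<Sum>i<n. \<Sum>j<l. a j * (\<theta> j x * (D j x \<bullet> (x i *\<^sub>R e i j))))"
      unfolding sum_distrib_right by (intro sum.cong refl) (simp add: algebra_simps)
    also have "\<dots> = (\<Sum>j<l. \<Sum>i<n. a j * (\<theta> j x * (D j x \<bullet> (x i *\<^sub>R e i j))))"
      by (rule sum.swap)
    also have "\<dots> = (\<Sum>j<l. a j * (\<theta> j x * (D j x \<bullet> D j x)))"
      by (simp add: D_def inner_sum_right sum_distrib_left)
    finally have "(\<Sum>i<n. (\<Sum>j<l. a j * (\<theta> j x * (D j x \<bullet> e i j))) * x i)
        = (\<Sum>j<l. a j * (\<theta> j x * (norm (D j x))\<^sup>2))"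
      by (simp add: power2_norm_eq_inner)
    moreover have "(\<Sum>i<n. F i x * x i) = (\<Sum>i<n. c i * (x i)\<^sup>2 - b i * x i)
        + p * (\<Sum>i<n. (\<Sum>j<l. a j * (\<theta> j x * (D j x \<bullet> e i j))) * x i)"
      unfolding F_def sum_distrib_left sum.distrib[symmetric]
      by (intro sum.cong refl) (simp add: algebra_simps power2_eq_square sum_distrib_left)
    ultimately show ?thesis by simp
  qed
  have bx: "(\<Sum>i<n. b i * x i) \<le> B * R" if "\<And>j. \<bar>x j\<bar> \<le> R" for x
  proof -
    have "(\<Sum>i<n. b i * x i) \<le> (\<Sum>i<n. \<bar>b i\<bar> * R)"
      by (rule sum_mono, rule order.trans[OF abs_ge_self]) (auto simp: abs_mult intro!: mult_left_mono that)
    then show ?thesis by (simp add: B_def sum_distrib_right)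
  qed
  have dissip: "0 \<le> a j * (\<theta> j x * (norm (D j x))\<^sup>2)" if "j < l" for j x
    using a[OF that] \<theta>[OF that] by simp
  obtain x where x: "\<And>j. \<bar>x j\<bar> \<le> R" and Fx: "\<And>i. i < n \<Longrightarrow> F i x = 0"
  proof (rule coercive_zero[of R n F])
    show "0 < R" using R by simp
    show "continuous_on UNIV (F i)" if "i < n" for i
      unfolding F_def by (intro continuous_intros continuous_on_product_coordinates D_cont \<theta>_cont) auto
    show "0 < (\<Sum>i<n. F i x * x i)" if x: "\<And>j. \<bar>x j\<bar> \<le> R" and i: "i < n" "\<bar>x i\<bar> = R" for x i
    proof -
      have "c i * R * R = c i * (x i)\<^sup>2"
        using i by (metis mult.assoc power2_abs power2_eq_square)
      also have "\<dots> \<le> (\<Sum>i<n. c i * (x i)\<^sup>2)"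
        using i by (intro member_le_sum) (auto intro!: mult_nonneg_nonneg less_imp_le[OF c])
      finally have "c i * R * R \<le> (\<Sum>i<n. c i * (x i)\<^sup>2)" .
      moreover have "B * R < c i * R * R"
        using R_gt[OF i(1)] R by simp
      moreover have "0 \<le> p * (\<Sum>j<l. a j * (\<theta> j x * (norm (D j x))\<^sup>2))"
        by (intro mult_nonneg_nonneg[OF less_imp_le[OF p] sum_nonneg] dissip) simp
      ultimately show ?thesis
        using bx[of x] x unfolding energy by (simp add: sum_subtractf)
    qed
  qed (use that in blast)
  define q where "q j = - ((p * \<theta> j x) *\<^sub>R D j x)" for j
  have nq: "norm (q j) = p * \<theta> j x * norm (D j x)" if "j < l" for j
    using p \<theta>[OF that] by (simp add: q_def)
  \<comment> \<open>A nonzero flux occurs only where the gradient exceeds the bound, hence exceeds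
    \<open>k0\<close>. There \<open>k0 * norm (q j)\<close> stays below the dissipation, which the
    energy identity limits by \<open>B * R\<close>.\<close>
  have active: "k0 \<le> m j x" "m j x < norm (D j x)" if "j < l" "q j \<noteq> 0" for j
    using that m_ge[OF that(1), of x] m_pos[OF that(1), of x]
    by (auto simp: q_def \<theta>_def max_def split: if_splits)
  show ?thesis
  proof
    show "\<bar>x i\<bar> \<le> R" for i by (rule x)
    show "c i * x i - (\<Sum>j<l. a j * (q j \<bullet> e i j)) = b i" if "i < n" for i
      using Fx[OF that] unfolding F_def q_def
      by (simp add: sum_distrib_left sum_negf algebra_simps)
    fix j assume j: "j < l"
    show "norm (D j x) \<le> m j x + norm (q j) / p"
      using \<theta>_D[OF j, of x] p by (simp add: nq[OF j] max_def split: if_splits)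
    show "m j x * norm (q j) + D j x \<bullet> q j \<le> 0"
    proof (cases "q j = 0")
      case False
      have "D j x \<bullet> q j = - (norm (D j x) * norm (q j))"
        unfolding nq[OF j] by (simp add: q_def power2_norm_eq_inner[symmetric] power2_eq_square)
      moreover have "m j x * norm (q j) \<le> norm (D j x) * norm (q j)"
        using active[OF j False] by (intro mult_right_mono) auto
      ultimately show ?thesis by simp
    qed simp
    have "k0 * norm (q j) \<le> p * (\<theta> j x * (norm (D j x))\<^sup>2)"
    proof (cases "q j = 0")
      case False
      have "k0 * norm (q j) \<le> norm (D j x) * norm (q j)"
        using active[OF j False] by (intro mult_right_mono) auto
      then show ?thesis unfolding nq[OF j] by (simp add: power2_eq_square algebra_simps)
    qed (use p \<theta>[OF j] in simp)
    from mult_left_mono[OF this less_imp_le[OF a[OF j]]]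
    have "a j * (k0 * norm (q j)) \<le> p * (a j * (\<theta> j x * (norm (D j x))\<^sup>2))"
      by (simp add: mult.left_commute)
    also have "\<dots> \<le> p * (\<Sum>j<l. a j * (\<theta> j x * (norm (D j x))\<^sup>2))"
      by (rule mult_left_mono[OF member_le_sum]) (use p j dissip in auto)
    also have "\<dots> = (\<Sum>i<n. b i * x i) - (\<Sum>i<n. c i * (x i)\<^sup>2)"
      using energy[of x] Fx by (simp add: sum_subtractf)
    also have "\<dots> \<le> B * R"
    proof -
      have "0 \<le> (\<Sum>i<n. c i * (x i)\<^sup>2)"
        by (auto intro!: sum_nonneg mult_nonneg_nonneg less_imp_le[OF c])
      moreover have "(\<Sum>i<n. b i * x i) \<le> B * R" using bx x by blast
      ultimately show ?thesis by linarith
    qed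
    finally show "norm (q j) \<le> B * R / (a j * k0)"
      using a[OF j] k0 by (simp add: field_simps)
  qed
qed

text \<open>With penalty parameters \<open>Suc k\<close> the pairs stay in a compact product of
  intervals and balls. Along a convergent subsequence the constraint violation, at most
  \<open>r j / Suc k\<close>, disappears, and the remaining conditions are closed.\<close>

lemma constrained_system_solvable:
  fixes a b c :: "nat \<Rightarrow> real" and e :: "nat \<Rightarrow> nat \<Rightarrow> 'a::euclidean_space"
    and m :: "nat \<Rightarrow> (nat \<Rightarrow> real) \<Rightarrow> real" and n l :: nat
  defines "D \<equiv> \<lambda>j x. \<Sum>i<n. x i *\<^sub>R e i j"
  assumes a: "\<And>j. j < l \<Longrightarrow> 0 < a j" and c: "\<And>i. i < n \<Longrightarrow> 0 < c i"
    and k0: "0 < k0" and m_ge: "\<And>j x. j < l \<Longrightarrow> k0 \<le> m j x"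
    and m_cont: "\<And>j. j < l \<Longrightarrow> continuous_on UNIV (m j)"
  obtains x q where
    "\<And>i. i < n \<Longrightarrow> c i * x i - (\<Sum>j<l. a j * (q j \<bullet> e i j)) = b i"
    "\<And>j. j < l \<Longrightarrow> norm (D j x) \<le> m j x"
    "\<And>j. j < l \<Longrightarrow> m j x * norm (q j) + D j x \<bullet> q j \<le> 0"
proof -
  define B where "B = (\<Sum>i<n. \<bar>b i\<bar>)"
  define R where "R = 1 + (\<Sum>i<n. B / c i)"
  define r where "r j = (if j < l then B * R / (a j * k0) else 0)" for j
  define approx where "approx k x q \<longleftrightarrow> (\<forall>i. \<bar>x i\<bar> \<le> R) \<and> (\<forall>j. norm (q j) \<le> r j) \<and>
      (\<forall>i<n. c i * x i - (\<Sum>j<l. a j * (q j \<bullet> e i j)) = b i) \<and>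
      (\<forall>j<l. norm (D j x) \<le> m j x + r j * inverse (real (Suc k))) \<and>
      (\<forall>j<l. m j x * norm (q j) + D j x \<bullet> q j \<le> 0)" for k x and q :: "nat \<Rightarrow> 'a"
  have "\<exists>x q. approx k x q" for k
  proof -
    obtain x q where x: "\<And>i. \<bar>x i\<bar> \<le> R"
      and q: "\<And>j. j < l \<Longrightarrow> norm (q j) \<le> B * R / (a j * k0)"
      and eq: "\<And>i. i < n \<Longrightarrow> c i * x i - (\<Sum>j<l. a j * (q j \<bullet> e i j)) = b i"
      and D: "\<And>j. j < l \<Longrightarrow> norm (D j x) \<le> m j x + norm (q j) / real (Suc k)"
      and m: "\<And>j. j < l \<Longrightarrow> m j x * norm (q j) + D j x \<bullet> q j \<le> 0"
      by (rule penalized_system_solvable[of l a n c k0 m "real (Suc k)" b e])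
        (use a c k0 m_ge m_cont in \<open>auto simp: D_def R_def B_def\<close>)
    \<comment> \<open>Only the first \<open>l\<close> fluxes are bounded by the penalised system;
      the others are set to 0 to match the radius \<open>r j = 0\<close>.\<close>
    define q' where "q' j = (if j < l then q j else 0)" for j
    have "norm (D j x) \<le> m j x + r j * inverse (real (Suc k))" if "j < l" for j
    proof -
      have "norm (q j) / real (Suc k) \<le> r j / real (Suc k)"
        using q that by (intro divide_right_mono) (auto simp: r_def)
      then show ?thesis
        using D[OF that] unfolding divide_inverse by linarith
    qed
    then have "approx k x q'"
      using x q eq m by (auto simp: approx_def q'_def r_def)
    then show ?thesis by blast
  qed
  then obtain X Y where XY: "\<And>k. approx k (X k) (Y k)" by metis
  have "compact (PiE UNIV (\<lambda>_. {- R..R}) \<times> PiE UNIV (\<lambda>j. cball 0 (r j)) :: ((nat \<Rightarrow> real) \<times> (nat \<Rightarrow> 'a)) set)"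
    (is "compact ?K")
    by (intro compact_Times compact_Pi_UNIV) auto
  then have K: "seq_compact ?K" by (simp only: compact_eq_seq_compact_metric)
  have mem: "\<forall>k. (X k, Y k) \<in> ?K"
    using XY by (auto simp: approx_def PiE_iff abs_le_iff minus_le_iff)
  obtain z s where s: "strict_mono (s :: nat \<Rightarrow> nat)"
    and lim: "((\<lambda>k. (X k, Y k)) \<circ> s) \<longlonglongrightarrow> z"
    by (rule seq_compactE[OF K mem]) (rule that)
  define x q where "x = fst z" and "q = snd z"
  have X: "(\<lambda>k. X (s k)) \<longlonglongrightarrow> x" and Y: "(\<lambda>k. Y (s k)) \<longlonglongrightarrow> q"
    using tendsto_fst[OF lim] tendsto_snd[OF lim] by (simp_all add: comp_def x_def q_def)
  have Xi: "(\<lambda>k. X (s k) i) \<longlonglongrightarrow> x i" and Yi: "(\<lambda>k. Y (s k) i) \<longlonglongrightarrow> q i" for i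
    using X Y by (auto simp: tendsto_fun_iff)
  have Dl: "(\<lambda>k. D j (X (s k))) \<longlonglongrightarrow> D j x" for j
    unfolding D_def by (intro tendsto_intros Xi)
  have ml: "(\<lambda>k. m j (X (s k))) \<longlonglongrightarrow> m j x" if "j < l" for j
    by (rule continuous_on_tendsto_compose[OF m_cont[OF that] X]) auto
  show ?thesis
  proof
    fix i assume i: "i < n"
    have "(\<lambda>k. c i * X (s k) i - (\<Sum>j<l. a j * (Y (s k) j \<bullet> e i j)))
        \<longlonglongrightarrow> c i * x i - (\<Sum>j<l. a j * (q j \<bullet> e i j))"
      by (intro tendsto_intros Xi Yi)
    moreover have "(\<lambda>k. c i * X (s k) i - (\<Sum>j<l. a j * (Y (s k) j \<bullet> e i j))) = (\<lambda>k. b i)"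
      using XY i by (auto simp: approx_def)
    ultimately show "c i * x i - (\<Sum>j<l. a j * (q j \<bullet> e i j)) = b i"
      by (simp add: LIMSEQ_const_iff)
  next
    fix j assume j: "j < l"
    have "(\<lambda>k. r j * inverse (real (Suc k))) \<longlonglongrightarrow> r j * 0"
      by (intro tendsto_intros LIMSEQ_inverse_real_of_nat)
    from LIMSEQ_subseq_LIMSEQ[OF this s]
    have "(\<lambda>k. m j (X (s k)) + r j * inverse (real (Suc (s k)))) \<longlonglongrightarrow> m j x + r j * 0"
      by (intro tendsto_add ml[OF j]) (simp only: comp_def)
    from LIMSEQ_le[OF tendsto_norm[OF Dl[of j]] this] show "norm (D j x) \<le> m j x"
      using XY j by (auto simp: approx_def)
    have "(\<lambda>k. m j (X (s k)) * norm (Y (s k) j) + D j (X (s k)) \<bullet> Y (s k) j)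
        \<longlonglongrightarrow> m j x * norm (q j) + D j x \<bullet> q j"
      by (intro tendsto_intros Yi Dl ml[OF j])
    then show "m j x * norm (q j) + D j x \<bullet> q j \<le> 0"
      by (rule LIMSEQ_le_const2) (use XY j in \<open>auto simp: approx_def\<close>)
  qed
qed

section \<open>Weak gradients of Lipschitz functions\<close>

lemma GDERIV_unique: "GDERIV f x :> a \<Longrightarrow> GDERIV f x :> b \<Longrightarrow> a = b"
  unfolding gderiv_def
  by (metis has_derivative_unique inner_commute vector_eq_rdot)

lemma GDERIV_transform_open:
  "GDERIV f x :> D \<Longrightarrow> open S \<Longrightarrow> x \<in> S \<Longrightarrow> (\<And>y. y \<in> S \<Longrightarrow> f y = g y) \<Longrightarrow> GDERIV g x :> D"
  unfolding gderiv_def by (rule has_derivative_transform_within_open)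

lemma GDERIV_affine: "GDERIV (\<lambda>x. a \<bullet> x + b) x :> a"
  unfolding gderiv_def by (auto intro!: derivative_eq_intros simp: inner_commute)

lemma GDERIV_difference_quotient:
  assumes "GDERIV u x :> D"
  shows "(\<lambda>k. (u (x + inverse (real (Suc k)) *\<^sub>R e) - u x) / inverse (real (Suc k))) \<longlonglongrightarrow> D \<bullet> e"
proof -
  have "((\<lambda>t. u (x + t *\<^sub>R e)) has_derivative (\<lambda>t. (t *\<^sub>R e) \<bullet> D)) (at 0)"
    using assms unfolding gderiv_def
    by (intro has_derivative_compose[of "\<lambda>t. x + t *\<^sub>R e" _ _ _ u, simplified] derivative_eq_intros | simp)+
  then have "((\<lambda>t. u (x + t *\<^sub>R e)) has_field_derivative (D \<bullet> e)) (at 0)"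
    by (simp add: has_field_derivative_def inner_commute mult_commute_abs)
  then have "((\<lambda>t. (u (x + t *\<^sub>R e) - u x) / t) \<longlongrightarrow> D \<bullet> e) (at 0)"
    by (simp add: DERIV_def)
  moreover have "filterlim (\<lambda>k. inverse (real (Suc k))) (at 0) sequentially"
    using LIMSEQ_inverse_real_of_nat unfolding filterlim_at by (auto simp del: of_nat_Suc)
  ultimately show ?thesis
    by (rule filterlim_compose)
qed

section \<open>Integration by parts through difference quotients\<close>

lemma lborel_integral_translate:
  fixes f :: "'a::euclidean_space \<Rightarrow> real"
  assumes [measurable]: "f \<in> borel_measurable borel"
  shows "(\<integral>x. f (c + x) \<partial>lborel) = (\<integral>x. f x \<partial>lborel)"
  by (subst (2) lborel_distr_plus[of c, symmetric]) (simp add: integral_distr)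

lemma integrable_compact_support:
  fixes f :: "'a::euclidean_space \<Rightarrow> 'b::euclidean_space"
  assumes f: "f \<in> borel_measurable lebesgue" and bound: "\<And>x. x \<in> K \<Longrightarrow> norm (f x) \<le> B"
    and K: "compact K" and out: "\<And>x. x \<notin> K \<Longrightarrow> f x = 0"
  shows "integrable lebesgue f"
proof (rule integrableI_bounded_set[where A = K and B = B])
  show "K \<in> sets lebesgue" using K by (simp add: lmeasurable_compact fmeasurableD)
  show "emeasure lebesgue K < \<infinity>"
    using lmeasurable_compact[OF K] by (auto simp: fmeasurable_def simp del: emeasure_completion)
qed (use assms in auto)

lemma continuous_compact_support:
  fixes f :: "'a::euclidean_space \<Rightarrow> 'b::euclidean_space"
  assumes f: "continuous_on UNIV f" and K: "compact K" and out: "\<And>x. x \<notin> K \<Longrightarrow> f x = 0"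
  shows "integrable lebesgue f" "\<exists>B\<ge>0. \<forall>x. norm (f x) \<le> B"
proof -
  have "bounded (f ` K)"
    by (intro compact_imp_bounded compact_continuous_image K continuous_on_subset[OF f]) simp
  then obtain B where B: "B > 0" "\<And>x. x \<in> K \<Longrightarrow> norm (f x) \<le> B"
    by (auto simp: bounded_pos)
  have "norm (f x) \<le> B" for x
    using B out[of x] by (cases "x \<in> K") auto
  then show "\<exists>B\<ge>0. \<forall>x. norm (f x) \<le> B" using B(1) by (intro exI[of _ B]) auto
  have "f \<in> borel_measurable borel" using f by (rule borel_measurable_continuous_onI)
  then have "f \<in> borel_measurable lebesgue" by (simp add: measurable_completion)
  then show "integrable lebesgue f"
    by (rule integrable_compact_support[OF _ _ K]) (use B out in auto)
qed

lemma C1_test_fun_zero: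
  assumes "C1_test_fun \<Omega> \<phi> g" "x \<notin> closure {x. \<phi> x \<noteq> 0}"
  shows "\<phi> x = 0" "g x = 0"
proof -
  show "\<phi> x = 0" using assms(2) closure_subset[of "{x. \<phi> x \<noteq> 0}"] by auto
  have "GDERIV (\<lambda>_. 0) x :> g x"
    by (rule GDERIV_transform_open[of \<phi> _ _ "- closure {x. \<phi> x \<noteq> 0}"])
      (use assms closure_subset[of "{x. \<phi> x \<noteq> 0}"] in \<open>auto simp: C1_test_fun_def\<close>)
  then show "g x = 0" using GDERIV_unique GDERIV_const by blast
qed

text \<open>A translation moves the difference quotient from \<open>\<phi>\<close> to
  \<open>u\<close>. The quotients of \<open>u\<close> are bounded by \<open>L * norm e\<close> and
  converge at every point of \<open>\<Omega>\<close> outside the null set \<open>N\<close>, so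
  dominated convergence applies on both sides.\<close>

lemma integration_by_parts_lipschitz:
  fixes u :: "'a::euclidean_space \<Rightarrow> real"
  assumes u: "L-lipschitz_on UNIV u"
    and G: "G \<in> borel_measurable lebesgue" and N: "negligible N"
    and deriv: "\<And>x. x \<in> \<Omega> - N \<Longrightarrow> GDERIV u x :> G x"
    and test: "C1_test_fun \<Omega> \<phi> g"
  shows "(LINT x|lebesgue. u x * (g x \<bullet> e)) = - (LINT x|lebesgue. \<phi> x * (G x \<bullet> e))"
proof -
  define S where "S = closure {x. \<phi> x \<noteq> 0}"
  define h where "h k = inverse (real (Suc k))" for k
  have h: "0 < h k" "h k \<le> 1" for k
    by (auto simp: h_def divide_simps)
  have u_cont: "continuous_on UNIV u" using u by (rule lipschitz_on_continuous_on)
  have K: "compact S" "S \<subseteq> \<Omega>" and g_cont: "continuous_on UNIV g"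
    and \<phi>_der: "\<And>x. GDERIV \<phi> x :> g x"
    using test unfolding C1_test_fun_def S_def by blast+
  have zero: "\<phi> x = 0" "g x = 0" if "x \<notin> S" for x
    using C1_test_fun_zero[OF test, of x] that unfolding S_def by blast+
  have \<phi>_cont: "continuous_on UNIV \<phi>"
    by (intro continuous_at_imp_continuous_on ballI has_derivative_continuous[OF \<phi>_der[unfolded gderiv_def]])
  obtain Cg where Cg: "0 \<le> Cg" "\<And>x. norm (g x) \<le> Cg"
    using continuous_compact_support(2)[OF g_cont K(1) zero(2)] by blast
  have \<phi>_lip: "\<bar>\<phi> y - \<phi> x\<bar> \<le> Cg * norm (y - x)" for x y
  proof -
    have "norm (\<phi> y - \<phi> x) \<le> Cg * norm (y - x)"
    proof (rule differentiable_bound[of UNIV \<phi> "\<lambda>x h. h \<bullet> g x"])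
      show "(\<phi> has_derivative (\<lambda>h. h \<bullet> g x)) (at x)" for x
        using \<phi>_der unfolding gderiv_def by simp
      show "onorm (\<lambda>h. h \<bullet> g x) \<le> Cg" for x
      proof (rule onorm_le)
        fix z
        have "norm (z \<bullet> g x) \<le> norm z * norm (g x)" by (simp add: Cauchy_Schwarz_ineq2)
        also have "\<dots> \<le> norm z * Cg" using Cg by (intro mult_left_mono) auto
        finally show "norm (z \<bullet> g x) \<le> Cg * norm z" by (simp add: mult.commute)
      qed
    qed auto
    then show ?thesis by simp
  qed
  obtain r where r: "S \<subseteq> cball 0 r"
    using compact_imp_bounded[OF K(1)] by (auto simp: bounded_iff subset_iff)
  \<comment> \<open>As \<open>h k \<le> 1\<close>, this ball contains the support of
    \<open>\<phi>\<close> and of all the translates that occur below.\<close>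
  define K1 where "K1 = cball (0::'a) (r + norm e)"
  have outK1: "\<phi> (x + h k *\<^sub>R e) = 0" "\<phi> x = 0" if "x \<notin> K1" for x k
  proof -
    have "norm (h k *\<^sub>R e) \<le> norm e" using h[of k] by (simp add: mult_left_le_one_le)
    then have "norm x \<le> norm (x + h k *\<^sub>R e) + norm e"
      by (smt (verit) norm_triangle_sub norm_minus_commute add_diff_cancel_left')
    moreover have "r + norm e < norm x" using that by (simp add: K1_def)
    ultimately have "r < norm (x + h k *\<^sub>R e)" "r < norm x"
      using norm_ge_zero[of e] by linarith+
    then have "x + h k *\<^sub>R e \<notin> S" "x \<notin> S"
      using r by (metis linorder_not_less mem_cball_0 subsetD)+
    then show "\<phi> (x + h k *\<^sub>R e) = 0" "\<phi> x = 0" using zero(1) by blast+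
  qed
  have "bounded (u ` K1)"
    unfolding K1_def by (intro compact_imp_bounded compact_continuous_image continuous_on_subset[OF u_cont]) auto
  then obtain Cu where Cu: "\<And>x. x \<in> K1 \<Longrightarrow> \<bar>u x\<bar> \<le> Cu"
    unfolding bounded_iff real_norm_def by blast
  have meas: "F \<in> borel_measurable lebesgue" if "continuous_on UNIV F" for F :: "'a \<Rightarrow> real"
    using that by (simp add: measurable_completion borel_measurable_continuous_onI)
  \<comment> \<open>The quotient of \<open>\<phi>\<close> is taken in direction \<open>e\<close> and
    that of \<open>u\<close> in direction \<open>- e\<close>; the substitution by
    \<open>h k *\<^sub>R e\<close> equates their integrals, and the minus sign of the formula is the
    one in \<open>- e\<close>.\<close>
  define A where "A k x = u x * ((\<phi> (x + h k *\<^sub>R e) - \<phi> x) / h k)" for k x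
  define B where "B k x = \<phi> x * ((u (x + h k *\<^sub>R - e) - u x) / h k)" for k x
  have shift: "continuous_on UNIV (\<lambda>x. F (x + c))" if "continuous_on UNIV F" for F :: "'a \<Rightarrow> real" and c
    by (rule continuous_on_compose2[OF that]) (auto intro: continuous_intros)
  have shift': "continuous_on UNIV (\<lambda>x. F (x - c))" if "continuous_on UNIV F" for F :: "'a \<Rightarrow> real" and c
    by (rule continuous_on_compose2[OF that]) (auto intro: continuous_intros)
  have A_cont: "continuous_on UNIV (A k)" and B_cont: "continuous_on UNIV (B k)" for k
    unfolding A_def B_def using h(1)[of k]
    by (auto intro!: continuous_intros shift shift' u_cont \<phi>_cont)
  have AB: "(LINT x|lebesgue. A k x) = (LINT x|lebesgue. B k x)" for k
  proof -
    have i1: "integrable lebesgue (\<lambda>x. u x * \<phi> (x + h k *\<^sub>R e))"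
      by (rule continuous_compact_support(1)[of _ K1])
        (auto simp: outK1 intro!: continuous_intros shift u_cont \<phi>_cont, simp add: K1_def)
    have i2: "integrable lebesgue (\<lambda>x. u x * \<phi> x)"
      by (rule continuous_compact_support(1)[OF _ K(1)])
        (auto simp: zero intro!: continuous_intros u_cont \<phi>_cont)
    have i3: "integrable lebesgue (\<lambda>x. u (x + h k *\<^sub>R - e) * \<phi> x)"
      by (rule continuous_compact_support(1)[OF _ K(1)])
        (auto simp: zero intro!: continuous_intros shift' u_cont \<phi>_cont)
    \<comment> \<open>Translation invariance is applied on \<open>lborel\<close>; the integrands are
      continuous, so the integrals agree with those over the completion.\<close>
    have "(LINT x|lebesgue. u x * \<phi> (x + h k *\<^sub>R e)) = (LINT x|lborel. u x * \<phi> (x + h k *\<^sub>R e))"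
      by (rule integral_completion)
        (auto intro!: borel_measurable_continuous_onI continuous_intros shift shift' u_cont \<phi>_cont)
    also have "\<dots> = (LINT x|lborel. u (h k *\<^sub>R - e + x) * \<phi> (h k *\<^sub>R - e + x + h k *\<^sub>R e))"
      by (rule lborel_integral_translate[symmetric])
        (auto intro!: borel_measurable_continuous_onI continuous_intros shift shift' u_cont \<phi>_cont)
    also have "\<dots> = (LINT x|lborel. u (x + h k *\<^sub>R - e) * \<phi> x)"
      by (simp add: add.commute)
    also have "\<dots> = (LINT x|lebesgue. u (x + h k *\<^sub>R - e) * \<phi> x)"
      by (rule integral_completion[symmetric])
        (auto intro!: borel_measurable_continuous_onI continuous_intros
            shift' u_cont \<phi>_cont)
    finally have eq: "(LINT x|lebesgue. u x * \<phi> (x + h k *\<^sub>R e))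
        = (LINT x|lebesgue. u (x + h k *\<^sub>R - e) * \<phi> x)" .
    have "A k = (\<lambda>x. (u x * \<phi> (x + h k *\<^sub>R e) - u x * \<phi> x) / h k)"
      "B k = (\<lambda>x. (u (x + h k *\<^sub>R - e) * \<phi> x - u x * \<phi> x) / h k)"
      unfolding A_def B_def by (auto simp: algebra_simps diff_divide_distrib)
    then show ?thesis
      using eq Bochner_Integration.integral_diff[OF i1 i2] Bochner_Integration.integral_diff[OF i3 i2]
      by simp
  qed
  have "(\<lambda>k. LINT x|lebesgue. A k x) \<longlonglongrightarrow> (LINT x|lebesgue. u x * (g x \<bullet> e))"
  proof (rule integral_dominated_convergence[where w = "\<lambda>x. indicator K1 x * (Cu * (Cg * norm e))"])
    show "integrable lebesgue (\<lambda>x. indicator K1 x * (Cu * (Cg * norm e)))"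
      using lmeasurable_cball[of 0 "r + norm e"] unfolding fmeasurable_def K1_def
      by (intro integrable_mult_left integrable_real_indicator) auto
    show "AE x in lebesgue. (\<lambda>k. A k x) \<longlonglongrightarrow> u x * (g x \<bullet> e)"
      unfolding A_def h_def by (intro AE_I2 tendsto_intros GDERIV_difference_quotient \<phi>_der)
    show "AE x in lebesgue. norm (A k x) \<le> indicator K1 x * (Cu * (Cg * norm e))" for k
    proof (intro AE_I2)
      fix x
      show "norm (A k x) \<le> indicator K1 x * (Cu * (Cg * norm e))"
      proof (cases "x \<in> K1")
        case True
        have "\<bar>\<phi> (x + h k *\<^sub>R e) - \<phi> x\<bar> \<le> Cg * (h k * norm e)"
          using \<phi>_lip[of "x + h k *\<^sub>R e" x] h[of k] by simp
        then have "\<bar>(\<phi> (x + h k *\<^sub>R e) - \<phi> x) / h k\<bar> \<le> Cg * norm e"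
          using h[of k] by (simp add: divide_simps mult_ac)
        then have "\<bar>u x\<bar> * \<bar>(\<phi> (x + h k *\<^sub>R e) - \<phi> x) / h k\<bar> \<le> Cu * (Cg * norm e)"
          using Cu[OF True] by (intro mult_mono) auto
        then show ?thesis using True by (simp add: A_def abs_mult)
      qed (simp add: A_def outK1)
    qed
  qed (auto intro!: meas A_cont continuous_intros u_cont g_cont)
  moreover have "(\<lambda>k. LINT x|lebesgue. B k x) \<longlonglongrightarrow> (LINT x|lebesgue. \<phi> x * (G x \<bullet> - e))"
  proof (rule integral_dominated_convergence[where w = "\<lambda>x. \<bar>\<phi> x\<bar> * (L * norm e)"])
    show "integrable lebesgue (\<lambda>x. \<bar>\<phi> x\<bar> * (L * norm e))"
      by (rule continuous_compact_support(1)[OF _ K(1)])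
        (auto simp: zero intro!: continuous_intros \<phi>_cont)
    show "(\<lambda>x. \<phi> x * (G x \<bullet> - e)) \<in> borel_measurable lebesgue"
      using G meas[OF \<phi>_cont] by measurable
    have "AE x in lebesgue. x \<notin> N"
      using N by (simp add: AE_not_in negligible_iff_null_sets)
    then show "AE x in lebesgue. (\<lambda>k. B k x) \<longlonglongrightarrow> \<phi> x * (G x \<bullet> - e)"
    proof eventually_elim
      case (elim x)
      show ?case
      proof (cases "x \<in> \<Omega>")
        case True
        then show ?thesis unfolding B_def h_def
          by (intro tendsto_intros GDERIV_difference_quotient deriv) (use elim in auto)
      next
        case False
        then have "\<phi> x = 0" using K(2) zero(1) by blast
        then show ?thesis by (simp add: B_def)
      qed
    qed
    show "AE x in lebesgue. norm (B k x) \<le> \<bar>\<phi> x\<bar> * (L * norm e)" for k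
    proof (intro AE_I2)
      fix x
      have "\<bar>u (x + h k *\<^sub>R - e) - u x\<bar> \<le> L * (h k * norm e)"
        using lipschitz_onD[OF u, of "x + h k *\<^sub>R - e" x] h[of k] by (simp add: dist_norm)
      then have "\<bar>(u (x + h k *\<^sub>R - e) - u x) / h k\<bar> \<le> L * norm e"
        using h[of k] by (simp add: divide_simps mult_ac)
      then show "norm (B k x) \<le> \<bar>\<phi> x\<bar> * (L * norm e)"
        unfolding B_def real_norm_def abs_mult by (intro mult_left_mono) auto
    qed
  qed (auto intro!: meas B_cont)
  ultimately have "(LINT x|lebesgue. u x * (g x \<bullet> e)) = (LINT x|lebesgue. \<phi> x * (G x \<bullet> - e))"
    unfolding AB by (rule LIMSEQ_unique)
  then show ?thesis by simp
qed

text \<open>Asking for the Lipschitz bound on the whole space lets the difference quotients be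
  estimated for all step widths, with no care near the boundary. Discrete functions with zero
  boundary values qualify through their extension by zero.\<close>

lemma weak_gradient_lipschitz:
  fixes u :: "'a::euclidean_space \<Rightarrow> real"
  assumes u: "L-lipschitz_on UNIV u"
    and G: "G \<in> borel_measurable lebesgue" and bound: "\<And>x. norm (G x) \<le> B"
    and N: "negligible N" and deriv: "\<And>x. x \<in> \<Omega> - N \<Longrightarrow> GDERIV u x :> G x"
  shows "weak_gradient \<Omega> u G"
  unfolding weak_gradient_def
proof (intro conjI allI impI)
  have u_cont: "continuous_on UNIV u" using u by (rule lipschitz_on_continuous_on)
  show "locally_integrable \<Omega> u"
    unfolding locally_integrable_def set_integrable_def
  proof (intro allI impI)
    fix K assume K: "compact K \<and> K \<subseteq> \<Omega>"
    have "integrable lborel (\<lambda>x. indicator K x *\<^sub>R u x)"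
      using K by (intro borel_integrable_compact continuous_on_subset[OF u_cont]) auto
    then show "integrable lebesgue (\<lambda>x. indicator K x *\<^sub>R u x)"
      using integrable_completion borel_measurable_integrable by blast
  qed
  show "locally_integrable \<Omega> G"
    unfolding locally_integrable_def set_integrable_def
  proof (intro allI impI)
    fix K assume K: "compact K \<and> K \<subseteq> \<Omega>"
    have "K \<in> sets lebesgue" using K by (simp add: lmeasurable_compact fmeasurableD)
    then show "integrable lebesgue (\<lambda>x. indicator K x *\<^sub>R G x)"
      by (intro integrable_compact_support[of _ K B] borel_measurable_scaleR G)
        (use K bound in auto)
  qed
  fix \<phi> g assume test: "C1_test_fun \<Omega> \<phi> g"
  define S where "S = closure {x. \<phi> x \<noteq> 0}"
  have K: "compact S" "S \<subseteq> \<Omega>" and g_cont: "continuous_on UNIV g"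
    and \<phi>_der: "\<And>x. GDERIV \<phi> x :> g x"
    using test unfolding C1_test_fun_def S_def by blast+
  have zero: "\<phi> x = 0" "g x = 0" if "x \<notin> S" for x
    using C1_test_fun_zero[OF test, of x] that unfolding S_def by blast+
  have \<phi>_cont: "continuous_on UNIV \<phi>"
    by (intro continuous_at_imp_continuous_on ballI has_derivative_continuous[OF \<phi>_der[unfolded gderiv_def]])
  obtain C\<phi> where C\<phi>: "\<And>x. \<bar>\<phi> x\<bar> \<le> C\<phi>"
    using continuous_compact_support(2)[OF \<phi>_cont K(1) zero(1)] by auto
  have i1: "integrable lebesgue (\<lambda>x. u x *\<^sub>R g x)"
    by (rule continuous_compact_support(1)[OF _ K(1)])
      (auto simp: zero intro!: continuous_intros u_cont g_cont)
  have "\<phi> \<in> borel_measurable lebesgue"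
    using \<phi>_cont by (simp add: measurable_completion borel_measurable_continuous_onI)
  then have i2: "integrable lebesgue (\<lambda>x. \<phi> x *\<^sub>R G x)"
    by (intro integrable_compact_support[OF _ _ K(1), of _ "C\<phi> * B"] borel_measurable_scaleR G)
      (auto simp: zero intro!: mult_mono C\<phi> bound order.trans[OF abs_ge_zero C\<phi>])
  have "indicator \<Omega> x *\<^sub>R (u x *\<^sub>R g x) = u x *\<^sub>R g x" "indicator \<Omega> x *\<^sub>R (\<phi> x *\<^sub>R G x) = \<phi> x *\<^sub>R G x" for x
    using zero[of x] K(2) by (auto simp: indicator_def)
  then have "(LINT x:\<Omega>|lebesgue. u x *\<^sub>R g x) = (LINT x|lebesgue. u x *\<^sub>R g x)"
    "(LINT x:\<Omega>|lebesgue. \<phi> x *\<^sub>R G x) = (LINT x|lebesgue. \<phi> x *\<^sub>R G x)"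
    unfolding set_lebesgue_integral_def by (simp_all only:)
  moreover have "(LINT x|lebesgue. u x *\<^sub>R g x) = - (LINT x|lebesgue. \<phi> x *\<^sub>R G x)"
  proof (rule euclidean_eqI)
    fix e :: 'a
    show "(LINT x|lebesgue. u x *\<^sub>R g x) \<bullet> e = - (LINT x|lebesgue. \<phi> x *\<^sub>R G x) \<bullet> e"
      using integration_by_parts_lipschitz[OF u G N deriv test, of e]
        integral_inner_left[of e, OF i1] integral_inner_left[of e, OF i2] by simp
  qed
  ultimately show "(LINT x:\<Omega>|lebesgue. u x *\<^sub>R g x) = - (LINT x:\<Omega>|lebesgue. \<phi> x *\<^sub>R G x)"
    by simp
qed

section \<open>Time averages of the load\<close>

text \<open>Completeness of \<open>lebesgue\<close> makes \<open>f\<close> measurable as soon as it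
  agrees almost everywhere with a measurable function, so measurability is a conclusion and not a
  premise.\<close>

lemma lebesgue_integral_cong_AE:
  fixes f g :: "'a::euclidean_space \<Rightarrow> 'b::euclidean_space"
  assumes g: "g \<in> borel_measurable lebesgue" and ae: "AE x in lebesgue. f x = g x"
  shows "f \<in> borel_measurable lebesgue" "(LINT x|lebesgue. f x) = (LINT x|lebesgue. g x)"
    "integrable lebesgue f \<longleftrightarrow> integrable lebesgue g"
proof -
  have "AE x in lebesgue. g x = f x" using ae by (simp add: eq_commute)
  then show f: "f \<in> borel_measurable lebesgue" by (rule borel_measurable_AE[OF g])
  show "(LINT x|lebesgue. f x) = (LINT x|lebesgue. g x)" by (rule integral_cong_AE[OF f g ae])
  show "integrable lebesgue f \<longleftrightarrow> integrable lebesgue g" by (rule integrable_cong_AE[OF f g ae])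
qed

lemma time_partition_tau_pos:
  assumes tp: "time_partition T N t" and n: "n \<in> {1..N}"
  shows "0 < tau t n"
proof -
  have "n - 1 < N" using n by auto
  then have "t (n - 1) < t (Suc (n - 1))" using tp unfolding time_partition_def by blast
  then show ?thesis using n by (simp add: tau_def)
qed

text \<open>A slice of a Lebesgue measurable function need not be measurable. Fubini is therefore
  applied to a Borel function \<open>h'\<close> that equals the load almost everywhere in
  space-time; for almost every \<open>x\<close> the slices then agree almost everywhere. The
  constant \<open>A\<close> is the L1 norm of the load over space-time, the same for all
  partitions.\<close>

lemma f_avg_integrable:
  fixes \<Omega> :: "'a::euclidean_space set"
  assumes op: "open \<Omega>" and bounded: "bounded \<Omega>" and f: "f \<in> L2_L2 \<Omega> T"
  obtains A where
    "\<And>N t n. time_partition T N t \<Longrightarrow> n \<in> {1..N} \<Longrightarrow> set_integrable lebesgue \<Omega> (f_avg f t n)"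
    "\<And>N t. time_partition T N t \<Longrightarrow> (\<Sum>n=1..N. tau t n * L1_norm \<Omega> (f_avg f t n)) \<le> A"
proof -
  let ?D = "\<Omega> \<times> {0<..<T}"
  define h where "h z = indicator ?D z *\<^sub>R (case z of (x, s) \<Rightarrow> f x s)" for z
  have h_meas: "h \<in> borel_measurable lebesgue"
    using f unfolding L2_L2_def set_borel_measurable_def h_def by auto
  have h_sq: "integrable lebesgue (\<lambda>z. (h z)\<^sup>2)"
  proof -
    have "(\<lambda>z. (h z)\<^sup>2) = (\<lambda>z. indicator ?D z *\<^sub>R (case z of (x, s) \<Rightarrow> (f x s)\<^sup>2))"
      by (auto simp: h_def indicator_def fun_eq_iff)
    then show ?thesis using f unfolding L2_L2_def set_integrable_def by simp
  qed
  have "open ?D" "bounded ?D" using op bounded by (auto intro: open_Times bounded_Times)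
  then have "?D \<in> lmeasurable" by (simp add: lmeasurable_open)
  then have ind: "integrable lebesgue (indicat_real ?D)"
    by (simp add: fmeasurable_def integrable_real_indicator del: emeasure_completion)
  have h_int: "integrable lebesgue h"
  proof (rule Bochner_Integration.integrable_bound[OF Bochner_Integration.integrable_add[OF ind h_sq] h_meas])
    show "AE z in lebesgue. norm (h z) \<le> norm (indicat_real ?D z + (h z)\<^sup>2)"
    proof (rule AE_I2)
      fix z
      \<comment> \<open>Expanding the square of \<open>1 - \<bar>h z\<bar>\<close> shows that square
        integrability on a bounded set gives integrability.\<close>
      have "\<bar>h z\<bar> \<le> 1 + (h z)\<^sup>2"
        using zero_le_power2[of "1 - \<bar>h z\<bar>"] abs_ge_zero[of "h z"] unfolding power2_diff by simp
      then show "norm (h z) \<le> norm (indicat_real ?D z + (h z)\<^sup>2)"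
        by (cases "z \<in> ?D") (simp_all, simp add: h_def)
    qed
  qed
  obtain h' where h'[measurable]: "h' \<in> borel_measurable lborel" and hh': "AE z in lborel. h z = h' z"
    using completion_ex_borel_measurable_real[OF h_meas] by blast
  have h'_leb: "h' \<in> borel_measurable lebesgue" using h' by (simp add: measurable_completion)
  have "integrable lebesgue h'"
    using h_int lebesgue_integral_cong_AE(3)[OF h'_leb, of h] AE_completion[OF hh'] by blast
  then have h'_int: "integrable (lborel \<Otimes>\<^sub>M lborel) h'"
    using integrable_completion[OF h'] by (simp add: lborel_prod)
  define good where "good x \<longleftrightarrow> (AE s in lborel. h (x, s) = h' (x, s))" for x
  have good: "AE x in lborel. good x"
    unfolding good_def by (rule lborel_pair.AE_pair) (use hh' in \<open>simp only: lborel_prod\<close>)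
  define slice where "slice a b x = (LINT s|lborel. indicator {a..b} s * h' (x, s))" for a b x
  define absslice where "absslice a b x = (LINT s|lborel. indicator {a..b} s * \<bar>h' (x, s)\<bar>)" for a b x
  have slice_int: "integrable lborel (slice a b)" and absslice_int: "integrable lborel (absslice a b)"
    and sect_int: "AE x in lborel. integrable lborel (\<lambda>s. h' (x, s))" for a b
  proof -
    have h'p[measurable]: "h' \<in> borel_measurable (lborel \<Otimes>\<^sub>M lborel)" using h' by (simp add: lborel_prod)
    have "integrable (lborel \<Otimes>\<^sub>M lborel) (\<lambda>z. indicator {a..b} (snd z) * h' z)"
      by (rule Bochner_Integration.integrable_bound[OF h'_int]) (auto simp: indicator_def abs_mult)
    from lborel_pair.integrable_fst'[OF this] show "integrable lborel (slice a b)"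
      by (simp add: slice_def[abs_def])
    have "integrable (lborel \<Otimes>\<^sub>M lborel) (\<lambda>z. indicator {a..b} (snd z) * \<bar>h' z\<bar>)"
      by (rule Bochner_Integration.integrable_bound[OF h'_int]) (auto simp: indicator_def abs_mult)
    from lborel_pair.integrable_fst'[OF this] show "integrable lborel (absslice a b)"
      by (simp add: absslice_def[abs_def])
    show "AE x in lborel. integrable lborel (\<lambda>s. h' (x, s))"
      using lborel_pair.AE_integrable_fst'[OF h'_int] .
  qed
  have integral_eq: "(LINT s:{a..b}|lebesgue. f x s) = slice a b x"
    if x: "x \<in> \<Omega>" "good x" and ab: "0 \<le> a" "b \<le> T" for x a b
  proof -
    have [measurable]: "(\<lambda>s. h' (x, s)) \<in> borel_measurable lborel"
      using measurable_compose[OF borel_measurable_continuous_onI[of "\<lambda>s. (x, s)"], of h' borel] h'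
      by (simp add: continuous_intros)
    \<comment> \<open>The function \<open>h\<close> agrees with \<open>f\<close> on the open time
      interval only, whereas the slices run over closed intervals; the two end points form a null
      set.\<close>
    have "AE s in lborel. s \<noteq> 0 \<and> s \<noteq> T"
      using AE_lborel_singleton[of 0] AE_lborel_singleton[of T] by eventually_elim auto
    moreover have "AE s in lborel. h (x, s) = h' (x, s)" using x by (simp add: good_def)
    ultimately have "AE s in lborel. indicator {a..b} s *\<^sub>R f x s = indicator {a..b} s * h' (x, s)"
    proof eventually_elim
      case (elim s)
      show ?case
      proof (cases "s \<in> {a..b}")
        case True
        then have "(x, s) \<in> ?D" using elim(1) ab x by auto
        then have "h (x, s) = f x s" by (simp add: h_def)
        then show ?thesis using elim by simp
      qed simp
    qed
    then have ae: "AE s in lebesgue. indicator {a..b} s *\<^sub>R f x s = indicator {a..b} s * h' (x, s)"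
      by (rule AE_completion)
    have m: "(\<lambda>s. indicator {a..b} s * h' (x, s)) \<in> borel_measurable lborel"
      by measurable
    have "(LINT s:{a..b}|lebesgue. f x s) = (LINT s|lebesgue. indicator {a..b} s * h' (x, s))"
      unfolding set_lebesgue_integral_def
      by (rule lebesgue_integral_cong_AE(2)[OF _ ae]) (use m in \<open>simp add: measurable_completion\<close>)
    also have "\<dots> = slice a b x"
      unfolding slice_def by (rule integral_completion[OF m])
    finally show ?thesis .
  qed
  have part: "0 \<le> t (n - 1)" "t n \<le> T" "0 < tau t n"
    if tp: "time_partition T N t" and n: "n \<in> {1..N}" for N t n
  proof -
    have mono: "t i \<le> t j" if "i \<le> j" "j \<le> N" for i j
      using that
    proof (induction j rule: dec_induct)
      case (step m)
      then show ?case using tp unfolding time_partition_def by (smt (verit) Suc_le_lessD Suc_leD)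
    qed simp
    show "0 \<le> t (n - 1)" using mono[of 0 "n - 1"] tp n by (auto simp: time_partition_def)
    show "t n \<le> T" using mono[of n N] tp n by (auto simp: time_partition_def)
    show "0 < tau t n" using tp n by (rule time_partition_tau_pos)
  qed
  have \<Omega>[measurable]: "\<Omega> \<in> sets borel" using op by simp
  have fa: "AE x in lebesgue. indicator \<Omega> x *\<^sub>R f_avg f t n x
      = indicator \<Omega> x * ((1 / tau t n) * slice (t (n - 1)) (t n) x)"
    if tp: "time_partition T N t" and n: "n \<in> {1..N}" for N t n
    using AE_completion[OF good]
  proof eventually_elim
    case (elim x)
    then show ?case
      using integral_eq[of x "t (n - 1)" "t n"] part[OF tp n] by (cases "x \<in> \<Omega>") (auto simp: f_avg_def)
  qed
  have int_slice: "integrable lborel (\<lambda>x. indicator \<Omega> x * ((1 / tau t n) * slice (t (n - 1)) (t n) x))" for t n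
    using integrable_real_mult_indicator[of \<Omega> lborel "\<lambda>x. (1 / tau t n) * slice (t (n - 1)) (t n) x"]
      slice_int[of "t (n - 1)" "t n"] by (simp add: mult.commute)
  then have int_slice': "integrable lebesgue (\<lambda>x. indicator \<Omega> x * ((1 / tau t n) * slice (t (n - 1)) (t n) x))" for t n
    using integrable_completion borel_measurable_integrable by blast
  have favg_int: "set_integrable lebesgue \<Omega> (f_avg f t n)"
    if tp: "time_partition T N t" and n: "n \<in> {1..N}" for N t n
    unfolding set_integrable_def
    using lebesgue_integral_cong_AE(3)[OF _ fa[OF tp n]] int_slice' borel_measurable_integrable by blast
  have abs_mono: "\<bar>slice a b x\<bar> \<le> absslice a b x" for a b x
    unfolding slice_def absslice_def
    using integral_abs_bound[of lborel "\<lambda>s. indicator {a..b} s * h' (x, s)"]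
    by (simp add: abs_mult)
  define A where "A = (LINT x|lborel. absslice 0 T x)"
  have sum_le: "(\<Sum>n=1..N. tau t n * L1_norm \<Omega> (f_avg f t n)) \<le> A" if tp: "time_partition T N t" for N t
  proof -
    have "tau t n * L1_norm \<Omega> (f_avg f t n) \<le> (LINT x|lborel. absslice (t (n - 1)) (t n) x)"
      if n: "n \<in> {1..N}" for n
    proof -
      have \<tau>: "0 < tau t n" using part[OF tp n] by simp
      let ?g = "\<lambda>x. indicator \<Omega> x * ((1 / tau t n) * slice (t (n - 1)) (t n) x)"
      have "L1_norm \<Omega> (f_avg f t n) = (LINT x|lebesgue. \<bar>?g x\<bar>)"
        unfolding L1_norm_def set_lebesgue_integral_def
      proof (rule lebesgue_integral_cong_AE(2))
        show "(\<lambda>x. \<bar>?g x\<bar>) \<in> borel_measurable lebesgue"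
          using borel_measurable_integrable[OF int_slice'] by (rule borel_measurable_abs)
        show "AE x in lebesgue. indicator \<Omega> x *\<^sub>R norm (f_avg f t n x) = \<bar>?g x\<bar>"
          using fa[OF tp n] by eventually_elim (auto simp: indicator_def)
      qed
      also have "\<dots> = (LINT x|lborel. \<bar>?g x\<bar>)"
        by (rule integral_completion) (use borel_measurable_integrable[OF int_slice] in \<open>rule borel_measurable_abs\<close>)
      also have "\<dots> \<le> (LINT x|lborel. (1 / tau t n) * absslice (t (n - 1)) (t n) x)"
      proof (rule integral_mono)
        show "integrable lborel (\<lambda>x. \<bar>?g x\<bar>)" by (intro integrable_abs int_slice)
        show "integrable lborel (\<lambda>x. (1 / tau t n) * absslice (t (n - 1)) (t n) x)"
          using absslice_int by simp
        show "\<bar>?g x\<bar> \<le> (1 / tau t n) * absslice (t (n - 1)) (t n) x" for x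
          using \<tau> abs_mono[of "t (n - 1)" "t n" x]
          by (auto simp: indicator_def abs_mult divide_right_mono intro: order.trans[OF abs_ge_zero])
      qed
      also have "\<dots> = (1 / tau t n) * (LINT x|lborel. absslice (t (n - 1)) (t n) x)"
        by simp
      finally show ?thesis using \<tau> by (simp add: field_simps)
    qed
    then have "(\<Sum>n=1..N. tau t n * L1_norm \<Omega> (f_avg f t n))
        \<le> (\<Sum>n=1..N. (LINT x|lborel. absslice (t (n - 1)) (t n) x))"
      by (rule sum_mono)
    also have "\<dots> = (LINT x|lborel. (\<Sum>n=1..N. absslice (t (n - 1)) (t n) x))"
      using absslice_int by (simp add: Bochner_Integration.integral_sum)
    also have "\<dots> = A"
      unfolding A_def
    proof (rule integral_cong_AE)
      show "(\<lambda>x. \<Sum>n=1..N. absslice (t (n - 1)) (t n) x) \<in> borel_measurable lborel"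
        using absslice_int by (intro borel_measurable_sum) auto
      show "absslice 0 T \<in> borel_measurable lborel" using absslice_int by auto
      show "AE x in lborel. (\<Sum>n=1..N. absslice (t (n - 1)) (t n) x) = absslice 0 T x"
        using sect_int
      proof eventually_elim
        case (elim x)
        have si: "integrable lborel (\<lambda>s. indicator {a..b} s * \<bar>h' (x, s)\<bar>)" for a b :: real
          using integrable_real_mult_indicator[OF _ integrable_abs[OF elim], of "{a..b}"]
          by (simp add: mult.commute)
        have "m \<le> N \<Longrightarrow> (\<Sum>n=1..m. absslice (t (n - 1)) (t n) x) = absslice 0 (t m) x" for m
        proof (induction m)
          case 0
          have "AE s in lborel. indicator {0..0} s * \<bar>h' (x, s)\<bar> = 0"
            using AE_lborel_singleton[of 0] by eventually_elim auto
          then have "absslice 0 0 x = 0" unfolding absslice_def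
            by (rule integral_eq_zero_AE)
          then show ?case using tp by (simp add: time_partition_def)
        next
          case (Suc m)
          \<comment> \<open>Consecutive closed intervals overlap only in \<open>t m\<close>, a null
            set, so the slices add up along the partition.\<close>
          have "absslice 0 (t (Suc m)) x
              = (LINT s|lborel. indicator {0..t m} s * \<bar>h' (x, s)\<bar> + indicator {t m..t (Suc m)} s * \<bar>h' (x, s)\<bar>)"
            unfolding absslice_def
          proof (rule integral_cong_AE)
            show "AE s in lborel. indicator {0..t (Suc m)} s * \<bar>h' (x, s)\<bar>
                = indicator {0..t m} s * \<bar>h' (x, s)\<bar> + indicator {t m..t (Suc m)} s * \<bar>h' (x, s)\<bar>"
              using AE_lborel_singleton[of "t m"]
            proof eventually_elim
              case (elim s)
              then show ?case
                using part[OF tp, of "Suc m"] Suc.prems by (auto simp: indicator_def tau_def)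
            qed
          qed (use si borel_measurable_integrable in \<open>auto intro!: borel_measurable_add\<close>)
          also have "\<dots> = absslice 0 (t m) x + absslice (t m) (t (Suc m)) x"
            unfolding absslice_def by (rule Bochner_Integration.integral_add[OF si si])
          finally show ?case using Suc by simp
        qed
        from this[of N] show ?case using tp by (simp add: time_partition_def)
      qed
    qed
    finally show ?thesis .
  qed
  show ?thesis using that favg_int sum_le by blast
qed

section \<open>Finite elements\<close>

text \<open>Moving one point of \<open>C\<close> to the origin turns affine into linear
  independence; prescribed values then extend to a linear functional, which the inner product
  represents by a vector \<open>a\<close>.\<close>

lemma affine_fun_with_values:
  fixes C :: "'a::euclidean_space set" and v :: "'a \<Rightarrow> real"
  assumes "\<not> affine_dependent C"
  obtains a b where "\<And>p. p \<in> C \<Longrightarrow> a \<bullet> p + b = v p"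
proof (cases "C = {}")
  case False
  then obtain c where c: "c \<in> C" by blast
  define B where "B = (\<lambda>x. - c + x) ` (C - {c})"
  have "independent B"
    using assms affine_dependent_iff_dependent2[OF c] by (simp add: B_def)
  then obtain g :: "'a \<Rightarrow> real" where g: "linear g" "\<And>x. x \<in> B \<Longrightarrow> g x = v (c + x) - v c"
    using linear_independent_extend[of B "\<lambda>x. v (c + x) - v c"] by blast
  define a where "a = (\<Sum>i\<in>Basis. g i *\<^sub>R i)"
  have a: "a \<bullet> x = g x" for x
  proof -
    have "g x = (\<Sum>i\<in>Basis. (x \<bullet> i) * g i)"
      by (subst euclidean_representation[of x, symmetric]) (simp add: linear_sum[OF g(1)] linear_cmul[OF g(1)])
    then show ?thesis by (simp add: a_def inner_sum_right inner_commute mult.commute)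
  qed
  show ?thesis
  proof (rule that[of a "v c - g c"])
    fix p assume "p \<in> C"
    then have "p = c \<or> - c + p \<in> B" by (auto simp: B_def)
    then show "a \<bullet> p + (v c - g c) = v p"
    proof
      assume "- c + p \<in> B"
      from g(2)[OF this] show ?thesis
        using linear_diff[OF g(1), of p c] by (simp add: a)
    qed (simp add: a)
  qed
qed (use that in blast)

lemma affine_fun_le_on_hull:
  fixes a :: "'a::euclidean_space"
  assumes "x \<in> convex hull V" "\<And>p. p \<in> V \<Longrightarrow> a \<bullet> p \<le> c"
  shows "a \<bullet> x \<le> c"
  using hull_minimal[of V "{x. a \<bullet> x \<le> c}" convex] assms convex_halfspace_le[of a c] by auto

lemma affine_fun_eq_on_hull:
  fixes a :: "'a::euclidean_space"
  assumes "x \<in> convex hull V" "\<And>p. p \<in> V \<Longrightarrow> a \<bullet> p + b = a' \<bullet> p + b'"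
  shows "a \<bullet> x + b = a' \<bullet> x + b'"
proof -
  have "(a - a') \<bullet> x \<le> b' - b" by (rule affine_fun_le_on_hull[OF assms(1)]) (use assms(2) in \<open>force simp: inner_diff_left\<close>)
  moreover have "(a' - a) \<bullet> x \<le> b - b'" by (rule affine_fun_le_on_hull[OF assms(1)]) (use assms(2) in \<open>force simp: inner_diff_left\<close>)
  ultimately show ?thesis by (simp add: inner_diff_left)
qed

section \<open>Geometry of the domain and of its mesh\<close>

locale fe_mesh =
  fixes \<Omega> :: "'a::euclidean_space set" and \<T> :: "'a set set"
  assumes domain: "convex_polygonal_domain \<Omega>" and mesh: "mesh \<Omega> \<T>"
begin

definition vol :: "'a set \<Rightarrow> real" where "vol \<sigma> = measure lebesgue \<sigma>"

text \<open>Any point of the element would do. Evaluation at \<open>mid \<sigma>\<close> turns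
  piecewise constant fields into functions on the set of elements, over which all later sums
  run.\<close>

definition mid :: "'a set \<Rightarrow> 'a" where "mid \<sigma> = (SOME x. x \<in> \<sigma>)"

abbreviation gr :: "('a \<Rightarrow> real) \<Rightarrow> 'a set \<Rightarrow> 'a" where "gr u \<sigma> \<equiv> grad u (mid \<sigma>)"

lemma open_domain: "open \<Omega>" and convex_domain: "convex \<Omega>" and domain_ne: "\<Omega> \<noteq> {}"
  and bounded_closure: "bounded (closure \<Omega>)"
  using domain polytope_imp_bounded by (auto simp: convex_polygonal_domain_def)

lemma bounded_domain: "bounded \<Omega>"
  using bounded_closure bounded_subset closure_subset by blast

lemma frontier_domain: "frontier \<Omega> = closure \<Omega> - \<Omega>"
  using open_domain by (simp add: frontier_def interior_open)

lemma finite_mesh: "finite \<T>"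
  using mesh by (simp add: mesh_def)

text \<open>\<open>verts\<close> reads the vertices off the closure as extreme points. For an
  affinely independent set the extreme points of its hull are exactly its members, so the vertices
  of the original simplex are recovered from its interior.\<close>

lemma element_hull:
  assumes "\<sigma> \<in> \<T>"
  shows "\<not> affine_dependent (verts \<sigma>)" "card (verts \<sigma>) = Suc DIM('a)"
    "closure \<sigma> = convex hull (verts \<sigma>)" "\<sigma> = interior (convex hull (verts \<sigma>))" "\<sigma> \<noteq> {}"
proof -
  obtain C where C: "\<not> affine_dependent C" "int (card C) = int DIM('a) + 1"
    and \<sigma>: "\<sigma> = interior (convex hull C)"
    using mesh assms unfolding mesh_def simplex_def by metis
  have card: "card C = Suc DIM('a)" using C(2) by simp
  then show ne: "\<sigma> \<noteq> {}" using C(1) interior_convex_hull_eq_empty \<sigma> by blast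
  have "closure \<sigma> = closure (convex hull C)"
    using ne unfolding \<sigma> by (intro convex_closure_interior) auto
  also have "\<dots> = convex hull C"
    using C(1) by (simp add: aff_independent_finite finite_imp_compact_convex_hull compact_imp_closed)
  finally have cl: "closure \<sigma> = convex hull C" .
  then have "verts \<sigma> = C"
    using extreme_point_of_convex_hull_affine_independent[OF C(1)] by (auto simp: verts_def)
  then show "\<not> affine_dependent (verts \<sigma>)" "card (verts \<sigma>) = Suc DIM('a)"
    "closure \<sigma> = convex hull (verts \<sigma>)" "\<sigma> = interior (convex hull (verts \<sigma>))"
    using C(1) card cl \<sigma> by auto
qed

lemma finite_verts: "\<sigma> \<in> \<T> \<Longrightarrow> finite (verts \<sigma>)"
  using element_hull(1) aff_independent_finite by blast

lemma finite_nodes: "finite (nodes \<T>)"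
  unfolding nodes_def using finite_mesh finite_verts by blast

lemma open_element: "\<sigma> \<in> \<T> \<Longrightarrow> open \<sigma>"
  using element_hull(4) by (metis open_interior)

lemma convex_element: "\<sigma> \<in> \<T> \<Longrightarrow> convex \<sigma>"
  using element_hull(4) by (metis convex_convex_hull convex_interior)

lemma mid_in: "\<sigma> \<in> \<T> \<Longrightarrow> mid \<sigma> \<in> \<sigma>"
  unfolding mid_def using element_hull(5) by (simp add: some_in_eq)

lemma closure_domain: "closure \<Omega> = (\<Union>\<sigma>\<in>\<T>. closure \<sigma>)"
  using mesh by (simp add: mesh_def)

lemma closure_element_subset: "\<sigma> \<in> \<T> \<Longrightarrow> closure \<sigma> \<subseteq> closure \<Omega>"
  using closure_domain by blast

text \<open>A convex open set is the interior of its closure, which keeps the open elements off the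
  boundary.\<close>

lemma element_subset: "\<sigma> \<in> \<T> \<Longrightarrow> \<sigma> \<subseteq> \<Omega>"
proof -
  assume \<sigma>: "\<sigma> \<in> \<T>"
  then have "\<sigma> \<subseteq> interior (closure \<Omega>)"
    using closure_element_subset closure_subset open_element by (meson interior_maximal order_trans)
  then show ?thesis
    using convex_domain open_domain by (simp add: convex_interior_closure interior_open)
qed

lemma verts_subset_closure: "\<sigma> \<in> \<T> \<Longrightarrow> verts \<sigma> \<subseteq> closure \<sigma>"
  using element_hull(3) hull_subset by metis

lemma nodes_subset: "nodes \<T> \<subseteq> closure \<Omega>"
  unfolding nodes_def using verts_subset_closure closure_element_subset by blast

lemma elements_eq: "\<sigma> \<in> \<T> \<Longrightarrow> \<sigma>' \<in> \<T> \<Longrightarrow> x \<in> \<sigma> \<Longrightarrow> x \<in> \<sigma>' \<Longrightarrow> \<sigma> = \<sigma>'"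
  using mesh unfolding mesh_def pairwise_def disjnt_def by blast

lemma lmeasurable_element: "\<sigma> \<in> \<T> \<Longrightarrow> \<sigma> \<in> lmeasurable"
  using open_element element_subset bounded_domain by (meson bounded_subset lmeasurable_open)

lemma lmeasurable_domain: "\<Omega> \<in> lmeasurable"
  using open_domain bounded_domain by (simp add: lmeasurable_open)

lemma vol_pos: "\<sigma> \<in> \<T> \<Longrightarrow> 0 < vol \<sigma>"
  unfolding vol_def using lmeasurable_element open_element element_hull(5)
  by (metis negligible_iff_measure open_not_negligible zero_less_measure_iff)

lemma negligible_skeleton: "negligible (\<Omega> - \<Union>\<T>)"
proof -
  have "\<Omega> - \<Union>\<T> \<subseteq> (\<Union>\<sigma>\<in>\<T>. frontier \<sigma>)"
    using closure_domain closure_subset[of \<Omega>] open_element by (fastforce simp: frontier_def interior_open)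
  moreover have "negligible (\<Union>\<sigma>\<in>\<T>. frontier \<sigma>)"
    using finite_mesh convex_element by (intro negligible_Union) (auto intro: negligible_convex_frontier)
  ultimately show ?thesis using negligible_subset by blast
qed

lemma AE_element: "AE x in lebesgue. x \<in> \<Omega> \<longrightarrow> (\<exists>\<sigma>\<in>\<T>. x \<in> \<sigma>)"
proof -
  have "AE x in lebesgue. x \<notin> \<Omega> - \<Union>\<T>"
    using negligible_skeleton AE_not_in unfolding negligible_iff_null_sets by blast
  then show ?thesis by eventually_elim blast
qed

subsection \<open>Piecewise constant functions\<close>

definition step :: "('a set \<Rightarrow> 'b::real_vector) \<Rightarrow> 'a \<Rightarrow> 'b" where
  "step c x = (\<Sum>\<sigma>\<in>\<T>. indicator \<sigma> x *\<^sub>R c \<sigma>)"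

lemma step_on: "\<sigma> \<in> \<T> \<Longrightarrow> x \<in> \<sigma> \<Longrightarrow> step c x = c \<sigma>"
proof -
  assume \<sigma>: "\<sigma> \<in> \<T>" "x \<in> \<sigma>"
  have "step c x = (\<Sum>\<sigma>'\<in>\<T>. if \<sigma>' = \<sigma> then c \<sigma>' else 0)"
    unfolding step_def by (intro sum.cong refl) (use \<sigma> elements_eq in \<open>auto simp: indicator_def\<close>)
  then show ?thesis using \<sigma> finite_mesh by simp
qed

lemma step_off: "x \<notin> \<Union>\<T> \<Longrightarrow> step c x = 0"
  unfolding step_def by (auto intro!: sum.neutral simp: indicator_def)

lemma step_in_S_h: "step c \<in> S_h \<T>" for c :: "'a set \<Rightarrow> 'b::euclidean_space"
proof -
  have "step c constant_on \<sigma>" if "\<sigma> \<in> \<T>" for \<sigma>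
    unfolding constant_on_def using step_on[OF that] by blast
  then show ?thesis unfolding S_h_def using step_off by blast
qed

lemma S_h_on: "\<eta> \<in> S_h \<T> \<Longrightarrow> \<sigma> \<in> \<T> \<Longrightarrow> x \<in> \<sigma> \<Longrightarrow> \<eta> x = \<eta> (mid \<sigma>)"
  unfolding S_h_def constant_on_def using mid_in by force

lemma step_integral:
  fixes c :: "'a set \<Rightarrow> 'b::euclidean_space"
  shows "integrable lebesgue (step c)" "(LINT x|lebesgue. step c x) = (\<Sum>\<sigma>\<in>\<T>. vol \<sigma> *\<^sub>R c \<sigma>)"
proof -
  have "integrable lebesgue (\<lambda>x. indicator \<sigma> x *\<^sub>R c \<sigma>)" 
    "(LINT x|lebesgue. indicator \<sigma> x *\<^sub>R c \<sigma>) = vol \<sigma> *\<^sub>R c \<sigma>" if "\<sigma> \<in> \<T>" for \<sigma>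
  proof -
    have "integrable lebesgue (indicat_real \<sigma>)"
      using lmeasurable_element[OF that] unfolding fmeasurable_def by (auto intro: integrable_real_indicator)
    then show "integrable lebesgue (\<lambda>x. indicator \<sigma> x *\<^sub>R c \<sigma>)" by simp
    show "(LINT x|lebesgue. indicator \<sigma> x *\<^sub>R c \<sigma>) = vol \<sigma> *\<^sub>R c \<sigma>"
      using integral_scaleR_left[of "c \<sigma>" lebesgue "indicat_real \<sigma>"] \<open>integrable lebesgue (indicat_real \<sigma>)\<close>
      by (simp add: vol_def del: integral_scaleR_left)
  qed
  then show "integrable lebesgue (step c)" "(LINT x|lebesgue. step c x) = (\<Sum>\<sigma>\<in>\<T>. vol \<sigma> *\<^sub>R c \<sigma>)"
    unfolding step_def by (simp_all add: Bochner_Integration.integral_sum)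
qed

text \<open>Reduces integrals of piecewise constants to finite sums. The integrand is arbitrary on
  the skeleton, where gradients of discrete functions have no meaning; the skeleton is a null
  set.\<close>

lemma integral_piecewise_const:
  fixes h :: "'a \<Rightarrow> 'b::euclidean_space"
  assumes "\<And>\<sigma> x. \<sigma> \<in> \<T> \<Longrightarrow> x \<in> \<sigma> \<Longrightarrow> h x = c \<sigma>"
  shows "set_integrable lebesgue \<Omega> h" "(LINT x:\<Omega>|lebesgue. h x) = (\<Sum>\<sigma>\<in>\<T>. vol \<sigma> *\<^sub>R c \<sigma>)"
proof -
  have ae: "AE x in lebesgue. indicator \<Omega> x *\<^sub>R h x = step c x"
    using AE_element
  proof eventually_elim
    case (elim x)
    show ?case
    proof (cases "x \<in> \<Omega>")
      case True
      then obtain \<sigma> where \<sigma>: "\<sigma> \<in> \<T>" "x \<in> \<sigma>" using elim by blast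
      then show ?thesis using True by (simp add: step_on assms)
    next
      case False
      then have "x \<notin> \<Union>\<T>" using element_subset by blast
      then show ?thesis using False by (simp add: step_off)
    qed
  qed
  note cong = lebesgue_integral_cong_AE[OF borel_measurable_integrable[OF step_integral(1)] ae]
  show "set_integrable lebesgue \<Omega> h"
    unfolding set_integrable_def using cong(3) step_integral(1) by blast
  show "(LINT x:\<Omega>|lebesgue. h x) = (\<Sum>\<sigma>\<in>\<T>. vol \<sigma> *\<^sub>R c \<sigma>)"
    unfolding set_lebesgue_integral_def using cong(2) step_integral(2) by simp
qed

lemma integral_le_step:
  assumes "set_integrable lebesgue \<Omega> h" "\<And>\<sigma> x. \<sigma> \<in> \<T> \<Longrightarrow> x \<in> \<sigma> \<Longrightarrow> h x \<le> c \<sigma>"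
  shows "(LINT x:\<Omega>|lebesgue. h x) \<le> (\<Sum>\<sigma>\<in>\<T>. vol \<sigma> * c \<sigma>)"
proof -
  have "(LINT x|lebesgue. indicator \<Omega> x *\<^sub>R h x) \<le> (LINT x|lebesgue. step c x)"
  proof (rule integral_mono_AE)
    show "AE x in lebesgue. indicator \<Omega> x *\<^sub>R h x \<le> step c x"
      using AE_element
    proof eventually_elim
      case (elim x)
      show ?case
      proof (cases "x \<in> \<Omega>")
        case True
        then obtain \<sigma> where \<sigma>: "\<sigma> \<in> \<T>" "x \<in> \<sigma>" using elim by blast
        then show ?thesis using True assms(2) by (simp add: step_on)
      next
        case False
        then have "x \<notin> \<Union>\<T>" using element_subset by blast
        then show ?thesis using False by (simp add: step_off)
      qed
    qed
  qed (use assms(1) step_integral(1) in \<open>auto simp: set_integrable_def\<close>)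
  then show ?thesis using step_integral(2)[of c] by (simp add: set_lebesgue_integral_def)
qed

text \<open>A nonempty open element is not a null set, so a condition that is uniform on elements
  cannot fail on one of them and hold almost everywhere.\<close>

lemma AE_domain_iff:
  assumes "\<And>\<sigma> x. \<sigma> \<in> \<T> \<Longrightarrow> x \<in> \<sigma> \<Longrightarrow> P x \<longleftrightarrow> Q \<sigma>"
  shows "(AE x in lebesgue_on \<Omega>. P x) \<longleftrightarrow> (\<forall>\<sigma>\<in>\<T>. Q \<sigma>)"
proof -
  have eq: "(AE x in lebesgue_on \<Omega>. P x) \<longleftrightarrow> (AE x in lebesgue. x \<in> \<Omega> \<longrightarrow> P x)"
    using lmeasurable_domain by (intro AE_restrict_space_iff) (simp add: fmeasurableD)
  show ?thesis unfolding eq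
  proof
    assume ae: "AE x in lebesgue. x \<in> \<Omega> \<longrightarrow> P x"
    show "\<forall>\<sigma>\<in>\<T>. Q \<sigma>"
    proof (rule ballI, rule ccontr)
      fix \<sigma> assume \<sigma>: "\<sigma> \<in> \<T>" and "\<not> Q \<sigma>"
      have "AE x in lebesgue. x \<notin> \<sigma>"
        using ae by (rule AE_mp) (use \<sigma> \<open>\<not> Q \<sigma>\<close> element_subset assms in \<open>auto intro!: AE_I2\<close>)
      then have "\<sigma> \<in> null_sets lebesgue"
        using lmeasurable_element[OF \<sigma>] by (simp add: AE_iff_null_sets fmeasurableD)
      then show False
        using open_not_negligible[OF open_element[OF \<sigma>] element_hull(5)[OF \<sigma>]] by (simp add: negligible_iff_null_sets)
    qed
  next
    assume Q: "\<forall>\<sigma>\<in>\<T>. Q \<sigma>"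
    show "AE x in lebesgue. x \<in> \<Omega> \<longrightarrow> P x"
      using AE_element by eventually_elim (use assms Q in blast)
  qed
qed

section \<open>Continuous piecewise affine functions and their gradients\<close>

lemma U_h_affine:
  assumes u: "u \<in> U_h \<Omega> \<T>" and \<sigma>: "\<sigma> \<in> \<T>"
  obtains b where "\<And>x. x \<in> closure \<sigma> \<Longrightarrow> u x = gr u \<sigma> \<bullet> x + b"
    "\<And>x. x \<in> \<sigma> \<Longrightarrow> GDERIV u x :> gr u \<sigma>" "\<And>x. x \<in> \<sigma> \<Longrightarrow> grad u x = gr u \<sigma>"
proof -
  obtain a b where ab: "\<And>x. x \<in> \<sigma> \<Longrightarrow> u x = a \<bullet> x + b"
    using u \<sigma> unfolding U_h_def by blast
  have der: "GDERIV u x :> a" if "x \<in> \<sigma>" for x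
    by (rule GDERIV_transform_open[OF GDERIV_affine[of a b] open_element[OF \<sigma>] that]) (simp add: ab)
  then have gr: "grad u x = a" if "x \<in> \<sigma>" for x
    unfolding grad_def using that GDERIV_unique by (intro the_equality) blast+
  have "u x = a \<bullet> x + b" if "x \<in> closure \<sigma>" for x
  proof -
    have "continuous_on (closure \<sigma>) u"
      using u closure_element_subset[OF \<sigma>] continuous_on_subset unfolding U_h_def by blast
    then have "continuous_on (closure \<sigma>) (\<lambda>x. u x - a \<bullet> x)"
      by (intro continuous_intros)
    from continuous_constant_on_closure[OF this _ that, of b] show ?thesis
      by (simp add: ab)
  qed
  then show ?thesis using that[of b] der gr mid_in[OF \<sigma>] by simp
qed

lemma U_h_affine_closure:
  assumes "u \<in> U_h \<Omega> \<T>" "\<sigma> \<in> \<T>"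
  shows "\<exists>b. \<forall>x\<in>closure \<sigma>. u x = gr u \<sigma> \<bullet> x + b"
  by (rule U_h_affine[OF assms]) (intro exI ballI)

lemma GDERIV_U_h: "u \<in> U_h \<Omega> \<T> \<Longrightarrow> \<sigma> \<in> \<T> \<Longrightarrow> x \<in> \<sigma> \<Longrightarrow> GDERIV u x :> gr u \<sigma>"
  by (rule U_h_affine)

lemma grad_U_h: "u \<in> U_h \<Omega> \<T> \<Longrightarrow> \<sigma> \<in> \<T> \<Longrightarrow> x \<in> \<sigma> \<Longrightarrow> grad u x = gr u \<sigma>"
  by (rule U_h_affine)

lemma U_h_eqI:
  assumes u: "u \<in> U_h \<Omega> \<T>" and v: "v \<in> U_h \<Omega> \<T>" and eq: "\<And>p. p \<in> nodes \<T> \<Longrightarrow> u p = v p"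
  shows "u = v"
proof
  fix x
  show "u x = v x"
  proof (cases "x \<in> closure \<Omega>")
    case True
    then obtain \<sigma> where \<sigma>: "\<sigma> \<in> \<T>" "x \<in> closure \<sigma>" using closure_domain by blast
    obtain b where b: "\<And>x. x \<in> closure \<sigma> \<Longrightarrow> u x = gr u \<sigma> \<bullet> x + b" using U_h_affine_closure[OF u \<sigma>(1)] by blast
    obtain b' where b': "\<And>x. x \<in> closure \<sigma> \<Longrightarrow> v x = gr v \<sigma> \<bullet> x + b'" using U_h_affine_closure[OF v \<sigma>(1)] by blast
    have "gr u \<sigma> \<bullet> x + b = gr v \<sigma> \<bullet> x + b'"
    proof (rule affine_fun_eq_on_hull)
      show "x \<in> convex hull verts \<sigma>" using \<sigma> element_hull(3) by simp
      fix p assume p: "p \<in> verts \<sigma>"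
      then have "p \<in> nodes \<T>" "p \<in> closure \<sigma>" using \<sigma> verts_subset_closure by (auto simp: nodes_def)
      then show "gr u \<sigma> \<bullet> p + b = gr v \<sigma> \<bullet> p + b'" using eq b b' by metis
    qed
    then show ?thesis using b b' \<sigma> by simp
  next
    case False
    then show ?thesis using u v by (simp add: U_h_def)
  qed
qed

lemma gr_unique:
  assumes "u \<in> U_h \<Omega> \<T>" "\<sigma> \<in> \<T>" "GDERIV u (mid \<sigma>) :> a"
  shows "gr u \<sigma> = a"
  using GDERIV_unique[OF GDERIV_U_h[OF assms(1,2) mid_in[OF assms(2)]] assms(3)] .

lemma U_h_lin:
  assumes u: "u \<in> U_h \<Omega> \<T>" and v: "v \<in> U_h \<Omega> \<T>"
  shows "(\<lambda>x. u x + c * v x) \<in> U_h \<Omega> \<T>"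
    "\<sigma> \<in> \<T> \<Longrightarrow> gr (\<lambda>x. u x + c * v x) \<sigma> = gr u \<sigma> + c *\<^sub>R gr v \<sigma>"
proof -
  have aff: "\<exists>a b. \<forall>x\<in>\<sigma>. u x + c * v x = a \<bullet> x + b" if "\<sigma> \<in> \<T>" for \<sigma>
  proof -
    obtain b where "\<forall>x\<in>closure \<sigma>. u x = gr u \<sigma> \<bullet> x + b"
      using U_h_affine_closure[OF u \<open>\<sigma> \<in> \<T>\<close>] by blast
    moreover obtain b' where "\<forall>x\<in>closure \<sigma>. v x = gr v \<sigma> \<bullet> x + b'"
      using U_h_affine_closure[OF v \<open>\<sigma> \<in> \<T>\<close>] by blast
    ultimately have "\<forall>x\<in>\<sigma>. u x + c * v x = (gr u \<sigma> + c *\<^sub>R gr v \<sigma>) \<bullet> x + (b + c * b')"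
      using closure_subset[of \<sigma>] by (simp add: subset_iff inner_add_left algebra_simps)
    then show ?thesis by blast
  qed
  have cont: "continuous_on (closure \<Omega>) (\<lambda>x. u x + c * v x)"
    using u v unfolding U_h_def by (intro continuous_intros) simp_all
  have out: "u x + c * v x = 0" if "x \<notin> closure \<Omega>" for x
    using u v that unfolding U_h_def by simp
  show mem: "(\<lambda>x. u x + c * v x) \<in> U_h \<Omega> \<T>"
    unfolding U_h_def by (intro CollectI conjI ballI allI impI cont aff out)
  assume \<sigma>: "\<sigma> \<in> \<T>"
  have "GDERIV (\<lambda>x. u x + c * v x) (mid \<sigma>) :> gr u \<sigma> + c *\<^sub>R gr v \<sigma>"
    using GDERIV_U_h[OF u \<sigma> mid_in[OF \<sigma>]] GDERIV_U_h[OF v \<sigma> mid_in[OF \<sigma>]]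
    unfolding gderiv_def by (auto intro!: derivative_eq_intros simp: inner_add_right)
  then show "gr (\<lambda>x. u x + c * v x) \<sigma> = gr u \<sigma> + c *\<^sub>R gr v \<sigma>"
    by (rule gr_unique[OF mem \<sigma>])
qed

lemma U_h_zero: "(\<lambda>x. 0) \<in> U_h \<Omega> \<T>" "\<sigma> \<in> \<T> \<Longrightarrow> gr (\<lambda>x. 0) \<sigma> = 0"
proof -
  have "\<exists>a b. \<forall>x\<in>\<sigma>. 0 = a \<bullet> x + b" for \<sigma> :: "'a set"
    by (rule exI[of _ 0], rule exI[of _ 0]) simp
  then show mem: "(\<lambda>x. 0) \<in> U_h \<Omega> \<T>" unfolding U_h_def by auto
  show "\<sigma> \<in> \<T> \<Longrightarrow> gr (\<lambda>x. 0) \<sigma> = 0" using gr_unique[OF mem _ GDERIV_const] by simp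
qed

subsection \<open>Lipschitz continuity and Sobolev norms\<close>

text \<open>The segment from \<open>x\<close> to \<open>y\<close> stays in the convex closure and is
  covered by finitely many closed pieces on each of which the function is affine with slope at most
  \<open>B * norm (y - x)\<close>; such bounds glue over a closed cover of an interval.\<close>

lemma U_h_lipschitz_closure:
  assumes u: "u \<in> U_h \<Omega> \<T>" and B: "0 \<le> B" and gr: "\<And>\<sigma>. \<sigma> \<in> \<T> \<Longrightarrow> norm (gr u \<sigma>) \<le> B"
  shows "B-lipschitz_on (closure \<Omega>) u"
proof (rule lipschitz_onI)
  fix x y assume x: "x \<in> closure \<Omega>" and y: "y \<in> closure \<Omega>"
  define \<gamma> where "\<gamma> s = x + s *\<^sub>R (y - x)" for s :: real
  have \<gamma>_in: "\<gamma> s \<in> closure \<Omega>" if "s \<in> {0..1}" for s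
  proof -
    have "(1 - s) *\<^sub>R x + s *\<^sub>R y \<in> closure \<Omega>"
      using convex_domain that x y by (intro convexD[OF convex_closure]) auto
    then show ?thesis by (simp add: \<gamma>_def algebra_simps)
  qed
  have "(B * norm (y - x))-lipschitz_on {0..1} (\<lambda>s. u (\<gamma> s))"
  proof (rule lipschitz_on_closed_Union[where U = "\<lambda>\<sigma>. \<gamma> -` closure \<sigma>" and I = \<T>])
    show "finite \<T>" by (rule finite_mesh)
    show "0 \<le> B * norm (y - x)" using B by simp
    show "{0..1} \<subseteq> (\<Union>\<sigma>\<in>\<T>. \<gamma> -` closure \<sigma>)" using \<gamma>_in closure_domain by fastforce
    show "closed (\<gamma> -` closure \<sigma>)" for \<sigma>
      unfolding \<gamma>_def by (intro continuous_closed_vimage continuous_intros) auto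
    fix \<sigma> assume \<sigma>: "\<sigma> \<in> \<T>"
    obtain b where b: "\<And>x. x \<in> closure \<sigma> \<Longrightarrow> u x = gr u \<sigma> \<bullet> x + b" using U_h_affine_closure[OF u \<sigma>] by blast
    show "(B * norm (y - x))-lipschitz_on (\<gamma> -` closure \<sigma>) (\<lambda>s. u (\<gamma> s))"
    proof (rule lipschitz_onI)
      fix s s' assume "s \<in> \<gamma> -` closure \<sigma>" "s' \<in> \<gamma> -` closure \<sigma>"
      then have "u (\<gamma> s) - u (\<gamma> s') = (s - s') * (gr u \<sigma> \<bullet> (y - x))"
        by (simp add: b \<gamma>_def inner_add_right algebra_simps)
      moreover have "\<bar>gr u \<sigma> \<bullet> (y - x)\<bar> \<le> B * norm (y - x)"
        using Cauchy_Schwarz_ineq2[of "gr u \<sigma>" "y - x"] mult_right_mono[OF gr[OF \<sigma>] norm_ge_zero[of "y - x"]]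
        by linarith
      ultimately show "dist (u (\<gamma> s)) (u (\<gamma> s')) \<le> B * norm (y - x) * dist s s'"
        by (simp add: dist_real_def abs_mult mult.commute mult_left_mono)
    qed (use B in simp)
  qed
  from lipschitz_onD[OF this, of 0 1] show "dist (u x) (u y) \<le> B * dist x y"
    by (simp add: \<gamma>_def dist_norm norm_minus_commute)
qed (rule B)

text \<open>A segment that leaves the closure crosses the frontier, where \<open>u\<close> vanishes;
  the extension by zero thus keeps the constant \<open>B\<close>.\<close>

lemma U_h_lipschitz:
  assumes u: "u \<in> U_h \<Omega> \<T>" and B: "0 \<le> B" and gr: "\<And>\<sigma>. \<sigma> \<in> \<T> \<Longrightarrow> norm (gr u \<sigma>) \<le> B"
    and zero: "\<And>x. x \<in> frontier \<Omega> \<Longrightarrow> u x = 0"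
  shows "B-lipschitz_on UNIV u"
proof (rule lipschitz_onI)
  note lip = lipschitz_onD[OF U_h_lipschitz_closure[OF u B gr]]
  have out: "u x = 0" if "x \<notin> closure \<Omega>" for x using u that by (simp add: U_h_def)
  have in_out: "\<bar>u x\<bar> \<le> B * dist x y" if x: "x \<in> closure \<Omega>" and y: "y \<notin> closure \<Omega>" for x y
  proof -
    have "closed_segment x y \<inter> frontier (closure \<Omega>) \<noteq> {}"
      using x y by (intro connected_Int_frontier) auto
    then obtain z where z: "z \<in> closed_segment x y" "z \<in> frontier \<Omega>"
      using open_domain convex_domain by (auto simp: frontier_def convex_interior_closure interior_open)
    then have "z \<in> closure \<Omega>" by (simp add: frontier_domain)
    then have "\<bar>u x\<bar> \<le> B * dist x z" using lip[OF _ x, of z] zero[OF z(2)] by (simp add: dist_norm norm_minus_commute)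
    also have "\<dots> \<le> B * dist x y"
      using dist_in_closed_segment[OF z(1)] B by (intro mult_left_mono) (auto simp: dist_commute)
    finally show ?thesis .
  qed
  fix x y
  consider "x \<in> closure \<Omega>" "y \<in> closure \<Omega>" | "x \<in> closure \<Omega>" "y \<notin> closure \<Omega>"
    | "x \<notin> closure \<Omega>" "y \<in> closure \<Omega>" | "x \<notin> closure \<Omega>" "y \<notin> closure \<Omega>" by blast
  then show "dist (u x) (u y) \<le> B * dist x y"
  proof cases
    case 2 then show ?thesis using in_out[of x y] out[of y] by simp
  next
    case 3 then show ?thesis using in_out[of y x] out[of x] by (simp add: dist_commute)
  qed (use lip out B in auto)
qed (rule B)

text \<open>Every point of the closure lies within one diameter of a boundary point, where
  \<open>u\<close> vanishes. This is the origin of the constant \<open>H\<close> in the stability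
  estimate.\<close>

lemma U_h_bound:
  assumes u: "u \<in> U_h \<Omega> \<T>" and B: "0 \<le> B" and gr: "\<And>\<sigma>. \<sigma> \<in> \<T> \<Longrightarrow> norm (gr u \<sigma>) \<le> B"
    and zero: "\<And>x. x \<in> frontier \<Omega> \<Longrightarrow> u x = 0"
  shows "\<bar>u x\<bar> \<le> B * diameter (closure \<Omega>)"
proof (cases "x \<in> closure \<Omega>")
  case True
  have "\<Omega> \<noteq> UNIV" using bounded_domain by auto
  then obtain z where z: "z \<in> frontier \<Omega>" using frontier_not_empty domain_ne by blast
  then have "z \<in> closure \<Omega>" by (simp add: frontier_domain)
  then have "dist x z \<le> diameter (closure \<Omega>)"
    using diameter_bounded_bound[OF bounded_closure True] by simp
  then have "B * dist x z \<le> B * diameter (closure \<Omega>)" using B by (rule mult_left_mono)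
  moreover have "\<bar>u x\<bar> \<le> B * dist x z"
    using lipschitz_onD[OF U_h_lipschitz[OF u B gr zero], of x z] zero[OF z] by simp
  ultimately show ?thesis by simp
next
  case False
  then show ?thesis using u B bounded_closure by (simp add: U_h_def diameter_ge_0)
qed

lemma U_h_weak_gradient:
  assumes u: "u \<in> U_h \<Omega> \<T>" and zero: "\<And>x. x \<in> frontier \<Omega> \<Longrightarrow> u x = 0"
  shows "weak_gradient \<Omega> u (step (gr u))"
proof -
  define B where "B = (\<Sum>\<sigma>\<in>\<T>. norm (gr u \<sigma>))"
  have gr: "norm (gr u \<sigma>) \<le> B" if "\<sigma> \<in> \<T>" for \<sigma>
    unfolding B_def using that finite_mesh by (intro member_le_sum) auto
  have B: "0 \<le> B" by (simp add: B_def sum_nonneg)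
  show ?thesis
  proof (rule weak_gradient_lipschitz[OF U_h_lipschitz[OF u B gr zero] _ _ negligible_skeleton])
    show "step (gr u) \<in> borel_measurable lebesgue" using step_integral(1) by (rule borel_measurable_integrable)
    show "norm (step (gr u) x) \<le> B" for x
    proof (cases "x \<in> \<Union>\<T>")
      case True
      then show ?thesis using gr by (auto simp: step_on)
    qed (simp add: step_off B)
    fix x assume "x \<in> \<Omega> - (\<Omega> - \<Union>\<T>)"
    then obtain \<sigma> where \<sigma>: "\<sigma> \<in> \<T>" "x \<in> \<sigma>" by blast
    then show "GDERIV u x :> step (gr u) x" using GDERIV_U_h[OF u \<sigma>] step_on[OF \<sigma>, of "gr u"] by simp
  qed
qed

lemma U_h_measurable: "u \<in> U_h \<Omega> \<T> \<Longrightarrow> u \<in> borel_measurable (lebesgue_on \<Omega>)"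
proof -
  assume u: "u \<in> U_h \<Omega> \<T>"
  then have "continuous_on \<Omega> u"
    unfolding U_h_def using continuous_on_subset closure_subset by blast
  then show ?thesis
    using lmeasurable_domain by (intro continuous_imp_measurable_on_sets_lebesgue) (auto simp: fmeasurableD)
qed

lemma W1inf_norm_le:
  assumes u: "u \<in> U_h \<Omega> \<T>" and B: "0 \<le> B" and gr: "\<And>\<sigma>. \<sigma> \<in> \<T> \<Longrightarrow> norm (gr u \<sigma>) \<le> B"
    and zero: "\<And>x. x \<in> frontier \<Omega> \<Longrightarrow> u x = 0"
  shows "W1inf_norm \<Omega> u \<le> ereal (max (B * diameter (closure \<Omega>)) B)"
proof -
  have "Linf_norm \<Omega> u \<le> ereal (B * diameter (closure \<Omega>))"
    unfolding Linf_norm_def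
  proof (rule esssup_I)
    show "(\<lambda>x. ereal (norm (u x))) \<in> borel_measurable (lebesgue_on \<Omega>)"
      using U_h_measurable[OF u] by measurable
    show "AE x in lebesgue_on \<Omega>. ereal (norm (u x)) \<le> ereal (B * diameter (closure \<Omega>))"
      using U_h_bound[OF u B gr zero] by (intro AE_I2) simp
  qed
  moreover have "Linf_norm \<Omega> (step (gr u)) \<le> ereal B"
    unfolding Linf_norm_def
  proof (rule esssup_I)
    have "step (gr u) \<in> borel_measurable lebesgue"
      using step_integral(1) by (rule borel_measurable_integrable)
    then have "step (gr u) \<in> borel_measurable (lebesgue_on \<Omega>)"
      by (rule measurable_restrict_space1)
    then show "(\<lambda>x. ereal (norm (step (gr u) x))) \<in> borel_measurable (lebesgue_on \<Omega>)"
      by measurable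
    show "AE x in lebesgue_on \<Omega>. ereal (norm (step (gr u) x)) \<le> ereal B"
    proof (intro AE_I2)
      fix x
      show "ereal (norm (step (gr u) x)) \<le> ereal B"
      proof (cases "x \<in> \<Union>\<T>")
        case True
        then show ?thesis using gr by (auto simp: step_on)
      qed (simp add: step_off B)
    qed
  qed
  ultimately have "max (Linf_norm \<Omega> u) (Linf_norm \<Omega> (step (gr u)))
      \<le> max (ereal (B * diameter (closure \<Omega>))) (ereal B)"
    by (rule max.mono)
  also have "\<dots> = ereal (max (B * diameter (closure \<Omega>)) B)" by simp
  finally have "max (Linf_norm \<Omega> u) (Linf_norm \<Omega> (step (gr u)))
      \<le> ereal (max (B * diameter (closure \<Omega>)) B)" .
  then show ?thesis
    unfolding W1inf_norm_def
    using U_h_weak_gradient[OF u zero] by (intro INF_lower2[of "step (gr u)"]) simp_all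
qed

text \<open>Zero boundary values make the extension by zero Lipschitz, with weak gradient
  \<open>step (gr u)\<close>, and this yields the finite Sobolev norm. Membership thereby becomes a
  question about values only.\<close>

lemma U0_h_iff: "u \<in> U0_h \<Omega> \<T> \<longleftrightarrow> u \<in> U_h \<Omega> \<T> \<and> (\<forall>x\<in>frontier \<Omega>. u x = 0)"
proof
  assume "u \<in> U0_h \<Omega> \<T>"
  then show "u \<in> U_h \<Omega> \<T> \<and> (\<forall>x\<in>frontier \<Omega>. u x = 0)" by (auto simp: U0_h_def W1inf_0_def)
next
  assume u: "u \<in> U_h \<Omega> \<T> \<and> (\<forall>x\<in>frontier \<Omega>. u x = 0)"
  define B where "B = (\<Sum>\<sigma>\<in>\<T>. norm (gr u \<sigma>))"
  have gr: "norm (gr u \<sigma>) \<le> B" if "\<sigma> \<in> \<T>" for \<sigma>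
    unfolding B_def using that finite_mesh by (intro member_le_sum) auto
  have B: "0 \<le> B" by (simp add: B_def sum_nonneg)
  have "W1inf_norm \<Omega> u \<le> ereal (max (B * diameter (closure \<Omega>)) B)"
    by (rule W1inf_norm_le) (use u B gr in auto)
  then have "W1inf_norm \<Omega> u < \<infinity>" by (rule le_less_trans) (simp only: less_ereal.simps)
  then show "u \<in> U0_h \<Omega> \<T>" using u by (auto simp: U0_h_def W1inf_0_def W1inf_def U_h_def)
qed

lemma U0_h_U_h: "u \<in> U0_h \<Omega> \<T> \<Longrightarrow> u \<in> U_h \<Omega> \<T>"
  and U0_h_frontier: "u \<in> U0_h \<Omega> \<T> \<Longrightarrow> x \<in> frontier \<Omega> \<Longrightarrow> u x = 0"
  by (auto simp: U0_h_iff)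

lemma U0_h_lin: "u \<in> U0_h \<Omega> \<T> \<Longrightarrow> v \<in> U0_h \<Omega> \<T> \<Longrightarrow> (\<lambda>x. u x + c * v x) \<in> U0_h \<Omega> \<T>"
  by (auto simp: U0_h_iff U_h_lin)

lemma U0_h_diff:
  assumes "u \<in> U0_h \<Omega> \<T>" "v \<in> U0_h \<Omega> \<T>"
  shows "(\<lambda>x. u x - v x) \<in> U0_h \<Omega> \<T>" "\<sigma> \<in> \<T> \<Longrightarrow> gr (\<lambda>x. u x - v x) \<sigma> = gr u \<sigma> - gr v \<sigma>"
  using U0_h_lin[OF assms, of "-1"] U_h_lin(2)[OF assms[THEN U0_h_U_h], of \<sigma> "-1"] by simp_all

lemma U0_h_sum:
  assumes "finite I" "\<And>i. i \<in> I \<Longrightarrow> w i \<in> U0_h \<Omega> \<T>"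
  shows "(\<lambda>x. \<Sum>i\<in>I. c i * w i x) \<in> U0_h \<Omega> \<T> \<and>
    (\<forall>\<sigma>\<in>\<T>. gr (\<lambda>x. \<Sum>i\<in>I. c i * w i x) \<sigma> = (\<Sum>i\<in>I. c i *\<^sub>R gr (w i) \<sigma>))"
  using assms
proof (induction I rule: finite_induct)
  case empty
  then show ?case using U_h_zero by (simp add: U0_h_iff)
next
  case (insert i I)
  let ?s = "\<lambda>x. \<Sum>i\<in>I. c i * w i x"
  have s: "?s \<in> U0_h \<Omega> \<T>" "\<forall>\<sigma>\<in>\<T>. gr ?s \<sigma> = (\<Sum>i\<in>I. c i *\<^sub>R gr (w i) \<sigma>)"
    and wi: "w i \<in> U0_h \<Omega> \<T>" using insert by auto
  have "(\<lambda>x. \<Sum>i\<in>insert i I. c i * w i x) = (\<lambda>x. ?s x + c i * w i x)"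
    using insert by (simp add: add.commute)
  then show ?case
    using U0_h_lin[OF s(1) wi, of "c i"] U_h_lin(2)[OF s(1)[THEN U0_h_U_h] wi[THEN U0_h_U_h], of _ "c i"] s(2) insert
    by (simp add: add.commute)
qed

text \<open>The intersection of the closed elements is a face of \<open>\<sigma>\<close>, hence the
  hull of some vertices \<open>c\<close> of it. Extreme points of a face are extreme in the whole
  set, and the intersection is a face of \<open>\<sigma>'\<close> as well, so \<open>c\<close>
  consists of common vertices.\<close>

lemma conforming:
  assumes \<sigma>: "\<sigma> \<in> \<T>" and \<sigma>': "\<sigma>' \<in> \<T>" and x: "x \<in> closure \<sigma>" "x \<in> closure \<sigma>'"
  shows "x \<in> convex hull (verts \<sigma> \<inter> verts \<sigma>')"
proof -
  have tri: "triangulation (closure ` \<T>)" using mesh by (simp add: mesh_def)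
  have face: "closure \<sigma> \<inter> closure \<sigma>' face_of closure \<sigma>"
    using tri \<sigma> \<sigma>' unfolding triangulation_def by blast
  have face': "closure \<sigma> \<inter> closure \<sigma>' face_of closure \<sigma>'"
    using tri \<sigma> \<sigma>' unfolding triangulation_def by (metis Int_commute imageI)
  obtain c where c: "c \<subseteq> verts \<sigma>" "closure \<sigma> \<inter> closure \<sigma>' = convex hull c"
    using face face_of_convex_hull_affine_independent[OF element_hull(1)[OF \<sigma>]] element_hull(3)[OF \<sigma>] by auto
  have "c \<subseteq> verts \<sigma>'"
  proof
    fix p assume p: "p \<in> c"
    then have "p extreme_point_of closure \<sigma>" using c(1) by (auto simp: verts_def)
    moreover have "p \<in> closure \<sigma> \<inter> closure \<sigma>'" unfolding c(2) by (rule hull_inc[OF p])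
    ultimately have "p extreme_point_of (closure \<sigma> \<inter> closure \<sigma>')"
      unfolding extreme_point_of_face[OF face] by simp
    then have "p extreme_point_of closure \<sigma>'"
      unfolding extreme_point_of_face[OF face'] by simp
    then show "p \<in> verts \<sigma>'" by (simp add: verts_def)
  qed
  then have "convex hull c \<subseteq> convex hull (verts \<sigma> \<inter> verts \<sigma>')" using c(1) by (intro hull_mono) blast
  then show ?thesis using x c(2) by blast
qed

text \<open>Affine pieces with the given vertex values agree on intersections of closed elements by
  \<open>conforming\<close>, so it does not matter which element containing \<open>x\<close> is
  chosen; continuity follows by pasting finitely many closed pieces.\<close>

lemma interpolant_exists: "\<exists>u\<in>U_h \<Omega> \<T>. \<forall>p\<in>nodes \<T>. u p = v p"
proof -
  have "\<exists>a b. \<forall>p\<in>verts \<sigma>. a \<bullet> p + b = v p" if "\<sigma> \<in> \<T>" for \<sigma>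
    by (rule affine_fun_with_values[OF element_hull(1)[OF that], of v]) blast
  then obtain a b where ab: "\<And>\<sigma> p. \<sigma> \<in> \<T> \<Longrightarrow> p \<in> verts \<sigma> \<Longrightarrow> a \<sigma> \<bullet> p + b \<sigma> = v p"
    by metis
  define u where "u x = (if x \<in> closure \<Omega> then
      (let \<sigma> = SOME \<sigma>. \<sigma> \<in> \<T> \<and> x \<in> closure \<sigma> in a \<sigma> \<bullet> x + b \<sigma>) else 0)" for x
  have u: "u x = a \<sigma> \<bullet> x + b \<sigma>" if \<sigma>: "\<sigma> \<in> \<T>" "x \<in> closure \<sigma>" for x \<sigma>
  proof -
    define \<sigma>' where "\<sigma>' = (SOME \<sigma>. \<sigma> \<in> \<T> \<and> x \<in> closure \<sigma>)"
    have \<sigma>': "\<sigma>' \<in> \<T> \<and> x \<in> closure \<sigma>'"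
      unfolding \<sigma>'_def by (rule someI[of _ \<sigma>]) (use \<sigma> in blast)
    have "x \<in> closure \<Omega>" using \<sigma> closure_element_subset by blast
    then have "u x = a \<sigma>' \<bullet> x + b \<sigma>'" by (simp add: u_def \<sigma>'_def Let_def)
    also have "\<dots> = a \<sigma> \<bullet> x + b \<sigma>"
      by (rule affine_fun_eq_on_hull[OF conforming[of \<sigma>' \<sigma>]]) (use \<sigma> \<sigma>' ab in auto)
    finally show ?thesis .
  qed
  have "continuous_on (closure \<Omega>) u"
    unfolding closure_domain
  proof (rule continuous_on_closed_Union[OF finite_mesh])
    fix \<sigma> assume \<sigma>: "\<sigma> \<in> \<T>"
    show "closed (closure \<sigma>)" by simp
    have "continuous_on (closure \<sigma>) (\<lambda>x. a \<sigma> \<bullet> x + b \<sigma>)" by (intro continuous_intros)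
    then show "continuous_on (closure \<sigma>) u"
      by (rule continuous_on_eq) (simp add: u[OF \<sigma>])
  qed
  moreover have "\<forall>\<sigma>\<in>\<T>. \<exists>a b. \<forall>x\<in>\<sigma>. u x = a \<bullet> x + b"
    using u closure_subset by (metis subsetD)
  moreover have "\<forall>x. x \<notin> closure \<Omega> \<longrightarrow> u x = 0" by (simp add: u_def)
  ultimately have "u \<in> U_h \<Omega> \<T>" unfolding U_h_def by simp
  moreover have "u p = v p" if p: "p \<in> nodes \<T>" for p
  proof -
    obtain \<sigma> where "\<sigma> \<in> \<T>" "p \<in> verts \<sigma>" using p by (auto simp: nodes_def)
    then show ?thesis using u ab verts_subset_closure by (metis subsetD)
  qed
  ultimately show ?thesis by blast
qed

lemma pi_h: "pi_h \<Omega> \<T> v \<in> U_h \<Omega> \<T>" "p \<in> nodes \<T> \<Longrightarrow> pi_h \<Omega> \<T> v p = v p"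
proof -
  obtain u where u: "u \<in> U_h \<Omega> \<T>" "\<forall>p\<in>nodes \<T>. u p = v p" using interpolant_exists by blast
  have "pi_h \<Omega> \<T> v = u"
    unfolding pi_h_def
  proof (rule the_equality)
    show "w = u" if "w \<in> U_h \<Omega> \<T> \<and> (\<forall>p\<in>nodes \<T>. w p = v p)" for w
      by (rule U_h_eqI) (use u that in auto)
  qed (use u in blast)
  then show "pi_h \<Omega> \<T> v \<in> U_h \<Omega> \<T>" "p \<in> nodes \<T> \<Longrightarrow> pi_h \<Omega> \<T> v p = v p" using u by auto
qed

text \<open>A supporting hyperplane at a boundary point only meets boundary vertices of the elements, and
  the boundary point is a convex combination of these.\<close>

lemma U_h_frontier_zero:
  assumes u: "u \<in> U_h \<Omega> \<T>" and zero: "\<And>p. p \<in> nodes \<T> \<Longrightarrow> p \<in> frontier \<Omega> \<Longrightarrow> u p = 0"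
    and x: "x \<in> frontier \<Omega>"
  shows "u x = 0"
proof -
  have x': "x \<in> closure \<Omega>" "x \<notin> rel_interior \<Omega>"
    using x open_domain by (auto simp: frontier_domain rel_interior_open)
  obtain a where a: "\<And>y. y \<in> closure \<Omega> \<Longrightarrow> a \<bullet> x \<le> a \<bullet> y" "\<And>y. y \<in> rel_interior \<Omega> \<Longrightarrow> a \<bullet> x < a \<bullet> y"
  proof -
    have "\<exists>a. (\<forall>y\<in>closure \<Omega>. a \<bullet> x \<le> a \<bullet> y) \<and> (\<forall>y\<in>rel_interior \<Omega>. a \<bullet> x < a \<bullet> y)"
      by (rule supporting_hyperplane_relative_frontier[OF convex_domain x']) blast
    then show ?thesis using that by blast
  qed
  obtain \<sigma> where \<sigma>: "\<sigma> \<in> \<T>" "x \<in> closure \<sigma>" using x'(1) closure_domain by blast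
  obtain b where b: "\<forall>x\<in>closure \<sigma>. u x = gr u \<sigma> \<bullet> x + b" using U_h_affine_closure[OF u \<sigma>(1)] by blast
  have "x \<in> convex hull verts \<sigma>" using \<sigma> element_hull(3) by simp
  then obtain l where l: "\<forall>p\<in>verts \<sigma>. 0 \<le> l p" "sum l (verts \<sigma>) = 1" "(\<Sum>p\<in>verts \<sigma>. l p *\<^sub>R p) = x"
    using convex_hull_finite[OF finite_verts[OF \<sigma>(1)]] by auto
  have vert: "p \<in> closure \<sigma>" "p \<in> closure \<Omega>" "p \<in> nodes \<T>" if "p \<in> verts \<sigma>" for p
    using that \<sigma>(1) verts_subset_closure closure_element_subset by (auto simp: nodes_def)
  have "(\<Sum>p\<in>verts \<sigma>. l p * (a \<bullet> p - a \<bullet> x)) = a \<bullet> (\<Sum>p\<in>verts \<sigma>. l p *\<^sub>R p) - sum l (verts \<sigma>) * (a \<bullet> x)"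
    by (simp add: inner_sum_right right_diff_distrib sum_subtractf sum_distrib_right)
  also have "\<dots> = 0" using l by simp
  finally have sum0: "(\<Sum>p\<in>verts \<sigma>. l p * (a \<bullet> p - a \<bullet> x)) = 0" .
  have "0 \<le> l p * (a \<bullet> p - a \<bullet> x)" if "p \<in> verts \<sigma>" for p
    using l(1) that a(1)[OF vert(2)[OF that]] by simp
  then have "\<forall>p\<in>verts \<sigma>. l p * (a \<bullet> p - a \<bullet> x) = 0"
    using sum_nonneg_eq_0_iff[OF finite_verts[OF \<sigma>(1)], of "\<lambda>p. l p * (a \<bullet> p - a \<bullet> x)"] sum0 by simp
  then have summand: "l p * u p = 0" if "p \<in> verts \<sigma>" for p
  proof (cases "l p = 0")
    case False
    then have "a \<bullet> p = a \<bullet> x" using \<open>\<forall>p\<in>verts \<sigma>. l p * (a \<bullet> p - a \<bullet> x) = 0\<close> that by auto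
    then have "p \<notin> \<Omega>" using a(2)[of p] open_domain by (auto simp: rel_interior_open)
    then show ?thesis using zero vert[OF that] by (simp add: frontier_domain)
  qed simp
  have "u x = gr u \<sigma> \<bullet> (\<Sum>p\<in>verts \<sigma>. l p *\<^sub>R p) + sum l (verts \<sigma>) * b" using b \<sigma> l by simp
  also have "\<dots> = (\<Sum>p\<in>verts \<sigma>. l p * (gr u \<sigma> \<bullet> p + b))"
    by (simp add: inner_sum_right distrib_left sum.distrib sum_distrib_right)
  also have "\<dots> = (\<Sum>p\<in>verts \<sigma>. l p * u p)"
    using b vert by (intro sum.cong refl) auto
  finally show ?thesis using summand by simp
qed

lemma pi_h_U0_h: "(\<And>p. p \<in> frontier \<Omega> \<Longrightarrow> v p = 0) \<Longrightarrow> pi_h \<Omega> \<T> v \<in> U0_h \<Omega> \<T>"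
  unfolding U0_h_iff using pi_h U_h_frontier_zero by simp

section \<open>Nodal basis of the space with zero boundary values\<close>

definition inner_nodes :: "'a set" where "inner_nodes = nodes \<T> \<inter> \<Omega>"

definition hat :: "'a \<Rightarrow> 'a \<Rightarrow> real" where "hat p = pi_h \<Omega> \<T> (\<lambda>q. if q = p then 1 else 0)"

lemma finite_inner_nodes: "finite inner_nodes"
  using finite_nodes by (simp add: inner_nodes_def)

lemma hat_U0_h: "p \<in> inner_nodes \<Longrightarrow> hat p \<in> U0_h \<Omega> \<T>"
  unfolding hat_def by (rule pi_h_U0_h) (auto simp: inner_nodes_def frontier_domain)

lemma hat_node: "q \<in> nodes \<T> \<Longrightarrow> hat p q = (if q = p then 1 else 0)"
  by (simp add: hat_def pi_h(2))

lemma U0_h_node_zero: "u \<in> U0_h \<Omega> \<T> \<Longrightarrow> p \<in> nodes \<T> - inner_nodes \<Longrightarrow> u p = 0"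
  using U0_h_frontier nodes_subset by (auto simp: inner_nodes_def frontier_domain)

lemma hat_sum: "(\<lambda>x. \<Sum>p\<in>inner_nodes. c p * hat p x) \<in> U0_h \<Omega> \<T>"
    "\<sigma> \<in> \<T> \<Longrightarrow> gr (\<lambda>x. \<Sum>p\<in>inner_nodes. c p * hat p x) \<sigma> = (\<Sum>p\<in>inner_nodes. c p *\<^sub>R gr (hat p) \<sigma>)"
    "q \<in> inner_nodes \<Longrightarrow> (\<Sum>p\<in>inner_nodes. c p * hat p q) = c q"
proof -
  show "(\<lambda>x. \<Sum>p\<in>inner_nodes. c p * hat p x) \<in> U0_h \<Omega> \<T>"
    "\<sigma> \<in> \<T> \<Longrightarrow> gr (\<lambda>x. \<Sum>p\<in>inner_nodes. c p * hat p x) \<sigma> = (\<Sum>p\<in>inner_nodes. c p *\<^sub>R gr (hat p) \<sigma>)"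
    using U0_h_sum[OF finite_inner_nodes, of hat c] hat_U0_h by auto
  assume q: "q \<in> inner_nodes"
  then have "(\<Sum>p\<in>inner_nodes. c p * hat p q) = (\<Sum>p\<in>inner_nodes. if q = p then c p else 0)"
    by (intro sum.cong refl) (simp add: hat_node inner_nodes_def)
  then show "(\<Sum>p\<in>inner_nodes. c p * hat p q) = c q" using q finite_inner_nodes by simp
qed

lemma hat_expansion:
  assumes u: "u \<in> U0_h \<Omega> \<T>"
  shows "u = (\<lambda>x. \<Sum>p\<in>inner_nodes. u p * hat p x)"
proof (rule U_h_eqI)
  fix q assume q: "q \<in> nodes \<T>"
  show "u q = (\<Sum>p\<in>inner_nodes. u p * hat p q)"
  proof (cases "q \<in> inner_nodes")
    case False
    then have "(\<Sum>p\<in>inner_nodes. u p * hat p q) = 0"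
      using q by (intro sum.neutral) (auto simp: hat_node)
    then show ?thesis using U0_h_node_zero[OF u] q False by simp
  qed (simp add: hat_sum)
qed (use u hat_sum U0_h_U_h in auto)

subsection \<open>Mass lumping\<close>

text \<open>Diagonal entry of the lumped mass matrix at the node \<open>p\<close>.\<close>

definition wt :: "'a \<Rightarrow> real" where
  "wt p = (\<Sum>\<sigma>\<in>{\<sigma>\<in>\<T>. p \<in> verts \<sigma>}. vol \<sigma> / (real DIM('a) + 1))"

lemma wt_pos: "p \<in> nodes \<T> \<Longrightarrow> 0 < wt p"
  unfolding wt_def using finite_mesh vol_pos by (intro sum_pos) (auto simp: nodes_def)

text \<open>Exchanging the sums over elements and vertices exhibits the lumped form as diagonal.
  This is why the algebraic system can carry one positive coefficient \<open>c i\<close> per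
  unknown.\<close>

lemma lumped_nodes: "lumped \<T> \<eta> \<xi> = (\<Sum>p\<in>nodes \<T>. wt p * (\<eta> p * \<xi> p))"
proof -
  have "lumped \<T> \<eta> \<xi> = (\<Sum>\<sigma>\<in>\<T>. \<Sum>p\<in>nodes \<T>. if p \<in> verts \<sigma> then vol \<sigma> / (real DIM('a) + 1) * (\<eta> p * \<xi> p) else 0)"
    unfolding lumped_def
  proof (intro sum.cong refl)
    fix \<sigma> assume \<sigma>: "\<sigma> \<in> \<T>"
    then have "nodes \<T> \<inter> {p. p \<in> verts \<sigma>} = verts \<sigma>" by (auto simp: nodes_def)
    then show "measure lebesgue \<sigma> / (real DIM('a) + 1) * (\<Sum>p\<in>verts \<sigma>. \<eta> p * \<xi> p)
        = (\<Sum>p\<in>nodes \<T>. if p \<in> verts \<sigma> then vol \<sigma> / (real DIM('a) + 1) * (\<eta> p * \<xi> p) else 0)"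
      using sum.inter_restrict[OF finite_nodes, of "\<lambda>p. vol \<sigma> / (real DIM('a) + 1) * (\<eta> p * \<xi> p)" "verts \<sigma>"]
      by (simp add: sum_distrib_left vol_def Int_def)
  qed
  also have "\<dots> = (\<Sum>p\<in>nodes \<T>. \<Sum>\<sigma>\<in>\<T>. if p \<in> verts \<sigma> then vol \<sigma> / (real DIM('a) + 1) * (\<eta> p * \<xi> p) else 0)"
    by (rule sum.swap)
  also have "\<dots> = (\<Sum>p\<in>nodes \<T>. wt p * (\<eta> p * \<xi> p))"
    unfolding wt_def sum_distrib_right by (intro sum.cong refl sum.inter_filter[OF finite_mesh, symmetric])
  finally show ?thesis .
qed

lemma lumped_inner_nodes:
  assumes "\<eta> \<in> U0_h \<Omega> \<T>"
  shows "lumped \<T> g \<eta> = (\<Sum>p\<in>inner_nodes. wt p * (g p * \<eta> p))"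
  unfolding lumped_nodes
  by (rule sum.mono_neutral_right) (use finite_nodes U0_h_node_zero[OF assms] in \<open>auto simp: inner_nodes_def\<close>)

text \<open>The weights are positive and nodal values determine the function. This is the source of
  uniqueness of the primal component when the gradient bound is fixed.\<close>

lemma lumped_zero_imp_eq:
  assumes u: "u \<in> U0_h \<Omega> \<T>" and v: "v \<in> U0_h \<Omega> \<T>"
    and le: "lumped \<T> (\<lambda>x. u x - v x) (\<lambda>x. u x - v x) \<le> 0"
  shows "u = v"
proof (rule U_h_eqI[OF U0_h_U_h[OF u] U0_h_U_h[OF v]])
  fix p assume p: "p \<in> nodes \<T>"
  have nn: "0 \<le> wt q * ((u q - v q) * (u q - v q))" if "q \<in> nodes \<T>" for q
    using wt_pos[OF that] by simp
  have "(\<Sum>p\<in>nodes \<T>. wt p * ((u p - v p) * (u p - v p))) = 0"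
    using le nn unfolding lumped_nodes by (intro antisym sum_nonneg) auto
  then have "wt p * ((u p - v p) * (u p - v p)) = 0"
    using sum_nonneg_eq_0_iff[OF finite_nodes, of "\<lambda>p. wt p * ((u p - v p) * (u p - v p))"] nn p by simp
  then show "u p = v p" using wt_pos[OF p] by simp
qed

lemma measure_domain: "(\<Sum>\<sigma>\<in>\<T>. vol \<sigma>) = measure lebesgue \<Omega>"
  using integral_piecewise_const(2)[of "\<lambda>x. 1::real" "\<lambda>_. 1"] lmeasurable_domain
  by (simp add: set_lebesgue_integral_def)

lemma lumped_self_le:
  assumes "\<And>p. p \<in> nodes \<T> \<Longrightarrow> \<bar>u p\<bar> \<le> B"
  shows "lumped \<T> u u \<le> measure lebesgue \<Omega> * B\<^sup>2"
proof -
  have "measure lebesgue \<sigma> / (real DIM('a) + 1) * (\<Sum>p\<in>verts \<sigma>. u p * u p) \<le> vol \<sigma> * B\<^sup>2"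
    if \<sigma>: "\<sigma> \<in> \<T>" for \<sigma>
  proof -
    have "u p * u p \<le> B\<^sup>2" if "p \<in> verts \<sigma>" for p
    proof -
      have "\<bar>u p\<bar> \<le> B" using assms that \<sigma> by (auto simp: nodes_def)
      then have "\<bar>u p\<bar>\<^sup>2 \<le> B\<^sup>2" by (rule power_mono) simp
      then show ?thesis by (simp add: power2_eq_square)
    qed
    then have "(\<Sum>p\<in>verts \<sigma>. u p * u p) \<le> (\<Sum>p\<in>verts \<sigma>. B\<^sup>2)" by (rule sum_mono)
    also have "\<dots> = (real DIM('a) + 1) * B\<^sup>2" using element_hull(2)[OF \<sigma>] by simp
    finally have "measure lebesgue \<sigma> / (real DIM('a) + 1) * (\<Sum>p\<in>verts \<sigma>. u p * u p)
        \<le> measure lebesgue \<sigma> / (real DIM('a) + 1) * ((real DIM('a) + 1) * B\<^sup>2)"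
      by (rule mult_left_mono) simp
    also have "\<dots> = vol \<sigma> * B\<^sup>2" by (simp add: vol_def)
    finally show ?thesis .
  qed
  then have "lumped \<T> u u \<le> (\<Sum>\<sigma>\<in>\<T>. vol \<sigma> * B\<^sup>2)" unfolding lumped_def by (rule sum_mono)
  then show ?thesis by (simp add: measure_domain[symmetric] sum_distrib_right)
qed

subsection \<open>Integrals\<close>

lemma U_h_bounded: "u \<in> U_h \<Omega> \<T> \<Longrightarrow> \<exists>B\<ge>0. \<forall>x. \<bar>u x\<bar> \<le> B"
proof -
  assume u: "u \<in> U_h \<Omega> \<T>"
  have "compact (closure \<Omega>)" using bounded_closure by (simp add: compact_eq_bounded_closed)
  then have "bounded (u ` closure \<Omega>)"
    using u unfolding U_h_def by (intro compact_imp_bounded compact_continuous_image) auto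
  then obtain B where B: "0 < B" "\<And>x. x \<in> closure \<Omega> \<Longrightarrow> \<bar>u x\<bar> \<le> B" by (auto simp: bounded_pos)
  have "\<bar>u x\<bar> \<le> B" for x using B u by (cases "x \<in> closure \<Omega>") (auto simp: U_h_def)
  then show ?thesis using B(1) by (intro exI[of _ B]) simp
qed

lemma integrable_mult_U_h:
  assumes f: "set_integrable lebesgue \<Omega> f" and u: "u \<in> U_h \<Omega> \<T>"
  shows "set_integrable lebesgue \<Omega> (\<lambda>x. f x * u x)"
proof -
  obtain B where B: "0 \<le> B" "\<And>x. \<bar>u x\<bar> \<le> B" using U_h_bounded[OF u] by blast
  have m1: "(\<lambda>x. indicator \<Omega> x *\<^sub>R f x) \<in> borel_measurable lebesgue"
    using f unfolding set_integrable_def by (rule borel_measurable_integrable)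
  have "(\<lambda>x. indicator \<Omega> x *\<^sub>R u x) \<in> borel_measurable lebesgue"
    using U_h_measurable[OF u] lmeasurable_domain
    by (subst (asm) borel_measurable_restrict_space_iff) (auto simp: fmeasurableD)
  from borel_measurable_times[OF m1 this]
  have m: "(\<lambda>x. indicator \<Omega> x *\<^sub>R (f x * u x)) \<in> borel_measurable lebesgue"
    by (rule measurable_cong[THEN iffD1, rotated]) (simp add: indicator_def)
  have "integrable lebesgue (\<lambda>x. B * (indicator \<Omega> x *\<^sub>R f x))"
    using f unfolding set_integrable_def by simp
  then show ?thesis
    unfolding set_integrable_def
  proof (rule Bochner_Integration.integrable_bound[OF _ m])
    have "\<bar>f x\<bar> * \<bar>u x\<bar> \<le> \<bar>B\<bar> * \<bar>f x\<bar>" for x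
      using mult_right_mono[OF B(2)[of x] abs_ge_zero[of "f x"]] B(1) by (simp add: mult.commute)
    then show "AE x in lebesgue. norm (indicator \<Omega> x *\<^sub>R (f x * u x)) \<le> norm (B * (indicator \<Omega> x *\<^sub>R f x))"
      by (intro AE_I2) (simp add: abs_mult indicator_def)
  qed
qed

lemma set_integrable_one: "set_integrable lebesgue \<Omega> (\<lambda>x. 1::real)"
  using integral_piecewise_const(1)[of "\<lambda>x. 1::real" "\<lambda>_. 1"] by simp

lemma U_h_integrable: "u \<in> U_h \<Omega> \<T> \<Longrightarrow> set_integrable lebesgue \<Omega> u"
  using integrable_mult_U_h[OF set_integrable_one] by simp

lemma load_le:
  assumes f: "set_integrable lebesgue \<Omega> f" and u: "u \<in> U_h \<Omega> \<T>" and B: "\<And>x. \<bar>u x\<bar> \<le> B"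
  shows "L2_inner \<Omega> f u \<le> B * L1_norm \<Omega> f"
proof -
  have "(LINT x:\<Omega>|lebesgue. f x * u x) \<le> (LINT x:\<Omega>|lebesgue. B * \<bar>f x\<bar>)"
  proof (rule set_integral_mono)
    show "set_integrable lebesgue \<Omega> (\<lambda>x. B * \<bar>f x\<bar>)"
      using set_integrable_abs[OF f] by simp
    fix x
    have "f x * u x \<le> \<bar>f x\<bar> * \<bar>u x\<bar>" by (metis abs_ge_self abs_mult)
    also have "\<dots> \<le> \<bar>f x\<bar> * B" using B by (intro mult_left_mono) auto
    finally show "f x * u x \<le> B * \<bar>f x\<bar>" by (simp add: mult.commute)
  qed (rule integrable_mult_U_h[OF f u])
  then show ?thesis by (simp add: L2_inner_def L1_norm_def)
qed

lemma load_hat_expansion: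
  assumes f: "set_integrable lebesgue \<Omega> f"
  shows "L2_inner \<Omega> f (\<lambda>x. \<Sum>p\<in>inner_nodes. c p * hat p x) = (\<Sum>p\<in>inner_nodes. c p * L2_inner \<Omega> f (hat p))"
proof -
  have "integrable lebesgue (\<lambda>x. indicator \<Omega> x *\<^sub>R (f x * hat p x))" if "p \<in> inner_nodes" for p
    using integrable_mult_U_h[OF f U0_h_U_h[OF hat_U0_h[OF that]]] by (simp add: set_integrable_def)
  then have "(LINT x|lebesgue. (\<Sum>p\<in>inner_nodes. c p * (indicator \<Omega> x *\<^sub>R (f x * hat p x))))
      = (\<Sum>p\<in>inner_nodes. c p * (LINT x|lebesgue. indicator \<Omega> x *\<^sub>R (f x * hat p x)))"
    by (subst Bochner_Integration.integral_sum) auto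
  moreover have "(\<lambda>x. indicator \<Omega> x *\<^sub>R (f x \<bullet> (\<Sum>p\<in>inner_nodes. c p * hat p x)))
      = (\<lambda>x. \<Sum>p\<in>inner_nodes. c p * (indicator \<Omega> x *\<^sub>R (f x * hat p x)))"
    by (simp add: sum_distrib_left mult_ac)
  ultimately show ?thesis by (simp add: L2_inner_def set_lebesgue_integral_def)
qed

lemma L2_inner_const:
  fixes \<eta> \<xi> :: "'a \<Rightarrow> 'b::euclidean_space"
  assumes "\<And>\<sigma> x. \<sigma> \<in> \<T> \<Longrightarrow> x \<in> \<sigma> \<Longrightarrow> \<eta> x = a \<sigma>" "\<And>\<sigma> x. \<sigma> \<in> \<T> \<Longrightarrow> x \<in> \<sigma> \<Longrightarrow> \<xi> x = b \<sigma>"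
  shows "L2_inner \<Omega> \<eta> \<xi> = (\<Sum>\<sigma>\<in>\<T>. vol \<sigma> * (a \<sigma> \<bullet> b \<sigma>))"
  unfolding L2_inner_def
  using integral_piecewise_const(2)[of "\<lambda>x. \<eta> x \<bullet> \<xi> x" "\<lambda>\<sigma>. a \<sigma> \<bullet> b \<sigma>"] assms by simp

lemma L2_inner_grad:
  assumes "Q \<in> S_h \<T>" "u \<in> U_h \<Omega> \<T>"
  shows "L2_inner \<Omega> Q (grad u) = (\<Sum>\<sigma>\<in>\<T>. vol \<sigma> * (Q (mid \<sigma>) \<bullet> gr u \<sigma>))"
  by (rule L2_inner_const) (use S_h_on[OF assms(1)] grad_U_h[OF assms(2)] in auto)

subsection \<open>A priori bounds for finite element functions\<close>

lemma U_h_sq_le_verts: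
  assumes u: "u \<in> U_h \<Omega> \<T>" and \<sigma>: "\<sigma> \<in> \<T>" and x: "x \<in> \<sigma>"
  shows "(u x)\<^sup>2 \<le> (\<Sum>p\<in>verts \<sigma>. u p * u p)"
proof -
  define M where "M = sqrt (\<Sum>p\<in>verts \<sigma>. u p * u p)"
  obtain b where b: "\<forall>x\<in>closure \<sigma>. u x = gr u \<sigma> \<bullet> x + b" using U_h_affine_closure[OF u \<sigma>] by blast
  have "\<bar>u p\<bar> \<le> M" if "p \<in> verts \<sigma>" for p
  proof -
    have "u p * u p \<le> (\<Sum>p\<in>verts \<sigma>. u p * u p)"
      using that finite_verts[OF \<sigma>] by (intro member_le_sum) auto
    then show ?thesis unfolding M_def by (intro real_le_rsqrt) (simp add: power2_eq_square)
  qed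
  then have p: "\<bar>gr u \<sigma> \<bullet> p + b\<bar> \<le> M" if "p \<in> verts \<sigma>" for p
    using that b verts_subset_closure[OF \<sigma>] by (metis subsetD)
  have x: "x \<in> convex hull verts \<sigma>" "x \<in> closure \<sigma>" using x closure_subset[of \<sigma>] element_hull(3)[OF \<sigma>] by auto
  have "gr u \<sigma> \<bullet> x \<le> M - b" by (rule affine_fun_le_on_hull[OF x(1)]) (use p in \<open>smt (verit)\<close>)
  moreover have "(- gr u \<sigma>) \<bullet> x \<le> M + b"
    by (rule affine_fun_le_on_hull[OF x(1)]) (use p in \<open>simp add: inner_minus_left, smt (verit)\<close>)
  ultimately have "\<bar>u x\<bar> \<le> M" using b x by (auto simp: inner_minus_left)
  then have "\<bar>u x\<bar>\<^sup>2 \<le> M\<^sup>2" by (rule power_mono) simp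
  then show ?thesis unfolding M_def by (simp add: sum_nonneg)
qed

text \<open>On an element the square of the function is at most the sum of the squares of its vertex
  values; the factor in front cancels the division by the number of vertices in the lumping
  rule.\<close>

lemma L2_norm_sq_le_lumped:
  assumes u: "u \<in> U_h \<Omega> \<T>"
  shows "(L2_norm \<Omega> u)\<^sup>2 \<le> (real DIM('a) + 1) * lumped \<T> u u"
proof -
  have "(LINT x:\<Omega>|lebesgue. u x * u x) \<le> (\<Sum>\<sigma>\<in>\<T>. vol \<sigma> * (\<Sum>p\<in>verts \<sigma>. u p * u p))"
    by (rule integral_le_step[OF integrable_mult_U_h[OF U_h_integrable[OF u] u]])
      (use U_h_sq_le_verts[OF u] in \<open>simp add: power2_eq_square\<close>)
  also have "\<dots> = (real DIM('a) + 1) * lumped \<T> u u"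
    unfolding lumped_def sum_distrib_left by (intro sum.cong refl) (simp add: vol_def field_simps)
  finally have "L2_inner \<Omega> u u \<le> (real DIM('a) + 1) * lumped \<T> u u" by (simp add: L2_inner_def)
  moreover have "0 \<le> L2_inner \<Omega> u u"
    unfolding L2_inner_def set_lebesgue_integral_def by (intro integral_nonneg_AE AE_I2) simp
  ultimately show ?thesis by (simp add: L2_norm_def)
qed

lemma L2_norm_le:
  assumes u: "u \<in> U_h \<Omega> \<T>" and B: "\<And>x. \<bar>u x\<bar> \<le> B"
  shows "L2_norm \<Omega> u \<le> sqrt (measure lebesgue \<Omega> * B\<^sup>2)"
proof -
  have "\<bar>u x\<bar>\<^sup>2 \<le> B\<^sup>2" for x using B by (rule power_mono) simp
  then have "(LINT x:\<Omega>|lebesgue. u x * u x) \<le> (\<Sum>\<sigma>\<in>\<T>. vol \<sigma> * B\<^sup>2)"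
    by (intro integral_le_step[OF integrable_mult_U_h[OF U_h_integrable[OF u] u]]) (simp add: power2_eq_square)
  then show ?thesis
    unfolding L2_norm_def L2_inner_def by (simp add: measure_domain[symmetric] sum_distrib_right)
qed

text \<open>Across an inscribed ball of radius \<open>r\<close>, in the direction of the gradient,
  the function rises by \<open>2 * r\<close> times the length of the gradient, while the vertex
  values limit its oscillation to \<open>L * diameter \<sigma>\<close>. The gradient is thus
  controlled by \<open>L\<close> times the ratio that shape regularity bounds.\<close>

lemma gr_le_shape:
  assumes u: "u \<in> U_h \<Omega> \<T>" and \<sigma>: "\<sigma> \<in> \<T>" and L: "0 \<le> L"
    and lip: "\<And>p q. p \<in> verts \<sigma> \<Longrightarrow> q \<in> verts \<sigma> \<Longrightarrow> u p - u q \<le> L * dist p q"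
    and \<kappa>: "0 \<le> \<kappa>" and shape: "diameter \<sigma> \<le> \<kappa> * inball_diameter \<sigma>"
  shows "norm (gr u \<sigma>) \<le> L * \<kappa>"
proof (cases "gr u \<sigma> = 0")
  case True
  then show ?thesis using L \<kappa> by simp
next
  case False
  define g where "g = gr u \<sigma>"
  have g: "0 < norm g" using False by (simp add: g_def)
  define D where "D = L * diameter \<sigma>"
  have bdd: "bounded (closure \<sigma>)"
    using bounded_closure closure_element_subset[OF \<sigma>] bounded_subset by blast
  obtain b where b: "\<forall>x\<in>closure \<sigma>. u x = g \<bullet> x + b"
    using U_h_affine_closure[OF u \<sigma>] unfolding g_def by blast
  have vv: "g \<bullet> p \<le> D + g \<bullet> q" if pq: "p \<in> verts \<sigma>" "q \<in> verts \<sigma>" for p q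
  proof -
    have cl: "p \<in> closure \<sigma>" "q \<in> closure \<sigma>" using pq verts_subset_closure[OF \<sigma>] by auto
    have "dist p q \<le> diameter \<sigma>"
      using diameter_bounded_bound[OF bdd cl] diameter_closure[of \<sigma>] bdd bounded_subset closure_subset by metis
    then have "L * dist p q \<le> D" unfolding D_def using L by (rule mult_left_mono)
    then show ?thesis using lip[OF pq] b cl by simp
  qed
  \<comment> \<open>The bound on differences of vertex values passes to the hull in one variable
    after the other.\<close>
  have cc: "g \<bullet> x - g \<bullet> y \<le> D" if x: "x \<in> closure \<sigma>" and y: "y \<in> closure \<sigma>" for x y
  proof -
    have xh: "x \<in> convex hull verts \<sigma>" and yh: "y \<in> convex hull verts \<sigma>"
      using x y element_hull(3)[OF \<sigma>] by auto
    have "(- g) \<bullet> y \<le> D - g \<bullet> x"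
    proof (rule affine_fun_le_on_hull[OF yh])
      fix q assume "q \<in> verts \<sigma>"
      then have "g \<bullet> x \<le> D + g \<bullet> q" using affine_fun_le_on_hull[OF xh] vv by blast
      then show "(- g) \<bullet> q \<le> D - g \<bullet> x" by (simp add: inner_minus_left)
    qed
    then show ?thesis by (simp add: inner_minus_left)
  qed
  let ?S = "{2 * r |r. 0 < r \<and> (\<exists>x. ball x r \<subseteq> \<sigma>)}"
  have S_le: "s \<le> D / norm g" if s: "s \<in> ?S" for s
  proof -
    obtain r x where r: "s = 2 * r" "0 < r" "ball x r \<subseteq> \<sigma>" using s by auto
    have "cball x r \<subseteq> closure \<sigma>" using closure_mono[OF r(3)] r(2) by simp
    moreover define e where "e = (r / norm g) *\<^sub>R g"
    have "norm e = r" using g r(2) by (simp add: e_def)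
    then have "x + e \<in> cball x r" "x - e \<in> cball x r" by (auto simp: dist_norm)
    ultimately have "g \<bullet> (x + e) - g \<bullet> (x - e) \<le> D" by (intro cc) auto
    moreover have "g \<bullet> (x + e) - g \<bullet> (x - e) = 2 * r * norm g"
      using g by (simp add: e_def inner_add_right inner_diff_right power2_norm_eq_inner[symmetric] power2_eq_square)
    ultimately show ?thesis using g r(1) by (simp add: pos_le_divide_eq)
  qed
  \<comment> \<open>The real \<open>Sup\<close> in \<open>inball_diameter\<close> is informative
    only for a nonempty set bounded above: \<open>S_le\<close> is the upper bound, a ball around
    \<open>mid \<sigma>\<close> provides a member.\<close>
  obtain r where r: "0 < r" "ball (mid \<sigma>) r \<subseteq> \<sigma>"
    using open_element[OF \<sigma>] mid_in[OF \<sigma>] by (meson open_contains_ball)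
  then have r_in: "2 * r \<in> ?S" by blast
  have "2 * r \<le> inball_diameter \<sigma>"
    unfolding inball_diameter_def using S_le by (intro cSup_upper[OF r_in] bdd_aboveI)
  then have pos: "0 < inball_diameter \<sigma>" using r(1) by simp
  have "inball_diameter \<sigma> \<le> D / norm g"
    unfolding inball_diameter_def using r_in S_le by (intro cSup_least) blast+
  then have "norm g * inball_diameter \<sigma> \<le> D" using g by (simp add: pos_le_divide_eq mult.commute)
  also have "\<dots> \<le> L * (\<kappa> * inball_diameter \<sigma>)" unfolding D_def using shape L by (rule mult_left_mono)
  finally have "norm g * inball_diameter \<sigma> \<le> (L * \<kappa>) * inball_diameter \<sigma>" by simp
  then show ?thesis unfolding g_def[symmetric] using pos by (rule mult_right_le_imp_le)
qed

section \<open>Element means, the flux equation and elementwise duality\<close>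

definition avg :: "'a set \<Rightarrow> ('a \<Rightarrow> real) \<Rightarrow> real" where
  "avg \<sigma> v = (LINT y:\<sigma>|lebesgue. v y) / vol \<sigma>"

lemma P_h_on: "\<sigma> \<in> \<T> \<Longrightarrow> x \<in> \<sigma> \<Longrightarrow> P_h \<T> v x = avg \<sigma> v"
proof -
  have "P_h \<T> v x = step (\<lambda>\<sigma>. avg \<sigma> v) x"
    by (simp add: P_h_def step_def avg_def vol_def)
  then show "\<sigma> \<in> \<T> \<Longrightarrow> x \<in> \<sigma> \<Longrightarrow> P_h \<T> v x = avg \<sigma> v" by (simp add: step_on)
qed

text \<open>Linearity of the means in the nodal values is what makes the gradient bound depend
  continuously on them.\<close>

lemma avg_hat_sum:
  assumes \<sigma>: "\<sigma> \<in> \<T>"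
  shows "avg \<sigma> (\<lambda>x. \<Sum>p\<in>inner_nodes. c p * hat p x) = (\<Sum>p\<in>inner_nodes. c p * avg \<sigma> (hat p))"
proof -
  have "integrable lebesgue (\<lambda>x. indicator \<sigma> x *\<^sub>R hat p x)" if "p \<in> inner_nodes" for p
    using set_integrable_subset[OF U_h_integrable[OF U0_h_U_h[OF hat_U0_h[OF that]]] _ element_subset[OF \<sigma>]]
      lmeasurable_element[OF \<sigma>] by (simp add: set_integrable_def fmeasurableD)
  then have "(LINT x|lebesgue. (\<Sum>p\<in>inner_nodes. c p * (indicator \<sigma> x *\<^sub>R hat p x)))
      = (\<Sum>p\<in>inner_nodes. c p * (LINT x|lebesgue. indicator \<sigma> x *\<^sub>R hat p x))"
    by (subst Bochner_Integration.integral_sum) auto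
  moreover have "(\<lambda>x. indicator \<sigma> x *\<^sub>R (\<Sum>p\<in>inner_nodes. c p * hat p x))
      = (\<lambda>x. \<Sum>p\<in>inner_nodes. c p * (indicator \<sigma> x *\<^sub>R hat p x))"
    by (simp add: sum_distrib_left mult_ac)
  ultimately show ?thesis
    by (simp add: avg_def set_lebesgue_integral_def sum_divide_distrib)
qed

text \<open>The flux equation of a step with an arbitrary \<open>g\<close> in place of the time
  difference quotient; it serves \<open>Q_step\<close>, \<open>Z_h\<close> and the problem with
  frozen bound alike.\<close>

definition galerkin :: "('a \<Rightarrow> real) \<Rightarrow> ('a \<Rightarrow> real) \<Rightarrow> ('a \<Rightarrow> 'a) \<Rightarrow> bool" where
  "galerkin f g Q \<longleftrightarrow> (\<forall>\<eta>\<in>U0_h \<Omega> \<T>. lumped \<T> g \<eta> - L2_inner \<Omega> Q (grad \<eta>) = L2_inner \<Omega> f \<eta>)"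

lemma galerkinD:
  assumes "galerkin f g Q" "Q \<in> S_h \<T>" "\<eta> \<in> U0_h \<Omega> \<T>"
  shows "lumped \<T> g \<eta> - L2_inner \<Omega> f \<eta> = (\<Sum>\<sigma>\<in>\<T>. vol \<sigma> * (Q (mid \<sigma>) \<bullet> gr \<eta> \<sigma>))"
  using assms L2_inner_grad[OF assms(2) U0_h_U_h[OF assms(3)]] by (simp add: galerkin_def algebra_simps)

lemma galerkinI:
  assumes f: "set_integrable lebesgue \<Omega> f" and Q: "Q \<in> S_h \<T>"
    and hats: "\<And>p. p \<in> inner_nodes \<Longrightarrow>
      wt p * g p - (\<Sum>\<sigma>\<in>\<T>. vol \<sigma> * (Q (mid \<sigma>) \<bullet> gr (hat p) \<sigma>)) = L2_inner \<Omega> f (hat p)"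
  shows "galerkin f g Q"
  unfolding galerkin_def
proof
  fix \<eta> assume \<eta>: "\<eta> \<in> U0_h \<Omega> \<T>"
  have "gr \<eta> \<sigma> = (\<Sum>p\<in>inner_nodes. \<eta> p *\<^sub>R gr (hat p) \<sigma>)" if "\<sigma> \<in> \<T>" for \<sigma>
    using hat_sum(2)[OF that, of \<eta>] hat_expansion[OF \<eta>] by simp
  then have "L2_inner \<Omega> Q (grad \<eta>)
      = (\<Sum>\<sigma>\<in>\<T>. \<Sum>p\<in>inner_nodes. \<eta> p * (vol \<sigma> * (Q (mid \<sigma>) \<bullet> gr (hat p) \<sigma>)))"
    unfolding L2_inner_grad[OF Q U0_h_U_h[OF \<eta>]]
    by (intro sum.cong refl) (simp add: inner_sum_right sum_distrib_left mult_ac)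
  also have "\<dots> = (\<Sum>p\<in>inner_nodes. \<Sum>\<sigma>\<in>\<T>. \<eta> p * (vol \<sigma> * (Q (mid \<sigma>) \<bullet> gr (hat p) \<sigma>)))"
    by (rule sum.swap)
  also have "\<dots> = (\<Sum>p\<in>inner_nodes. \<eta> p * (wt p * g p - L2_inner \<Omega> f (hat p)))"
  proof (intro sum.cong refl)
    fix p assume "p \<in> inner_nodes"
    from hats[OF this] show "(\<Sum>\<sigma>\<in>\<T>. \<eta> p * (vol \<sigma> * (Q (mid \<sigma>) \<bullet> gr (hat p) \<sigma>)))
        = \<eta> p * (wt p * g p - L2_inner \<Omega> f (hat p))"
      unfolding sum_distrib_left[symmetric] by (simp add: algebra_simps)
  qed
  also have "\<dots> = lumped \<T> g \<eta> - (\<Sum>p\<in>inner_nodes. \<eta> p * L2_inner \<Omega> f (hat p))"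
    unfolding lumped_inner_nodes[OF \<eta>] by (simp add: right_diff_distrib sum_subtractf mult_ac)
  also have "(\<Sum>p\<in>inner_nodes. \<eta> p * L2_inner \<Omega> f (hat p)) = L2_inner \<Omega> f \<eta>"
    using load_hat_expansion[OF f, of \<eta>] hat_expansion[OF \<eta>] by simp
  finally show "lumped \<T> g \<eta> - L2_inner \<Omega> Q (grad \<eta>) = L2_inner \<Omega> f \<eta>" by simp
qed

text \<open>Elementwise optimality: primal feasibility and a vanishing duality gap. For
  \<open>m \<sigma> > 0\<close> the second equation means that the flux is zero, or that the
  gradient has length \<open>m \<sigma>\<close> and the flux points against it.\<close>

definition dual_pair :: "('a set \<Rightarrow> real) \<Rightarrow> ('a \<Rightarrow> real) \<Rightarrow> ('a \<Rightarrow> 'a) \<Rightarrow> bool" where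
  "dual_pair m W Q \<longleftrightarrow> (\<forall>\<sigma>\<in>\<T>. norm (gr W \<sigma>) \<le> m \<sigma> \<and>
     m \<sigma> * norm (Q (mid \<sigma>)) + gr W \<sigma> \<bullet> Q (mid \<sigma>) = 0)"

lemma duality_gap_nonneg:
  fixes g q :: 'a
  assumes "norm g \<le> m"
  shows "0 \<le> m * norm q + g \<bullet> q"
  using Cauchy_Schwarz_ineq2[of g q] mult_right_mono[OF assms norm_ge_zero[of q]] by linarith

text \<open>The inequality says that \<open>Q\<close> minimises the volume-weighted sum of
  \<open>gap\<close> over \<open>S_h\<close>. Values on different elements are independent, so the
  minimisation decouples; on one element \<open>gap\<close> is positively homogeneous, so its
  minimum can only be zero.\<close>

lemma dual_pair_iff_variational:
  assumes Q: "Q \<in> S_h \<T>" and W: "W \<in> U_h \<Omega> \<T>"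
    and M: "\<And>\<sigma> x. \<sigma> \<in> \<T> \<Longrightarrow> x \<in> \<sigma> \<Longrightarrow> M x = m \<sigma>"
  shows "(\<forall>v\<in>S_h \<T>. L2_inner \<Omega> M (\<lambda>x. norm (v x) - norm (Q x)) + L2_inner \<Omega> (grad W) (\<lambda>x. v x - Q x) \<ge> 0)
    \<longleftrightarrow> dual_pair m W Q"
proof -
  define gap where "gap \<sigma> q = m \<sigma> * norm q + gr W \<sigma> \<bullet> q" for \<sigma> q
  have eq: "L2_inner \<Omega> M (\<lambda>x. norm (v x) - norm (Q x)) + L2_inner \<Omega> (grad W) (\<lambda>x. v x - Q x)
      = (\<Sum>\<sigma>\<in>\<T>. vol \<sigma> * (gap \<sigma> (v (mid \<sigma>)) - gap \<sigma> (Q (mid \<sigma>))))" if v: "v \<in> S_h \<T>" for v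
  proof -
    have "L2_inner \<Omega> M (\<lambda>x. norm (v x) - norm (Q x))
        = (\<Sum>\<sigma>\<in>\<T>. vol \<sigma> * (m \<sigma> \<bullet> (norm (v (mid \<sigma>)) - norm (Q (mid \<sigma>)))))"
      by (rule L2_inner_const[OF M]) (simp_all add: S_h_on[OF v] S_h_on[OF Q])
    moreover have "L2_inner \<Omega> (grad W) (\<lambda>x. v x - Q x)
        = (\<Sum>\<sigma>\<in>\<T>. vol \<sigma> * (gr W \<sigma> \<bullet> (v (mid \<sigma>) - Q (mid \<sigma>))))"
      by (rule L2_inner_const[OF grad_U_h[OF W]]) (simp_all add: S_h_on[OF v] S_h_on[OF Q])
    ultimately show ?thesis
      by (simp add: gap_def sum.distrib[symmetric] inner_diff_right algebra_simps)
  qed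
  show ?thesis
  proof
    assume var: "\<forall>v\<in>S_h \<T>. L2_inner \<Omega> M (\<lambda>x. norm (v x) - norm (Q x)) + L2_inner \<Omega> (grad W) (\<lambda>x. v x - Q x) \<ge> 0"
    have min: "gap \<sigma> (Q (mid \<sigma>)) \<le> gap \<sigma> y" if \<sigma>: "\<sigma> \<in> \<T>" for \<sigma> y
    proof -
      \<comment> \<open>A competitor that differs from \<open>Q\<close> on a single element isolates
        the inequality there.\<close>
      define v where "v = step (\<lambda>\<sigma>'. if \<sigma>' = \<sigma> then y else Q (mid \<sigma>'))"
      have vm: "v (mid \<sigma>') = (if \<sigma>' = \<sigma> then y else Q (mid \<sigma>'))" if "\<sigma>' \<in> \<T>" for \<sigma>'
        unfolding v_def using that mid_in by (simp add: step_on)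
      have vS: "v \<in> S_h \<T>" unfolding v_def by (rule step_in_S_h)
      have "0 \<le> (\<Sum>\<sigma>'\<in>\<T>. vol \<sigma>' * (gap \<sigma>' (v (mid \<sigma>')) - gap \<sigma>' (Q (mid \<sigma>'))))"
        using bspec[OF var vS] unfolding eq[OF vS] .
      also have "\<dots> = (\<Sum>\<sigma>'\<in>\<T>. if \<sigma>' = \<sigma> then vol \<sigma>' * (gap \<sigma>' y - gap \<sigma>' (Q (mid \<sigma>'))) else 0)"
        by (intro sum.cong refl) (simp add: vm)
      also have "\<dots> = vol \<sigma> * (gap \<sigma> y - gap \<sigma> (Q (mid \<sigma>)))" using \<sigma> finite_mesh by simp
      finally show ?thesis using vol_pos[OF \<sigma>] by (simp add: zero_le_mult_iff)
    qed
    show "dual_pair m W Q"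
      unfolding dual_pair_def
    proof
      fix \<sigma> assume \<sigma>: "\<sigma> \<in> \<T>"
      \<comment> \<open>Doubling the flux shows that the minimal gap is nonnegative, the zero flux
        that it is nonpositive.\<close>
      have "gap \<sigma> (2 *\<^sub>R Q (mid \<sigma>)) = 2 * gap \<sigma> (Q (mid \<sigma>))" "gap \<sigma> 0 = 0"
        by (simp_all add: gap_def)
      then have zero: "gap \<sigma> (Q (mid \<sigma>)) = 0"
        using min[OF \<sigma>, of "2 *\<^sub>R Q (mid \<sigma>)"] min[OF \<sigma>, of 0] by linarith
      have "0 \<le> gap \<sigma> (- gr W \<sigma>)" using min[OF \<sigma>, of "- gr W \<sigma>"] zero by simp
      then have "norm (gr W \<sigma>) * norm (gr W \<sigma>) \<le> m \<sigma> * norm (gr W \<sigma>)"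
        by (simp add: gap_def power2_norm_eq_inner[symmetric] power2_eq_square)
      \<comment> \<open>For a vanishing gradient the choice \<open>- gr W \<sigma>\<close> carries
        no information; a unit vector then makes the gap equal to \<open>m \<sigma>\<close>.\<close>
      moreover have "0 \<le> m \<sigma>" if "norm (gr W \<sigma>) = 0"
      proof -
        obtain y :: 'a where y: "norm y = 1" using vector_choose_size[of 1] by auto
        moreover have "0 \<le> gap \<sigma> y" using min[OF \<sigma>, of y] zero by simp
        ultimately show ?thesis using that by (simp add: gap_def)
      qed
      ultimately have "norm (gr W \<sigma>) \<le> m \<sigma>"
        using mult_right_le_imp_le[of "norm (gr W \<sigma>)" "norm (gr W \<sigma>)" "m \<sigma>"]
        by (cases "norm (gr W \<sigma>) = 0") auto
      then show "norm (gr W \<sigma>) \<le> m \<sigma> \<and> m \<sigma> * norm (Q (mid \<sigma>)) + gr W \<sigma> \<bullet> Q (mid \<sigma>) = 0"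
        using zero by (simp add: gap_def)
    qed
  next
    assume d: "dual_pair m W Q"
    have "0 \<le> vol \<sigma> * (gap \<sigma> (v (mid \<sigma>)) - gap \<sigma> (Q (mid \<sigma>)))" if "\<sigma> \<in> \<T>" for v \<sigma>
      using d that vol_pos[OF that] duality_gap_nonneg[of "gr W \<sigma>" "m \<sigma>" "v (mid \<sigma>)"]
      by (simp add: dual_pair_def gap_def)
    then show "\<forall>v\<in>S_h \<T>. L2_inner \<Omega> M (\<lambda>x. norm (v x) - norm (Q x)) + L2_inner \<Omega> (grad W) (\<lambda>x. v x - Q x) \<ge> 0"
      by (auto simp: eq intro!: sum_nonneg)
  qed
qed

text \<open>The bound \<open>m\<close> may depend on the solution; with a constant bound this is the Lagrange
  multiplier theorem for the convex gradient-constrained problem.\<close>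

lemma discrete_step_solvable:
  fixes m :: "('a \<Rightarrow> real) \<Rightarrow> 'a set \<Rightarrow> real"
  assumes f: "set_integrable lebesgue \<Omega> f" and \<tau>: "0 < \<tau>" and k0: "0 < k0"
    and m_ge: "\<And>W \<sigma>. \<sigma> \<in> \<T> \<Longrightarrow> k0 \<le> m W \<sigma>"
    and m_cont: "\<And>\<sigma> \<iota>. \<sigma> \<in> \<T> \<Longrightarrow>
      continuous_on UNIV (\<lambda>x :: nat \<Rightarrow> real. m (\<lambda>y. \<Sum>p\<in>inner_nodes. x (\<iota> p) * hat p y) \<sigma>)"
  obtains W Q where "W \<in> U0_h \<Omega> \<T>" "Q \<in> S_h \<T>" "galerkin f (\<lambda>x. (W x - V x) / \<tau>) Q" "dual_pair (m W) W Q"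
proof -
  obtain h :: "nat \<Rightarrow> 'a" and n where h: "bij_betw h {..<n} inner_nodes"
    using ex_bij_betw_nat_finite[OF finite_inner_nodes] by (auto simp: atLeast0LessThan)
  obtain e :: "nat \<Rightarrow> 'a set" and l where e: "bij_betw e {..<l} \<T>"
    using ex_bij_betw_nat_finite[OF finite_mesh] by (auto simp: atLeast0LessThan)
  \<comment> \<open>The algebraic system is indexed by numbers; \<open>\<iota>\<close> and
    \<open>\<kappa>\<close> undo the enumerations of inner nodes and of elements.\<close>
  define \<iota> where "\<iota> = inv_into {..<n} h"
  define \<kappa> where "\<kappa> = inv_into {..<l} e"
  have \<iota>: "\<iota> (h i) = i" if "i < n" for i
    using h that unfolding \<iota>_def by (simp add: bij_betw_def inv_into_f_f)
  have \<kappa>: "\<kappa> (e j) = j" if "j < l" for j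
    using e that unfolding \<kappa>_def by (simp add: bij_betw_def inv_into_f_f)
  have h_in: "h i \<in> inner_nodes" if "i < n" for i using h that by (auto simp: bij_betw_def)
  have e_in: "e j \<in> \<T>" if "j < l" for j using e that by (auto simp: bij_betw_def)
  have h_sum: "(\<Sum>p\<in>inner_nodes. F p) = (\<Sum>i<n. F (h i))" for F :: "'a \<Rightarrow> 'a"
    using sum.reindex_bij_betw[OF h, of F] by simp
  have e_sum: "(\<Sum>\<sigma>\<in>\<T>. F \<sigma>) = (\<Sum>j<l. F (e j))" for F :: "'a set \<Rightarrow> real"
    using sum.reindex_bij_betw[OF e, of F] by simp
  define Wof where "Wof x = (\<lambda>y. \<Sum>p\<in>inner_nodes. x (\<iota> p) * hat p y)" for x :: "nat \<Rightarrow> real"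
  have Wof: "Wof x \<in> U0_h \<Omega> \<T>" for x
    unfolding Wof_def by (rule hat_sum(1))
  have gr_Wof: "gr (Wof x) (e j) = (\<Sum>i<n. x i *\<^sub>R gr (hat (h i)) (e j))" if "j < l" for x j
    unfolding Wof_def hat_sum(2)[OF e_in[OF that]] h_sum
    by (intro sum.cong refl) (simp add: \<iota>)
  have Wof_node: "Wof x (h i) = x i" if "i < n" for x i
    unfolding Wof_def using hat_sum(3)[OF h_in[OF that], of "\<lambda>p. x (\<iota> p)"] \<iota>[OF that] by simp
  \<comment> \<open>The part of the difference quotient that comes from the previous iterate
    \<open>V\<close> has been moved to the right-hand side, next to the load.\<close>
  obtain x q where eq: "\<And>i. i < n \<Longrightarrow> wt (h i) / \<tau> * x i - (\<Sum>j<l. vol (e j) * (q j \<bullet> gr (hat (h i)) (e j)))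
        = L2_inner \<Omega> f (hat (h i)) + wt (h i) / \<tau> * V (h i)"
    and D: "\<And>j. j < l \<Longrightarrow> norm (\<Sum>i<n. x i *\<^sub>R gr (hat (h i)) (e j)) \<le> m (Wof x) (e j)"
    and m: "\<And>j. j < l \<Longrightarrow> m (Wof x) (e j) * norm (q j) + (\<Sum>i<n. x i *\<^sub>R gr (hat (h i)) (e j)) \<bullet> q j \<le> 0"
  proof (rule constrained_system_solvable[of l "\<lambda>j. vol (e j)" n "\<lambda>i. wt (h i) / \<tau>" k0 "\<lambda>j x. m (Wof x) (e j)"
        "\<lambda>i j. gr (hat (h i)) (e j)" "\<lambda>i. L2_inner \<Omega> f (hat (h i)) + wt (h i) / \<tau> * V (h i)"])
    show "0 < vol (e j)" if "j < l" for j using vol_pos e_in that by blast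
    show "0 < wt (h i) / \<tau>" if "i < n" for i
      using wt_pos[of "h i"] h_in[OF that] \<tau> by (simp add: inner_nodes_def)
    show "continuous_on UNIV (\<lambda>x. m (Wof x) (e j))" if "j < l" for j
      unfolding Wof_def by (rule m_cont[OF e_in[OF that]])
  qed (use k0 m_ge e_in that in auto)
  define Q where "Q = step (\<lambda>\<sigma>. q (\<kappa> \<sigma>))"
  have Q: "Q (mid (e j)) = q j" if "j < l" for j
    unfolding Q_def using step_on[OF e_in[OF that] mid_in[OF e_in[OF that]], of "\<lambda>\<sigma>. q (\<kappa> \<sigma>)"] \<kappa>[OF that] by simp
  have QS: "Q \<in> S_h \<T>" unfolding Q_def by (rule step_in_S_h)
  \<comment> \<open>The bound variable \<open>x\<close> is a point and hides the coefficient vector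
    of the same name, hence the copy \<open>x'\<close>.\<close>
  have "galerkin f (\<lambda>x. (Wof x' x - V x) / \<tau>) Q" if "x' = x" for x'
  proof (rule galerkinI[OF f QS])
    fix p assume "p \<in> inner_nodes"
    then obtain i where i: "i < n" "p = h i" using h by (auto simp: bij_betw_def)
    have "(\<Sum>\<sigma>\<in>\<T>. vol \<sigma> * (Q (mid \<sigma>) \<bullet> gr (hat p) \<sigma>)) = (\<Sum>j<l. vol (e j) * (q j \<bullet> gr (hat (h i)) (e j)))"
      unfolding e_sum i by (intro sum.cong refl) (simp add: Q)
    then show "wt p * ((Wof x' p - V p) / \<tau>) - (\<Sum>\<sigma>\<in>\<T>. vol \<sigma> * (Q (mid \<sigma>) \<bullet> gr (hat p) \<sigma>)) = L2_inner \<Omega> f (hat p)"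
      using eq[OF i(1)] i that by (simp add: Wof_node diff_divide_distrib right_diff_distrib)
  qed
  moreover have "dual_pair (m (Wof x)) (Wof x) Q"
    unfolding dual_pair_def
  proof
    fix \<sigma> assume "\<sigma> \<in> \<T>"
    then obtain j where j: "j < l" "\<sigma> = e j" using e by (auto simp: bij_betw_def)
    have le: "norm (gr (Wof x) \<sigma>) \<le> m (Wof x) \<sigma>" using D[OF j(1)] j gr_Wof by simp
    \<comment> \<open>The limit of the penalty fluxes only has a nonpositive gap; equality to zero
      needs the reverse inequality, supplied by feasibility.\<close>
    moreover have "m (Wof x) \<sigma> * norm (Q (mid \<sigma>)) + gr (Wof x) \<sigma> \<bullet> Q (mid \<sigma>) \<le> 0"
      using m[OF j(1)] j gr_Wof Q by simp
    ultimately show "norm (gr (Wof x) \<sigma>) \<le> m (Wof x) \<sigma> \<and> m (Wof x) \<sigma> * norm (Q (mid \<sigma>)) + gr (Wof x) \<sigma> \<bullet> Q (mid \<sigma>) = 0"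
      using duality_gap_nonneg[OF le, of "Q (mid \<sigma>)"] by linarith
  qed
  ultimately show ?thesis using that[OF Wof QS] by blast
qed

text \<open>The three branches are one affine function of the excess over the initial mean, clamped
  to the unit interval. In this form continuity, both bounds and independence of the point
  \<open>x\<close> are visible.\<close>

lemma M_h_on:
  fixes k0 :: real and w0 :: "'a \<Rightarrow> real"
  assumes \<sigma>: "\<sigma> \<in> \<T>" and x: "x \<in> \<sigma>" and \<epsilon>: "0 < \<epsilon>"
  defines "k1 \<equiv> max k0 (norm (gr (pi_h \<Omega> \<T> w0) \<sigma>))"
  shows "M_h \<Omega> \<T> k0 \<epsilon> w0 (P_h \<T> W) x
    = k1 + (k0 - k1) * max 0 (min 1 ((avg \<sigma> W - avg \<sigma> (pi_h \<Omega> \<T> w0)) / \<epsilon>))"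
proof -
  have "x \<in> \<Union>\<T>" using \<sigma> x by blast
  then show ?thesis
    unfolding M_h_def Let_def P_h_on[OF \<sigma> x] grad_U_h[OF pi_h(1) \<sigma> x] k1_def[symmetric]
    using \<epsilon> by (simp add: max_def min_def divide_simps)
qed

lemma M_h_bounds:
  assumes \<sigma>: "\<sigma> \<in> \<T>" and x: "x \<in> \<sigma>" and \<epsilon>: "0 < \<epsilon>"
  shows "k0 \<le> M_h \<Omega> \<T> k0 \<epsilon> w0 (P_h \<T> W) x"
    "M_h \<Omega> \<T> k0 \<epsilon> w0 (P_h \<T> W) x \<le> max k0 (norm (gr (pi_h \<Omega> \<T> w0) \<sigma>))"
proof -
  define k1 where "k1 = max k0 (norm (gr (pi_h \<Omega> \<T> w0) \<sigma>))"
  define s where "s = max 0 (min 1 ((avg \<sigma> W - avg \<sigma> (pi_h \<Omega> \<T> w0)) / \<epsilon>))"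
  have s: "0 \<le> s" "s \<le> 1" and k: "k0 \<le> k1" by (auto simp: s_def k1_def)
  have "M_h \<Omega> \<T> k0 \<epsilon> w0 (P_h \<T> W) x = k1 - (k1 - k0) * s"
    using M_h_on[OF assms] by (simp add: k1_def s_def algebra_simps)
  moreover have "0 \<le> (k1 - k0) * s" "(k1 - k0) * s \<le> k1 - k0"
    using s k by (auto simp: mult_left_le)
  ultimately show "k0 \<le> M_h \<Omega> \<T> k0 \<epsilon> w0 (P_h \<T> W) x"
    "M_h \<Omega> \<T> k0 \<epsilon> w0 (P_h \<T> W) x \<le> max k0 (norm (gr (pi_h \<Omega> \<T> w0) \<sigma>))"
    by (auto simp: k1_def)
qed

lemma M_h_const: "\<sigma> \<in> \<T> \<Longrightarrow> x \<in> \<sigma> \<Longrightarrow> 0 < \<epsilon> \<Longrightarrow>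
    M_h \<Omega> \<T> k0 \<epsilon> w0 (P_h \<T> W) x = M_h \<Omega> \<T> k0 \<epsilon> w0 (P_h \<T> W) (mid \<sigma>)"
  by (simp add: M_h_on mid_in)

lemma M_h_continuous:
  assumes \<sigma>: "\<sigma> \<in> \<T>" and \<epsilon>: "0 < \<epsilon>"
  shows "continuous_on UNIV (\<lambda>x :: nat \<Rightarrow> real.
    M_h \<Omega> \<T> k0 \<epsilon> w0 (P_h \<T> (\<lambda>y. \<Sum>p\<in>inner_nodes. x (\<iota> p) * hat p y)) (mid \<sigma>))"
  unfolding M_h_on[OF \<sigma> mid_in[OF \<sigma>] \<epsilon>] avg_hat_sum[OF \<sigma>]
  by (intro continuous_intros continuous_on_product_coordinates) (use \<epsilon> in auto)

end

section \<open>The discrete obstacle problem\<close>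

locale gradient_obstacle = fe_mesh +
  fixes k0 \<epsilon> :: real and w0 :: "'a \<Rightarrow> real"
  assumes k0: "0 < k0" and \<epsilon>: "0 < \<epsilon>" and w0_frontier: "\<And>x. x \<in> frontier \<Omega> \<Longrightarrow> w0 x = 0"
begin

definition bnd :: "('a \<Rightarrow> real) \<Rightarrow> 'a set \<Rightarrow> real" where
  "bnd W \<sigma> = M_h \<Omega> \<T> k0 \<epsilon> w0 (P_h \<T> W) (mid \<sigma>)"

lemma M_h_bnd: "\<sigma> \<in> \<T> \<Longrightarrow> x \<in> \<sigma> \<Longrightarrow> M_h \<Omega> \<T> k0 \<epsilon> w0 (P_h \<T> W) x = bnd W \<sigma>"
  unfolding bnd_def by (rule M_h_const[OF _ _ \<epsilon>])

lemma bnd_ge: "\<sigma> \<in> \<T> \<Longrightarrow> k0 \<le> bnd W \<sigma>"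
  unfolding bnd_def by (rule M_h_bounds(1)[OF _ mid_in \<epsilon>])

lemma bnd_le: "\<sigma> \<in> \<T> \<Longrightarrow> bnd W \<sigma> \<le> max k0 (norm (gr (pi_h \<Omega> \<T> w0) \<sigma>))"
  unfolding bnd_def by (rule M_h_bounds(2)[OF _ mid_in \<epsilon>])

lemma bnd_pos: "\<sigma> \<in> \<T> \<Longrightarrow> 0 < bnd W \<sigma>"
  using bnd_ge k0 by (metis less_le_trans)

lemma Q_step_iff:
  "Q_step \<Omega> \<T> k0 \<epsilon> w0 f t n V W Q \<longleftrightarrow> W \<in> U0_h \<Omega> \<T> \<and> Q \<in> S_h \<T> \<and>
     galerkin (f_avg f t n) (\<lambda>x. (W x - V x) / tau t n) Q \<and> dual_pair (bnd W) W Q"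
proof (cases "W \<in> U0_h \<Omega> \<T> \<and> Q \<in> S_h \<T>")
  case True
  then have "(\<forall>v\<in>S_h \<T>. L2_inner \<Omega> (M_h \<Omega> \<T> k0 \<epsilon> w0 (P_h \<T> W)) (\<lambda>x. norm (v x) - norm (Q x))
      + L2_inner \<Omega> (grad W) (\<lambda>x. v x - Q x) \<ge> 0) \<longleftrightarrow> dual_pair (bnd W) W Q"
    by (intro dual_pair_iff_variational M_h_bnd U0_h_U_h) auto
  then show ?thesis unfolding Q_step_def galerkin_def by simp
qed (auto simp: Q_step_def)

lemma Q_step_solvable:
  assumes "set_integrable lebesgue \<Omega> (f_avg f t n)" "0 < tau t n"
  shows "\<exists>W Q. Q_step \<Omega> \<T> k0 \<epsilon> w0 f t n V W Q"
proof -
  obtain W Q where "W \<in> U0_h \<Omega> \<T>" "Q \<in> S_h \<T>"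
    "galerkin (f_avg f t n) (\<lambda>x. (W x - V x) / tau t n) Q" "dual_pair (bnd W) W Q"
  proof (rule discrete_step_solvable[OF assms k0, of bnd V])
    show "k0 \<le> bnd W \<sigma>" if "\<sigma> \<in> \<T>" for W \<sigma> using that by (rule bnd_ge)
    show "continuous_on UNIV (\<lambda>x :: nat \<Rightarrow> real. bnd (\<lambda>y. \<Sum>p\<in>inner_nodes. x (\<iota> p) * hat p y) \<sigma>)"
      if "\<sigma> \<in> \<T>" for \<sigma> \<iota>
      unfolding bnd_def by (rule M_h_continuous[OF that \<epsilon>])
  qed (use that in blast)
  then show ?thesis using Q_step_iff by blast
qed

lemma K_h_iff:
  "\<eta> \<in> K_h \<Omega> \<T> k0 \<epsilon> w0 W \<longleftrightarrow> \<eta> \<in> U0_h \<Omega> \<T> \<and> (\<forall>\<sigma>\<in>\<T>. norm (gr \<eta> \<sigma>) \<le> bnd W \<sigma>)"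
proof -
  have "(AE x in lebesgue_on \<Omega>. norm (grad \<eta> x) \<le> M_h \<Omega> \<T> k0 \<epsilon> w0 (P_h \<T> W) x)
      \<longleftrightarrow> (\<forall>\<sigma>\<in>\<T>. norm (gr \<eta> \<sigma>) \<le> bnd W \<sigma>)" if "\<eta> \<in> U0_h \<Omega> \<T>"
    by (rule AE_domain_iff) (simp add: grad_U_h[OF U0_h_U_h[OF that]] M_h_bnd)
  then show ?thesis unfolding K_h_def by auto
qed

lemma galerkin_iff_Z:
  "Q \<in> Z_h \<Omega> \<T> f t W n \<longleftrightarrow> Q \<in> S_h \<T> \<and> galerkin (f_avg f t n) (\<lambda>x. (W n x - W (n - 1) x) / tau t n) Q"
  unfolding Z_h_def galerkin_def by (auto simp: algebra_simps)

lemma weighted_norm: "Q \<in> S_h \<T> \<Longrightarrow>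
    L2_inner \<Omega> (M_h \<Omega> \<T> k0 \<epsilon> w0 (P_h \<T> W)) (\<lambda>x. norm (Q x)) = (\<Sum>\<sigma>\<in>\<T>. vol \<sigma> * (bnd W \<sigma> * norm (Q (mid \<sigma>))))"
  by (subst L2_inner_const[OF M_h_bnd, where b = "\<lambda>\<sigma>. norm (Q (mid \<sigma>))"]) (simp_all add: S_h_on)

lemma lumped_nonneg: "0 \<le> lumped \<T> u u"
  unfolding lumped_nodes using wt_pos less_imp_le by (intro sum_nonneg mult_nonneg_nonneg[OF _ zero_le_square]) auto

lemma galerkin_diff:
  assumes gal: "galerkin f g Q" and Q: "Q \<in> S_h \<T>" and \<eta>: "\<eta> \<in> U0_h \<Omega> \<T>" and W: "W \<in> U0_h \<Omega> \<T>"
  shows "lumped \<T> g (\<lambda>x. \<eta> x - W x) - L2_inner \<Omega> f (\<lambda>x. \<eta> x - W x)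
    = (\<Sum>\<sigma>\<in>\<T>. vol \<sigma> * (Q (mid \<sigma>) \<bullet> (gr \<eta> \<sigma> - gr W \<sigma>)))"
  using galerkinD[OF gal Q U0_h_diff(1)[OF \<eta> W]] U0_h_diff(2)[OF \<eta> W] by simp

text \<open>Because the gap of \<open>W\<close> vanishes,
  \<open>Q . (\<nabla>\<eta> - \<nabla>W)\<close> is the duality gap of \<open>\<eta>\<close>
  against \<open>Q\<close>, nonnegative by feasibility of \<open>\<eta>\<close>.\<close>

lemma galerkin_variational:
  assumes gal: "galerkin f g Q" and Q: "Q \<in> S_h \<T>" and d: "dual_pair m W Q" and W: "W \<in> U0_h \<Omega> \<T>"
    and \<eta>: "\<eta> \<in> U0_h \<Omega> \<T>" and le: "\<And>\<sigma>. \<sigma> \<in> \<T> \<Longrightarrow> norm (gr \<eta> \<sigma>) \<le> m \<sigma>"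
  shows "L2_inner \<Omega> f (\<lambda>x. \<eta> x - W x) \<le> lumped \<T> g (\<lambda>x. \<eta> x - W x)"
proof -
  have "0 \<le> vol \<sigma> * (Q (mid \<sigma>) \<bullet> (gr \<eta> \<sigma> - gr W \<sigma>))" if \<sigma>: "\<sigma> \<in> \<T>" for \<sigma>
  proof -
    have "Q (mid \<sigma>) \<bullet> (gr \<eta> \<sigma> - gr W \<sigma>) = m \<sigma> * norm (Q (mid \<sigma>)) + gr \<eta> \<sigma> \<bullet> Q (mid \<sigma>)"
      using d \<sigma> by (auto simp: dual_pair_def inner_diff_right inner_commute)
    then show ?thesis using duality_gap_nonneg[OF le[OF \<sigma>], of "Q (mid \<sigma>)"] vol_pos[OF \<sigma>] by simp
  qed
  then have "0 \<le> (\<Sum>\<sigma>\<in>\<T>. vol \<sigma> * (Q (mid \<sigma>) \<bullet> (gr \<eta> \<sigma> - gr W \<sigma>)))" by (rule sum_nonneg)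
  then show ?thesis using galerkin_diff[OF gal Q \<eta> W] by simp
qed

text \<open>Given a solution \<open>W\<close> of the primal problem, freezing the bound at \<open>W\<close> yields a pair whose first
  component coincides with \<open>W\<close>; comparing its flux with the minimal flux forces the duality gap of
  the latter to vanish.\<close>

lemma dual_pair_of_primal_and_mixed:
  assumes f: "set_integrable lebesgue \<Omega> f" and \<tau>: "0 < \<tau>"
    and W: "W \<in> U0_h \<Omega> \<T>" and W_le: "\<And>\<sigma>. \<sigma> \<in> \<T> \<Longrightarrow> norm (gr W \<sigma>) \<le> m \<sigma>" and m: "\<And>\<sigma>. \<sigma> \<in> \<T> \<Longrightarrow> k0 \<le> m \<sigma>"
    and vi: "\<And>\<eta>. \<eta> \<in> U0_h \<Omega> \<T> \<Longrightarrow> (\<And>\<sigma>. \<sigma> \<in> \<T> \<Longrightarrow> norm (gr \<eta> \<sigma>) \<le> m \<sigma>) \<Longrightarrow>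
      L2_inner \<Omega> f (\<lambda>x. \<eta> x - W x) \<le> lumped \<T> (\<lambda>x. (W x - V x) / \<tau>) (\<lambda>x. \<eta> x - W x)"
    and Q: "Q \<in> S_h \<T>" and gal: "galerkin f (\<lambda>x. (W x - V x) / \<tau>) Q"
    and minimal: "\<And>v. v \<in> S_h \<T> \<Longrightarrow> galerkin f (\<lambda>x. (W x - V x) / \<tau>) v \<Longrightarrow>
      (\<Sum>\<sigma>\<in>\<T>. vol \<sigma> * (m \<sigma> * norm (Q (mid \<sigma>)))) \<le> (\<Sum>\<sigma>\<in>\<T>. vol \<sigma> * (m \<sigma> * norm (v (mid \<sigma>))))"
  shows "dual_pair m W Q"
proof -
  obtain W' Q' where W': "W' \<in> U0_h \<Omega> \<T>" and Q': "Q' \<in> S_h \<T>"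
    and gal': "galerkin f (\<lambda>x. (W' x - V x) / \<tau>) Q'" and d': "dual_pair m W' Q'"
    using discrete_step_solvable[OF f \<tau> k0, of "\<lambda>_. m" V] m by auto
  \<comment> \<open>Both functions satisfy the variational inequality over the same fixed constraint
    set. Testing each with the other and adding leaves a nonpositive multiple of the lumped square
    of their difference on the right.\<close>
  have "W = W'"
  proof (rule lumped_zero_imp_eq[OF W W'])
    have "L2_inner \<Omega> f (\<lambda>x. W' x - W x) \<le> lumped \<T> (\<lambda>x. (W x - V x) / \<tau>) (\<lambda>x. W' x - W x)"
      by (rule vi[OF W']) (use d' in \<open>simp add: dual_pair_def\<close>)
    moreover have "L2_inner \<Omega> f (\<lambda>x. W x - W' x) \<le> lumped \<T> (\<lambda>x. (W' x - V x) / \<tau>) (\<lambda>x. W x - W' x)"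
      by (rule galerkin_variational[OF gal' Q' d' W' W W_le])
    moreover have "L2_inner \<Omega> f (\<lambda>x. W x - W' x) = - L2_inner \<Omega> f (\<lambda>x. W' x - W x)"
    proof -
      have "(\<lambda>x. indicator \<Omega> x *\<^sub>R (f x \<bullet> (W x - W' x))) = (\<lambda>x. - (indicator \<Omega> x *\<^sub>R (f x \<bullet> (W' x - W x))))"
        by (simp add: fun_eq_iff algebra_simps)
      then show ?thesis
        unfolding L2_inner_def set_lebesgue_integral_def by (simp only: integral_minus)
    qed
    moreover have "lumped \<T> (\<lambda>x. (W x - V x) / \<tau>) (\<lambda>x. W' x - W x)
        + lumped \<T> (\<lambda>x. (W' x - V x) / \<tau>) (\<lambda>x. W x - W' x)
        = - (1 / \<tau>) * lumped \<T> (\<lambda>x. W x - W' x) (\<lambda>x. W x - W' x)"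
      unfolding lumped_nodes sum.distrib[symmetric] sum_distrib_left
      by (intro sum.cong refl) (use \<tau> in \<open>simp add: field_simps\<close>)
    ultimately have "(1 / \<tau>) * lumped \<T> (\<lambda>x. W x - W' x) (\<lambda>x. W x - W' x) \<le> 0" by linarith
    then show "lumped \<T> (\<lambda>x. W x - W' x) (\<lambda>x. W x - W' x) \<le> 0"
      using \<tau> by (simp add: divide_le_0_iff)
  qed
  then have gal'': "galerkin f (\<lambda>x. (W x - V x) / \<tau>) Q'" and d'': "dual_pair m W Q'"
    using gal' d' by auto
  have "(\<Sum>\<sigma>\<in>\<T>. vol \<sigma> * (m \<sigma> * norm (Q (mid \<sigma>)))) \<le> (\<Sum>\<sigma>\<in>\<T>. vol \<sigma> * (m \<sigma> * norm (Q' (mid \<sigma>))))"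
    by (rule minimal[OF Q' gal''])
  \<comment> \<open>A vanishing gap identifies the weighted norm of \<open>Q'\<close> with minus its
    pairing with the gradient of \<open>W\<close>, and the flux equation tested with
    \<open>W\<close> gives that pairing the same value for \<open>Q\<close>.\<close>
  also have "\<dots> = (\<Sum>\<sigma>\<in>\<T>. - (vol \<sigma> * (Q' (mid \<sigma>) \<bullet> gr W \<sigma>)))"
    using d'' by (intro sum.cong refl)
      (simp add: dual_pair_def inner_commute eq_neg_iff_add_eq_0 flip: distrib_left)
  also have "\<dots> = (\<Sum>\<sigma>\<in>\<T>. - (vol \<sigma> * (Q (mid \<sigma>) \<bullet> gr W \<sigma>)))"
    using galerkinD[OF gal Q W] galerkinD[OF gal'' Q' W] by (simp add: sum_negf)
  finally have "(\<Sum>\<sigma>\<in>\<T>. vol \<sigma> * (m \<sigma> * norm (Q (mid \<sigma>)) + gr W \<sigma> \<bullet> Q (mid \<sigma>))) \<le> 0"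
    by (simp add: sum_negf distrib_left sum.distrib inner_commute)
  moreover have nn: "0 \<le> vol \<sigma> * (m \<sigma> * norm (Q (mid \<sigma>)) + gr W \<sigma> \<bullet> Q (mid \<sigma>))" if "\<sigma> \<in> \<T>" for \<sigma>
    using duality_gap_nonneg[OF W_le[OF that]] vol_pos[OF that] by simp
  ultimately have "(\<Sum>\<sigma>\<in>\<T>. vol \<sigma> * (m \<sigma> * norm (Q (mid \<sigma>)) + gr W \<sigma> \<bullet> Q (mid \<sigma>))) = 0"
    by (intro antisym sum_nonneg) auto
  then have "\<forall>\<sigma>\<in>\<T>. vol \<sigma> * (m \<sigma> * norm (Q (mid \<sigma>)) + gr W \<sigma> \<bullet> Q (mid \<sigma>)) = 0"
    using sum_nonneg_eq_0_iff[OF finite_mesh, of "\<lambda>\<sigma>. vol \<sigma> * (m \<sigma> * norm (Q (mid \<sigma>)) + gr W \<sigma> \<bullet> Q (mid \<sigma>))"] nn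
    by simp
  then show ?thesis
    unfolding dual_pair_def using W_le vol_pos by fastforce
qed

text \<open>From left to right this is weak duality for the flux and
  \<open>galerkin_variational\<close> for the primal part; from right to left,
  \<open>dual_pair_of_primal_and_mixed\<close> at each time step.\<close>

lemma solves_Q_iff:
  assumes f: "\<And>n. n \<in> {1..N} \<Longrightarrow> set_integrable lebesgue \<Omega> (f_avg f t n)"
    and \<tau>: "\<And>n. n \<in> {1..N} \<Longrightarrow> 0 < tau t n"
  shows "solves_Q \<Omega> \<T> k0 \<epsilon> w0 f t N W Q \<longleftrightarrow>
    solves_P \<Omega> \<T> k0 \<epsilon> w0 f t N W \<and> solves_M \<Omega> \<T> k0 \<epsilon> w0 f t N W Q"
proof
  assume Q: "solves_Q \<Omega> \<T> k0 \<epsilon> w0 f t N W Q"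
  have step: "W n \<in> U0_h \<Omega> \<T>" "Q n \<in> S_h \<T>"
    "galerkin (f_avg f t n) (\<lambda>x. (W n x - W (n - 1) x) / tau t n) (Q n)" "dual_pair (bnd (W n)) (W n) (Q n)"
    if "n \<in> {1..N}" for n
    using Q that by (auto simp: solves_Q_def Q_step_iff)
  have "solves_P \<Omega> \<T> k0 \<epsilon> w0 f t N W"
    unfolding solves_P_def
  proof (intro conjI ballI)
    show "W 0 = pi_h \<Omega> \<T> w0" using Q by (simp add: solves_Q_def)
    fix n assume n: "n \<in> {1..N}"
    show "W n \<in> K_h \<Omega> \<T> k0 \<epsilon> w0 (W n)"
      using step[OF n] by (simp add: K_h_iff dual_pair_def)
    fix \<eta> assume "\<eta> \<in> K_h \<Omega> \<T> k0 \<epsilon> w0 (W n)"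
    then show "L2_inner \<Omega> (f_avg f t n) (\<lambda>x. \<eta> x - W n x)
        \<le> lumped \<T> (\<lambda>x. (W n x - W (n - 1) x) / tau t n) (\<lambda>x. \<eta> x - W n x)"
      by (intro galerkin_variational[OF step(3)[OF n] step(2)[OF n] step(4)[OF n] step(1)[OF n]]) (auto simp: K_h_iff)
  qed
  moreover have "solves_M \<Omega> \<T> k0 \<epsilon> w0 f t N W Q"
    unfolding solves_M_def
  proof (intro ballI conjI)
    fix n assume n: "n \<in> {1..N}"
    show "Q n \<in> Z_h \<Omega> \<T> f t W n" using step[OF n] by (simp add: galerkin_iff_Z)
    fix v assume "v \<in> Z_h \<Omega> \<T> f t W n"
    then have v: "v \<in> S_h \<T>" "galerkin (f_avg f t n) (\<lambda>x. (W n x - W (n - 1) x) / tau t n) v"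
      by (auto simp: galerkin_iff_Z)
    \<comment> \<open>All members of \<open>Z_h\<close> have the same pairing with the gradient of
      \<open>W n\<close>; minus that pairing is a lower bound for each weighted norm, attained by
      \<open>Q n\<close>.\<close>
    have "(\<Sum>\<sigma>\<in>\<T>. vol \<sigma> * (bnd (W n) \<sigma> * norm (Q n (mid \<sigma>)))) = (\<Sum>\<sigma>\<in>\<T>. - (vol \<sigma> * (Q n (mid \<sigma>) \<bullet> gr (W n) \<sigma>)))"
      using step(4)[OF n] by (intro sum.cong refl)
        (simp add: dual_pair_def inner_commute eq_neg_iff_add_eq_0 flip: distrib_left)
    also have "\<dots> = (\<Sum>\<sigma>\<in>\<T>. - (vol \<sigma> * (v (mid \<sigma>) \<bullet> gr (W n) \<sigma>)))"
      using galerkinD[OF step(3)[OF n] step(2)[OF n] step(1)[OF n]] galerkinD[OF v(2,1) step(1)[OF n]] by (simp add: sum_negf)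
    also have "\<dots> \<le> (\<Sum>\<sigma>\<in>\<T>. vol \<sigma> * (bnd (W n) \<sigma> * norm (v (mid \<sigma>))))"
    proof (rule sum_mono)
      fix \<sigma> assume \<sigma>: "\<sigma> \<in> \<T>"
      then have "0 \<le> bnd (W n) \<sigma> * norm (v (mid \<sigma>)) + gr (W n) \<sigma> \<bullet> v (mid \<sigma>)"
        using step(4)[OF n] by (intro duality_gap_nonneg) (simp add: dual_pair_def)
      then have "- (v (mid \<sigma>) \<bullet> gr (W n) \<sigma>) \<le> bnd (W n) \<sigma> * norm (v (mid \<sigma>))"
        by (simp add: inner_commute)
      from mult_left_mono[OF this less_imp_le[OF vol_pos[OF \<sigma>]]]
      show "- (vol \<sigma> * (v (mid \<sigma>) \<bullet> gr (W n) \<sigma>)) \<le> vol \<sigma> * (bnd (W n) \<sigma> * norm (v (mid \<sigma>)))" by simp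
    qed
    finally show "L2_inner \<Omega> (M_h \<Omega> \<T> k0 \<epsilon> w0 (P_h \<T> (W n))) (\<lambda>x. norm (Q n x))
        \<le> L2_inner \<Omega> (M_h \<Omega> \<T> k0 \<epsilon> w0 (P_h \<T> (W n))) (\<lambda>x. norm (v x))"
      by (simp add: weighted_norm v step[OF n])
  qed
  ultimately show "solves_P \<Omega> \<T> k0 \<epsilon> w0 f t N W \<and> solves_M \<Omega> \<T> k0 \<epsilon> w0 f t N W Q" ..
next
  assume "solves_P \<Omega> \<T> k0 \<epsilon> w0 f t N W \<and> solves_M \<Omega> \<T> k0 \<epsilon> w0 f t N W Q"
  then have P: "solves_P \<Omega> \<T> k0 \<epsilon> w0 f t N W" and M: "solves_M \<Omega> \<T> k0 \<epsilon> w0 f t N W Q" by auto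
  show "solves_Q \<Omega> \<T> k0 \<epsilon> w0 f t N W Q"
    unfolding solves_Q_def
  proof (intro conjI ballI)
    show "W 0 = pi_h \<Omega> \<T> w0" using P by (simp add: solves_P_def)
    fix n assume n: "n \<in> {1..N}"
    have "W n \<in> K_h \<Omega> \<T> k0 \<epsilon> w0 (W n)" using P n by (simp add: solves_P_def)
    then have W: "W n \<in> U0_h \<Omega> \<T>" "\<And>\<sigma>. \<sigma> \<in> \<T> \<Longrightarrow> norm (gr (W n) \<sigma>) \<le> bnd (W n) \<sigma>"
      by (auto simp: K_h_iff)
    have Q: "Q n \<in> S_h \<T>" "galerkin (f_avg f t n) (\<lambda>x. (W n x - W (n - 1) x) / tau t n) (Q n)"
      using M n by (auto simp: solves_M_def galerkin_iff_Z)
    have "dual_pair (bnd (W n)) (W n) (Q n)"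
    proof (rule dual_pair_of_primal_and_mixed[OF f[OF n] \<tau>[OF n] W bnd_ge _ Q])
      fix \<eta> assume "\<eta> \<in> U0_h \<Omega> \<T>" "\<And>\<sigma>. \<sigma> \<in> \<T> \<Longrightarrow> norm (gr \<eta> \<sigma>) \<le> bnd (W n) \<sigma>"
      then have "\<eta> \<in> K_h \<Omega> \<T> k0 \<epsilon> w0 (W n)" by (simp add: K_h_iff)
      then show "L2_inner \<Omega> (f_avg f t n) (\<lambda>x. \<eta> x - W n x)
          \<le> lumped \<T> (\<lambda>x. (W n x - W (n - 1) x) / tau t n) (\<lambda>x. \<eta> x - W n x)"
        using P n by (simp add: solves_P_def)
    next
      fix v assume v: "v \<in> S_h \<T>" "galerkin (f_avg f t n) (\<lambda>x. (W n x - W (n - 1) x) / tau t n) v"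
      then have "v \<in> Z_h \<Omega> \<T> f t W n" by (simp add: galerkin_iff_Z)
      then have "L2_inner \<Omega> (M_h \<Omega> \<T> k0 \<epsilon> w0 (P_h \<T> (W n))) (\<lambda>x. norm (Q n x))
          \<le> L2_inner \<Omega> (M_h \<Omega> \<T> k0 \<epsilon> w0 (P_h \<T> (W n))) (\<lambda>x. norm (v x))"
        using M n by (simp add: solves_M_def)
      then show "(\<Sum>\<sigma>\<in>\<T>. vol \<sigma> * (bnd (W n) \<sigma> * norm (Q n (mid \<sigma>))))
          \<le> (\<Sum>\<sigma>\<in>\<T>. vol \<sigma> * (bnd (W n) \<sigma> * norm (v (mid \<sigma>))))"
        by (simp add: weighted_norm v Q)
    qed
    then show "Q_step \<Omega> \<T> k0 \<epsilon> w0 f t n (W (n - 1)) (W n) (Q n)"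
      using W Q by (simp add: Q_step_iff)
  qed
qed

subsection \<open>Lagrange multipliers\<close>

text \<open>Equality case of Cauchy-Schwarz. With \<open>l = norm q / m\<close>, the square of
  \<open>norm (q + l *\<^sub>R g)\<close> expands to
  \<open>l\<^sup>2 * ((norm g)\<^sup>2 - m\<^sup>2)\<close>, which feasibility makes nonpositive.
  Its vanishing gives the alignment and complementary slackness.\<close>

lemma dual_pair_alignment:
  fixes g q :: 'a
  assumes le: "norm g \<le> m" and eq: "m * norm q + g \<bullet> q = 0" and m: "0 < m"
  shows "q = - (norm q / m) *\<^sub>R g" "norm q / m * ((norm g)\<^sup>2 - m\<^sup>2) = 0"
proof -
  define l where "l = norm q / m"
  have l: "0 \<le> l" "norm q = l * m" using m by (simp_all add: l_def)
  have gq: "g \<bullet> q = - (m * (l * m))" using eq l by simp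
  have "(norm (q + l *\<^sub>R g))\<^sup>2 = (norm q)\<^sup>2 + 2 * l * (g \<bullet> q) + l\<^sup>2 * (norm g)\<^sup>2"
    by (simp only: power2_norm_eq_inner)
      (simp add: inner_add_left inner_add_right inner_commute power2_eq_square algebra_simps)
  also have "\<dots> = l\<^sup>2 * ((norm g)\<^sup>2 - m\<^sup>2)"
    unfolding gq l(2) by (simp add: power2_eq_square algebra_simps)
  finally have sq: "(norm (q + l *\<^sub>R g))\<^sup>2 = l\<^sup>2 * ((norm g)\<^sup>2 - m\<^sup>2)" .
  have "(norm g)\<^sup>2 \<le> m\<^sup>2" using le by (rule power_mono) simp
  then have "l\<^sup>2 * ((norm g)\<^sup>2 - m\<^sup>2) \<le> 0" by (simp add: mult_nonneg_nonpos)
  then have z: "(norm (q + l *\<^sub>R g))\<^sup>2 = 0" using sq zero_le_power2[of "norm (q + l *\<^sub>R g)"] by linarith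
  then have "q + l *\<^sub>R g = 0" by simp
  then show "q = - (norm q / m) *\<^sub>R g" by (simp add: l_def eq_neg_iff_add_eq_0)
  have "l\<^sup>2 * ((norm g)\<^sup>2 - m\<^sup>2) = 0" using sq z by simp
  then show "norm q / m * ((norm g)\<^sup>2 - m\<^sup>2) = 0" by (auto simp: l_def)
qed

text \<open>Maximality in the multiplier is complementary slackness together with feasibility.
  Minimality in \<open>\<eta>\<close> holds because the Lagrangian is quadratic: at
  \<open>W n\<close> its linear part is cancelled by the flux equation, as \<open>Q\<close> is minus
  the multiplier times the gradient, and its quadratic part is nonnegative.\<close>

lemma Q_step_multiplier:
  assumes f: "set_integrable lebesgue \<Omega> (f_avg f t n)" and \<tau>: "0 < tau t n"
    and step: "Q_step \<Omega> \<T> k0 \<epsilon> w0 f t n (W (n - 1)) (W n) Q"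
  shows "\<exists>\<Lambda>. lagrange_multiplier \<Omega> \<T> k0 \<epsilon> w0 f t W n \<Lambda> \<and> (\<forall>x. Q x = - \<Lambda> x *\<^sub>R grad (W n) x)"
proof -
  have W: "W n \<in> U0_h \<Omega> \<T>" and Q: "Q \<in> S_h \<T>"
    and gal: "galerkin (f_avg f t n) (\<lambda>x. (W n x - W (n - 1) x) / tau t n) Q"
    and d: "dual_pair (bnd (W n)) (W n) Q"
    using step by (auto simp: Q_step_iff)
  define l where "l \<sigma> = norm (Q (mid \<sigma>)) / bnd (W n) \<sigma>" for \<sigma>
  define \<Lambda> where "\<Lambda> = step l"
  have l: "0 \<le> l \<sigma>" if "\<sigma> \<in> \<T>" for \<sigma> using bnd_pos[OF that, of "W n"] by (simp add: l_def)
  have \<Lambda>_on: "\<Lambda> x = l \<sigma>" if "\<sigma> \<in> \<T>" "x \<in> \<sigma>" for x \<sigma> using step_on[OF that, of l] by (simp add: \<Lambda>_def)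
  have Ql: "Q (mid \<sigma>) = - l \<sigma> *\<^sub>R gr (W n) \<sigma>" and cs: "l \<sigma> * ((norm (gr (W n) \<sigma>))\<^sup>2 - (bnd (W n) \<sigma>)\<^sup>2) = 0"
    if "\<sigma> \<in> \<T>" for \<sigma>
    using dual_pair_alignment[of "gr (W n) \<sigma>" "bnd (W n) \<sigma>" "Q (mid \<sigma>)"] d that bnd_pos[OF that, of "W n"]
    by (auto simp: dual_pair_def l_def)
  have "Q x = - \<Lambda> x *\<^sub>R grad (W n) x" for x
  proof (cases "x \<in> \<Union>\<T>")
    case True
    then obtain \<sigma> where \<sigma>: "\<sigma> \<in> \<T>" "x \<in> \<sigma>" by blast
    show ?thesis
      unfolding S_h_on[OF Q \<sigma>] Ql[OF \<sigma>(1)] \<Lambda>_on[OF \<sigma>] grad_U_h[OF U0_h_U_h[OF W] \<sigma>] ..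
  next
    \<comment> \<open>Off the open elements \<open>grad (W n)\<close> may be meaningless, but
      \<open>Q\<close> and \<open>\<Lambda>\<close> both vanish there by the choice of
      representatives in \<open>S_h\<close>.\<close>
    case False
    then show ?thesis using Q step_off[OF False, of l] by (simp add: S_h_def \<Lambda>_def)
  qed
  moreover have "lagrange_multiplier \<Omega> \<T> k0 \<epsilon> w0 f t W n \<Lambda>"
    unfolding lagrange_multiplier_def
  proof (intro conjI ballI)
    have "0 \<le> \<Lambda> x" for x
      by (cases "x \<in> \<Union>\<T>") (use \<Lambda>_on l step_off[of x l] in \<open>auto simp: \<Lambda>_def\<close>)
    then show "\<Lambda> \<in> S_h_nonneg \<T>" using step_in_S_h[of l] by (simp add: S_h_nonneg_def \<Lambda>_def)
    have con: "L2_inner \<Omega> \<mu> (\<lambda>x. (norm (grad \<eta> x))\<^sup>2 - (M_h \<Omega> \<T> k0 \<epsilon> w0 (P_h \<T> (W n)) x)\<^sup>2)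
        = (\<Sum>\<sigma>\<in>\<T>. vol \<sigma> * (\<mu> (mid \<sigma>) * ((norm (gr \<eta> \<sigma>))\<^sup>2 - (bnd (W n) \<sigma>)\<^sup>2)))"
      if \<mu>: "\<mu> \<in> S_h \<T>" and \<eta>: "\<eta> \<in> U0_h \<Omega> \<T>" for \<mu> \<eta>
      by (subst L2_inner_const[where a = "\<lambda>\<sigma>. \<mu> (mid \<sigma>)"
            and b = "\<lambda>\<sigma>. (norm (gr \<eta> \<sigma>))\<^sup>2 - (bnd (W n) \<sigma>)\<^sup>2"])
        (simp_all add: S_h_on[OF \<mu>] grad_U_h[OF U0_h_U_h[OF \<eta>]] M_h_bnd)
    have \<Lambda>S: "\<Lambda> \<in> S_h \<T>" unfolding \<Lambda>_def by (rule step_in_S_h)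
    have \<Lambda>mid: "\<Lambda> (mid \<sigma>) = l \<sigma>" if "\<sigma> \<in> \<T>" for \<sigma> using \<Lambda>_on[OF that mid_in[OF that]] .
    fix \<mu> assume "\<mu> \<in> S_h_nonneg \<T>"
    then have \<mu>: "\<mu> \<in> S_h \<T>" "\<And>x. 0 \<le> \<mu> x" by (auto simp: S_h_nonneg_def)
    have "(\<Sum>\<sigma>\<in>\<T>. vol \<sigma> * (\<mu> (mid \<sigma>) * ((norm (gr (W n) \<sigma>))\<^sup>2 - (bnd (W n) \<sigma>)\<^sup>2)))
        \<le> (\<Sum>\<sigma>\<in>\<T>. vol \<sigma> * (\<Lambda> (mid \<sigma>) * ((norm (gr (W n) \<sigma>))\<^sup>2 - (bnd (W n) \<sigma>)\<^sup>2)))"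
    proof (rule sum_mono)
      fix \<sigma> assume \<sigma>: "\<sigma> \<in> \<T>"
      have "norm (gr (W n) \<sigma>) \<le> bnd (W n) \<sigma>" using d \<sigma> by (simp add: dual_pair_def)
      then have "(norm (gr (W n) \<sigma>))\<^sup>2 \<le> (bnd (W n) \<sigma>)\<^sup>2" by (rule power_mono) simp
      then have "vol \<sigma> * (\<mu> (mid \<sigma>) * ((norm (gr (W n) \<sigma>))\<^sup>2 - (bnd (W n) \<sigma>)\<^sup>2)) \<le> 0"
        using vol_pos[OF \<sigma>] \<mu>(2) by (simp add: mult_nonneg_nonpos)
      then show "vol \<sigma> * (\<mu> (mid \<sigma>) * ((norm (gr (W n) \<sigma>))\<^sup>2 - (bnd (W n) \<sigma>)\<^sup>2))
          \<le> vol \<sigma> * (\<Lambda> (mid \<sigma>) * ((norm (gr (W n) \<sigma>))\<^sup>2 - (bnd (W n) \<sigma>)\<^sup>2))"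
        by (simp add: \<Lambda>mid[OF \<sigma>] cs[OF \<sigma>])
    qed
    then show "Lagrangian \<Omega> \<T> k0 \<epsilon> w0 f t W n (W n) \<mu> \<le> Lagrangian \<Omega> \<T> k0 \<epsilon> w0 f t W n (W n) \<Lambda>"
      by (simp add: Lagrangian_def con[OF \<mu>(1) W] con[OF \<Lambda>S W])
  next
    fix \<eta> assume \<eta>: "\<eta> \<in> U0_h \<Omega> \<T>"
    have con: "L2_inner \<Omega> \<Lambda> (\<lambda>x. (norm (grad \<zeta> x))\<^sup>2 - (M_h \<Omega> \<T> k0 \<epsilon> w0 (P_h \<T> (W n)) x)\<^sup>2)
        = (\<Sum>\<sigma>\<in>\<T>. vol \<sigma> * (l \<sigma> * ((norm (gr \<zeta> \<sigma>))\<^sup>2 - (bnd (W n) \<sigma>)\<^sup>2)))"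
      if \<zeta>: "\<zeta> \<in> U0_h \<Omega> \<T>" for \<zeta>
      by (subst L2_inner_const[where a = l and b = "\<lambda>\<sigma>. (norm (gr \<zeta> \<sigma>))\<^sup>2 - (bnd (W n) \<sigma>)\<^sup>2"])
        (simp_all add: \<Lambda>_on grad_U_h[OF U0_h_U_h[OF \<zeta>]] M_h_bnd)
    \<comment> \<open>Exact second order expansion at \<open>W n\<close>; the last summand is the
      nonnegative remainder.\<close>
    have lump: "1 / (2 * tau t n) * lumped \<T> (\<lambda>x. \<eta> x - W (n - 1) x) (\<lambda>x. \<eta> x - W (n - 1) x)
        = 1 / (2 * tau t n) * lumped \<T> (\<lambda>x. W n x - W (n - 1) x) (\<lambda>x. W n x - W (n - 1) x)
        + lumped \<T> (\<lambda>x. (W n x - W (n - 1) x) / tau t n) (\<lambda>x. \<eta> x - W n x)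
        + 1 / (2 * tau t n) * lumped \<T> (\<lambda>x. \<eta> x - W n x) (\<lambda>x. \<eta> x - W n x)"
      unfolding lumped_nodes sum_distrib_left sum.distrib[symmetric]
      by (intro sum.cong refl) (use \<tau> in \<open>simp add: field_simps\<close>)
    have lump_nn: "0 \<le> 1 / (2 * tau t n) * lumped \<T> (\<lambda>x. \<eta> x - W n x) (\<lambda>x. \<eta> x - W n x)"
      using \<tau> lumped_nonneg[of "\<lambda>x. \<eta> x - W n x"] by simp
    have load: "L2_inner \<Omega> (f_avg f t n) (\<lambda>x. \<eta> x - W n x) = L2_inner \<Omega> (f_avg f t n) \<eta> - L2_inner \<Omega> (f_avg f t n) (W n)"
      unfolding L2_inner_def
      using set_integral_diff(2)[OF integrable_mult_U_h[OF f U0_h_U_h[OF \<eta>]] integrable_mult_U_h[OF f U0_h_U_h[OF W]]]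
      by (simp add: right_diff_distrib)
    \<comment> \<open>The same expansion for the constraint term: its linear part
      \<open>2 * l \<sigma>\<close> times the gradient of \<open>W n\<close> is \<open>- 2\<close>
      times the flux, and the factor \<open>1 / 2\<close> in the Lagrangian matches it with the flux
      equation.\<close>
    have grads: "(\<Sum>\<sigma>\<in>\<T>. vol \<sigma> * (l \<sigma> * ((norm (gr (W n) \<sigma>))\<^sup>2 - (bnd (W n) \<sigma>)\<^sup>2)))
        - 2 * (\<Sum>\<sigma>\<in>\<T>. vol \<sigma> * (Q (mid \<sigma>) \<bullet> (gr \<eta> \<sigma> - gr (W n) \<sigma>)))
        \<le> (\<Sum>\<sigma>\<in>\<T>. vol \<sigma> * (l \<sigma> * ((norm (gr \<eta> \<sigma>))\<^sup>2 - (bnd (W n) \<sigma>)\<^sup>2)))"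
      unfolding sum_distrib_left sum_subtractf[symmetric]
    proof (rule sum_mono)
      fix \<sigma> assume \<sigma>: "\<sigma> \<in> \<T>"
      have "0 \<le> (norm (gr \<eta> \<sigma> - gr (W n) \<sigma>))\<^sup>2" by simp
      then have "0 \<le> vol \<sigma> * (l \<sigma> * (norm (gr \<eta> \<sigma> - gr (W n) \<sigma>))\<^sup>2)"
        using l[OF \<sigma>] vol_pos[OF \<sigma>] by simp
      moreover have "vol \<sigma> * (l \<sigma> * ((norm (gr \<eta> \<sigma>))\<^sup>2 - (bnd (W n) \<sigma>)\<^sup>2))
          = vol \<sigma> * (l \<sigma> * ((norm (gr (W n) \<sigma>))\<^sup>2 - (bnd (W n) \<sigma>)\<^sup>2))
            - 2 * (vol \<sigma> * (Q (mid \<sigma>) \<bullet> (gr \<eta> \<sigma> - gr (W n) \<sigma>)))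
            + vol \<sigma> * (l \<sigma> * (norm (gr \<eta> \<sigma> - gr (W n) \<sigma>))\<^sup>2)"
        unfolding Ql[OF \<sigma>] power2_norm_eq_inner
        by (simp add: inner_diff_left inner_diff_right inner_commute algebra_simps)
      ultimately show "vol \<sigma> * (l \<sigma> * ((norm (gr (W n) \<sigma>))\<^sup>2 - (bnd (W n) \<sigma>)\<^sup>2))
          - 2 * (vol \<sigma> * (Q (mid \<sigma>) \<bullet> (gr \<eta> \<sigma> - gr (W n) \<sigma>)))
          \<le> vol \<sigma> * (l \<sigma> * ((norm (gr \<eta> \<sigma>))\<^sup>2 - (bnd (W n) \<sigma>)\<^sup>2))" by linarith
    qed
    show "Lagrangian \<Omega> \<T> k0 \<epsilon> w0 f t W n (W n) \<Lambda> \<le> Lagrangian \<Omega> \<T> k0 \<epsilon> w0 f t W n \<eta> \<Lambda>"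
      unfolding Lagrangian_def con[OF W] con[OF \<eta>] lump
      using lump_nn load grads galerkin_diff[OF gal Q \<eta> W] by linarith
  qed
  ultimately show ?thesis by blast
qed

subsection \<open>Stability\<close>

lemma pi_h_w0: "pi_h \<Omega> \<T> w0 \<in> U0_h \<Omega> \<T>"
  using w0_frontier by (rule pi_h_U0_h)

text \<open>The supremum bound \<open>H\<close> follows from the gradient constraint, gives the L2
  and Sobolev bounds at once, and estimates the load term by \<open>H\<close> times an L1 norm. The
  energy inequality of one step then telescopes; \<open>E\<close> collects the initial lumped energy
  and twice the load contribution.\<close>

lemma solves_Q_bounds:
  assumes f: "\<And>n. n \<in> {1..N} \<Longrightarrow> set_integrable lebesgue \<Omega> (f_avg f t n)"
    and \<tau>: "\<And>n. n \<in> {1..N} \<Longrightarrow> 0 < tau t n"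
    and A: "(\<Sum>n=1..N. tau t n * L1_norm \<Omega> (f_avg f t n)) \<le> A"
    and sol: "solves_Q \<Omega> \<T> k0 \<epsilon> w0 f t N W Q"
    and B: "k0 \<le> B" "\<And>\<sigma>. \<sigma> \<in> \<T> \<Longrightarrow> norm (gr (pi_h \<Omega> \<T> w0) \<sigma>) \<le> B"
  defines "H \<equiv> B * diameter (closure \<Omega>)"
  defines "E \<equiv> measure lebesgue \<Omega> * H\<^sup>2 + 2 * H * A"
  shows "Max ((\<lambda>n. L2_norm \<Omega> (W n)) ` {0..N}) \<le> sqrt (measure lebesgue \<Omega> * H\<^sup>2)"
    and "(\<Sum>n=1..N. (L2_norm \<Omega> (\<lambda>x. W n x - W (n - 1) x))\<^sup>2) \<le> (real DIM('a) + 1) * E"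
    and "(\<Sum>n=1..N. tau t n * L1_norm \<Omega> (Q n)) \<le> E / (2 * k0)"
    and "Max ((\<lambda>n. W1inf_norm \<Omega> (W n)) ` {0..N}) \<le> ereal (max H B)"
proof -
  have W0: "W 0 = pi_h \<Omega> \<T> w0" using sol by (simp add: solves_Q_def)
  have step: "W n \<in> U0_h \<Omega> \<T>" "Q n \<in> S_h \<T>"
    "galerkin (f_avg f t n) (\<lambda>x. (W n x - W (n - 1) x) / tau t n) (Q n)" "dual_pair (bnd (W n)) (W n) (Q n)"
    if "n \<in> {1..N}" for n
    using sol that by (auto simp: solves_Q_def Q_step_iff)
  have B0: "0 \<le> B" using k0 B(1) by simp
  have WU0: "W n \<in> U0_h \<Omega> \<T>" and Wgr: "\<And>\<sigma>. \<sigma> \<in> \<T> \<Longrightarrow> norm (gr (W n) \<sigma>) \<le> B" if "n \<le> N" for n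
  proof -
    have "W n \<in> U0_h \<Omega> \<T> \<and> (\<forall>\<sigma>\<in>\<T>. norm (gr (W n) \<sigma>) \<le> B)"
    proof (cases "n = 0")
      case True
      then show ?thesis using W0 pi_h_w0 B by simp
    next
      case False
      then have n: "n \<in> {1..N}" using that by simp
      have "norm (gr (W n) \<sigma>) \<le> B" if \<sigma>: "\<sigma> \<in> \<T>" for \<sigma>
      proof -
        \<comment> \<open>The bound at any step is limited by that of the initial datum, so nothing
          accumulates over time.\<close>
        have "norm (gr (W n) \<sigma>) \<le> bnd (W n) \<sigma>" using step(4)[OF n] \<sigma> by (simp add: dual_pair_def)
        also have "\<dots> \<le> max k0 (norm (gr (pi_h \<Omega> \<T> w0) \<sigma>))" by (rule bnd_le[OF \<sigma>])
        also have "\<dots> \<le> B" using B \<sigma> by simp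
        finally show ?thesis .
      qed
      then show ?thesis using step(1)[OF n] by blast
    qed
    then show "W n \<in> U0_h \<Omega> \<T>" "\<And>\<sigma>. \<sigma> \<in> \<T> \<Longrightarrow> norm (gr (W n) \<sigma>) \<le> B" by auto
  qed
  have WH: "\<bar>W n x\<bar> \<le> H" if "n \<le> N" for n x
    unfolding H_def by (rule U_h_bound[OF U0_h_U_h[OF WU0[OF that]] B0 Wgr[OF that] U0_h_frontier[OF WU0[OF that]]])
  have H: "0 \<le> H" using WH[of 0] abs_ge_zero order_trans by blast
  show "Max ((\<lambda>n. L2_norm \<Omega> (W n)) ` {0..N}) \<le> sqrt (measure lebesgue \<Omega> * H\<^sup>2)"
    using L2_norm_le[OF U0_h_U_h[OF WU0] WH] by (auto simp: Max_le_iff)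
  show "Max ((\<lambda>n. W1inf_norm \<Omega> (W n)) ` {0..N}) \<le> ereal (max H B)"
    using W1inf_norm_le[OF U0_h_U_h[OF WU0] B0 Wgr U0_h_frontier[OF WU0]] unfolding H_def
    by (subst Max_le_iff) auto
  let ?\<Delta> = "\<lambda>n. lumped \<T> (\<lambda>x. W n x - W (n - 1) x) (\<lambda>x. W n x - W (n - 1) x)"
  let ?L = "\<lambda>n. lumped \<T> (W n) (W n)"
  have energy: "?\<Delta> n + 2 * k0 * (tau t n * L1_norm \<Omega> (Q n))
      \<le> ?L (n - 1) - ?L n + 2 * H * (tau t n * L1_norm \<Omega> (f_avg f t n))" if n: "n \<in> {1..N}" for n
  proof -
    have nN: "n \<le> N" using n by simp
    have L1: "L1_norm \<Omega> (Q n) = (\<Sum>\<sigma>\<in>\<T>. vol \<sigma> * norm (Q n (mid \<sigma>)))"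
      unfolding L1_norm_def
      using integral_piecewise_const(2)[of "\<lambda>x. norm (Q n x)" "\<lambda>\<sigma>. norm (Q n (mid \<sigma>))"]
      by (simp add: S_h_on[OF step(2)[OF n]])
    have "k0 * L1_norm \<Omega> (Q n) \<le> (\<Sum>\<sigma>\<in>\<T>. - (vol \<sigma> * (Q n (mid \<sigma>) \<bullet> gr (W n) \<sigma>)))"
      unfolding L1 sum_distrib_left
    proof (rule sum_mono)
      fix \<sigma> assume \<sigma>: "\<sigma> \<in> \<T>"
      have "k0 * norm (Q n (mid \<sigma>)) \<le> bnd (W n) \<sigma> * norm (Q n (mid \<sigma>))"
        using bnd_ge[OF \<sigma>] by (rule mult_right_mono) simp
      also have "\<dots> = - (Q n (mid \<sigma>) \<bullet> gr (W n) \<sigma>)"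
        using step(4)[OF n] \<sigma> by (simp add: dual_pair_def inner_commute eq_neg_iff_add_eq_0)
      finally have "vol \<sigma> * (k0 * norm (Q n (mid \<sigma>))) \<le> vol \<sigma> * - (Q n (mid \<sigma>) \<bullet> gr (W n) \<sigma>)"
        using vol_pos[OF \<sigma>] by (intro mult_left_mono) auto
      then show "k0 * (vol \<sigma> * norm (Q n (mid \<sigma>))) \<le> - (vol \<sigma> * (Q n (mid \<sigma>) \<bullet> gr (W n) \<sigma>))"
        by (simp add: mult.left_commute)
    qed
    also have "\<dots> = L2_inner \<Omega> (f_avg f t n) (W n) - lumped \<T> (\<lambda>x. (W n x - W (n - 1) x) / tau t n) (W n)"
      using galerkinD[OF step(3)[OF n] step(2)[OF n] step(1)[OF n]] by (simp add: sum_negf)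
    also have "\<dots> \<le> H * L1_norm \<Omega> (f_avg f t n) - lumped \<T> (\<lambda>x. (W n x - W (n - 1) x) / tau t n) (W n)"
      using load_le[OF f[OF n] U0_h_U_h[OF step(1)[OF n]] WH[OF nN]] by simp
    finally have "2 * tau t n * (k0 * L1_norm \<Omega> (Q n))
        \<le> 2 * tau t n * (H * L1_norm \<Omega> (f_avg f t n) - lumped \<T> (\<lambda>x. (W n x - W (n - 1) x) / tau t n) (W n))"
      using \<tau>[OF n] by (intro mult_left_mono) auto
    \<comment> \<open>At each node this is the identity
      \<open>2 (a - b) a = (a - b)^2 + a^2 - b^2\<close>.\<close>
    moreover have "2 * tau t n * lumped \<T> (\<lambda>x. (W n x - W (n - 1) x) / tau t n) (W n) = ?\<Delta> n + ?L n - ?L (n - 1)"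
      unfolding lumped_nodes sum_distrib_left sum.distrib[symmetric] sum_subtractf[symmetric]
      by (intro sum.cong refl) (use \<tau>[OF n] in \<open>simp add: field_simps\<close>)
    ultimately show ?thesis by (simp add: algebra_simps)
  qed
  have "(\<Sum>n=1..N. ?\<Delta> n + 2 * k0 * (tau t n * L1_norm \<Omega> (Q n)))
      \<le> (\<Sum>n=1..N. (?L (n - 1) - ?L n) + 2 * H * (tau t n * L1_norm \<Omega> (f_avg f t n)))"
    using energy by (rule sum_mono)
  also have "\<dots> = (?L 0 - ?L N) + 2 * H * (\<Sum>n=1..N. tau t n * L1_norm \<Omega> (f_avg f t n))"
  proof -
    have "(\<Sum>n=1..N. ?L (n - 1) - ?L n) = ?L 0 - ?L N"
      by (induction N) (simp_all)
    then show ?thesis by (simp add: sum.distrib sum_distrib_left)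
  qed
  also have "\<dots> \<le> E"
  proof -
    have "0 \<le> ?L N" by (rule lumped_nonneg)
    moreover have "?L 0 \<le> measure lebesgue \<Omega> * H\<^sup>2" by (rule lumped_self_le) (use WH[of 0] in simp)
    moreover have "2 * H * (\<Sum>n=1..N. tau t n * L1_norm \<Omega> (f_avg f t n)) \<le> 2 * H * A"
      using A H by (intro mult_left_mono) auto
    ultimately show ?thesis unfolding E_def by linarith
  qed
  finally have total: "(\<Sum>n=1..N. ?\<Delta> n) + 2 * k0 * (\<Sum>n=1..N. tau t n * L1_norm \<Omega> (Q n)) \<le> E"
    by (simp add: sum.distrib sum_distrib_left)
  have \<Delta>_nn: "0 \<le> (\<Sum>n=1..N. ?\<Delta> n)"
    by (intro sum_nonneg lumped_nonneg)
  have Q_nn: "0 \<le> (\<Sum>n=1..N. tau t n * L1_norm \<Omega> (Q n))"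
  proof (intro sum_nonneg mult_nonneg_nonneg)
    fix n assume "n \<in> {1..N}"
    then show "0 \<le> tau t n" using \<tau> less_imp_le by blast
    show "0 \<le> L1_norm \<Omega> (Q n)"
      unfolding L1_norm_def set_lebesgue_integral_def by (intro integral_nonneg_AE AE_I2) simp
  qed
  show "(\<Sum>n=1..N. tau t n * L1_norm \<Omega> (Q n)) \<le> E / (2 * k0)"
    using total \<Delta>_nn k0 by (simp add: field_simps)
  have "(\<Sum>n=1..N. (L2_norm \<Omega> (\<lambda>x. W n x - W (n - 1) x))\<^sup>2) \<le> (\<Sum>n=1..N. (real DIM('a) + 1) * ?\<Delta> n)"
  proof (rule sum_mono)
    fix n assume n: "n \<in> {1..N}"
    show "(L2_norm \<Omega> (\<lambda>x. W n x - W (n - 1) x))\<^sup>2 \<le> (real DIM('a) + 1) * ?\<Delta> n"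
      by (rule L2_norm_sq_le_lumped[OF U0_h_U_h[OF U0_h_diff(1)]]) (use WU0[of n] WU0[of "n - 1"] n in auto)
  qed
  also have "\<dots> \<le> (real DIM('a) + 1) * E"
    unfolding sum_distrib_left[symmetric]
  proof (rule mult_left_mono)
    have "0 \<le> 2 * k0 * (\<Sum>n=1..N. tau t n * L1_norm \<Omega> (Q n))" using Q_nn k0 by simp
    then show "(\<Sum>n=1..N. ?\<Delta> n) \<le> E" using total by linarith
  qed simp
  finally show "(\<Sum>n=1..N. (L2_norm \<Omega> (\<lambda>x. W n x - W (n - 1) x))\<^sup>2) \<le> (real DIM('a) + 1) * E" .
qed

end

section \<open>Uniform estimates for regular families\<close>

text \<open>The gradient is bounded on the compact closure; the mean value inequality on the convex
  open set then extends to the closure by continuity.\<close>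

lemma C1_closure_lipschitz:
  assumes op: "open \<Omega>" and conv: "convex \<Omega>" and bdd: "bounded (closure \<Omega>)"
    and C1: "C1_closure \<Omega> u G"
  obtains L where "L-lipschitz_on (closure \<Omega>) u"
proof -
  have "compact (closure \<Omega>)" using bdd by (simp add: compact_eq_bounded_closed)
  then have "bounded (G ` closure \<Omega>)"
    using C1 unfolding C1_closure_def by (intro compact_imp_bounded compact_continuous_image) auto
  then obtain L where L: "0 < L" "\<And>x. x \<in> closure \<Omega> \<Longrightarrow> norm (G x) \<le> L" by (auto simp: bounded_pos)
  have "L-lipschitz_on \<Omega> u"
  proof (rule lipschitz_onI)
    fix x y assume xy: "x \<in> \<Omega>" "y \<in> \<Omega>"
    have "norm (u x - u y) \<le> L * norm (x - y)"
    proof (rule differentiable_bound[of \<Omega> u "\<lambda>x h. h \<bullet> G x"])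
      show "(u has_derivative (\<lambda>h. h \<bullet> G x)) (at x within \<Omega>)" if "x \<in> \<Omega>" for x
      proof (rule has_derivative_at_withinI)
        have "GDERIV u x :> G x" using C1 that by (simp add: C1_closure_def)
        then show "(u has_derivative (\<lambda>h. h \<bullet> G x)) (at x)" unfolding gderiv_def .
      qed
      show "onorm (\<lambda>h. h \<bullet> G x) \<le> L" if "x \<in> \<Omega>" for x
      proof (rule onorm_le)
        fix z
        have "norm (z \<bullet> G x) \<le> norm z * norm (G x)" by (simp add: Cauchy_Schwarz_ineq2)
        also have "\<dots> \<le> norm z * L" using L(2)[of x] that closure_subset[of \<Omega>] by (intro mult_left_mono) auto
        finally show "norm (z \<bullet> G x) \<le> L * norm z" by (simp add: mult.commute)
      qed
    qed (use conv xy in auto)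
    then show "dist (u x) (u y) \<le> L * dist x y" by (simp add: dist_norm)
  qed (use L in simp)
  moreover have "continuous_on (closure \<Omega>) u" using C1 by (simp add: C1_closure_def)
  ultimately show ?thesis by (rule that[OF lipschitz_on_closure])
qed

theorem theorem2p2:
  fixes \<Omega> :: "'a::euclidean_space set"
    and f :: "'a \<Rightarrow> real \<Rightarrow> real"
    and w0 :: "'a \<Rightarrow> real" and G :: "'a \<Rightarrow> 'a"
    and T k0 \<epsilon> :: real
    and F :: "'a set set set"
  assumes "DIM('a) \<in> {1, 2}"
    and "convex_polygonal_domain \<Omega>"
    and "T > 0" and "k0 > 0" and "\<epsilon> > 0"
    and "f \<in> L2_L2 \<Omega> T"
    and "AE z in lebesgue_on (\<Omega> \<times> {0<..<T}). 0 \<le> f (fst z) (snd z)"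
    and "w0 \<in> W1inf_0 \<Omega>" and "C1_closure \<Omega> w0 G"
    and "\<forall>x \<nu>. outward_unit_normal \<Omega> x \<nu> \<longrightarrow> G x \<bullet> \<nu> < k0"
    and "regular_family \<Omega> F"
  shows
    "(\<forall>\<T>\<in>F. \<forall>N t W Q. \<forall>n\<in>{1..N}.
        time_partition T N t \<and> W 0 = pi_h \<Omega> \<T> w0 \<and>
        (\<forall>m\<in>{1..<n}. Q_step \<Omega> \<T> k0 \<epsilon> w0 f t m (W (m - 1)) (W m) (Q m)) \<longrightarrow>
        (\<exists>Wn Qn. Q_step \<Omega> \<T> k0 \<epsilon> w0 f t n (W (n - 1)) Wn Qn))
   \<and> (\<exists>C::real. C > 0 \<and>
        (\<forall>\<T>\<in>F. \<forall>N t W Q. time_partition T N t \<and> solves_Q \<Omega> \<T> k0 \<epsilon> w0 f t N W Q \<longrightarrow>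
           Max ((\<lambda>n. L2_norm \<Omega> (W n)) ` {0..N})
             + (\<Sum>n=1..N. (L2_norm \<Omega> (\<lambda>x. W n x - W (n - 1) x))\<^sup>2)
             + (\<Sum>n=1..N. tau t n * L1_norm \<Omega> (Q n)) \<le> C \<and>
           Max ((\<lambda>n. W1inf_norm \<Omega> (W n)) ` {0..N}) \<le> ereal C))
   \<and> (\<forall>\<T>\<in>F. \<forall>N t W Q. time_partition T N t \<longrightarrow>
        (solves_Q \<Omega> \<T> k0 \<epsilon> w0 f t N W Q \<longleftrightarrow>
         solves_P \<Omega> \<T> k0 \<epsilon> w0 f t N W \<and> solves_M \<Omega> \<T> k0 \<epsilon> w0 f t N W Q))
   \<and> (\<forall>\<T>\<in>F. \<forall>N t W Q. time_partition T N t \<and> solves_Q \<Omega> \<T> k0 \<epsilon> w0 f t N W Q \<longrightarrow>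
        (\<forall>n\<in>{1..N}. \<exists>\<Lambda>. lagrange_multiplier \<Omega> \<T> k0 \<epsilon> w0 f t W n \<Lambda> \<and>
           (\<forall>x. Q n x = - \<Lambda> x *\<^sub>R grad (W n) x)))"
proof -
  note dom = assms(2) and k0 = assms(4) and \<epsilon> = assms(5) and f = assms(6) and w0 = assms(8) and C1 = assms(9)
    and regular = assms(11)
  have op: "open \<Omega>" and conv: "convex \<Omega>" and bdd: "bounded (closure \<Omega>)"
    using dom polytope_imp_bounded by (auto simp: convex_polygonal_domain_def)
  have bdd': "bounded \<Omega>" using bdd bounded_subset closure_subset by blast
  have w0_frontier: "\<And>x. x \<in> frontier \<Omega> \<Longrightarrow> w0 x = 0" using w0 by (simp add: W1inf_0_def)
  obtain A where f_int: "\<And>N t n. time_partition T N t \<Longrightarrow> n \<in> {1..N} \<Longrightarrow> set_integrable lebesgue \<Omega> (f_avg f t n)"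
    and A: "\<And>N t. time_partition T N t \<Longrightarrow> (\<Sum>n=1..N. tau t n * L1_norm \<Omega> (f_avg f t n)) \<le> A"
    using f_avg_integrable[OF op bdd' f] by blast
  obtain L where L: "L-lipschitz_on (closure \<Omega>) w0" using C1_closure_lipschitz[OF op conv bdd C1] .
  obtain \<kappa> where \<kappa>: "0 < \<kappa>" "\<And>\<T> \<sigma>. \<T> \<in> F \<Longrightarrow> \<sigma> \<in> \<T> \<Longrightarrow> diameter \<sigma> \<le> \<kappa> * inball_diameter \<sigma>"
    using regular unfolding regular_family_def by blast
  have go: "gradient_obstacle \<Omega> \<T> k0 \<epsilon> w0" if "\<T> \<in> F" for \<T>
    using that dom k0 \<epsilon> w0_frontier regular
    by unfold_locales (auto simp: regular_family_def)
  \<comment> \<open>\<open>L * \<kappa>\<close> bounds the gradient of the interpolated initial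
    datum on every mesh of the family, and together with \<open>k0\<close> every value of the
    gradient bound.\<close>
  define B where "B = max k0 (L * \<kappa>)"
  define H where "H = B * diameter (closure \<Omega>)"
  define E where "E = measure lebesgue \<Omega> * H\<^sup>2 + 2 * H * A"
  define C where "C = max (sqrt (measure lebesgue \<Omega> * H\<^sup>2) + (real DIM('a) + 1) * E + E / (2 * k0)) (max H B)"
  have B: "k0 \<le> B" by (simp add: B_def)
  have C_pos: "0 < C" using B k0 by (simp add: C_def less_max_iff_disj)
  \<comment> \<open>The definition of \<open>mid\<close> involves no locale parameter, so its global
    form takes the element alone and this bound can be stated before a mesh is fixed by
    interpretation.\<close>
  have gr_pi: "norm (grad (pi_h \<Omega> \<T> w0) (fe_mesh.mid \<sigma>)) \<le> B" if T: "\<T> \<in> F" and \<sigma>: "\<sigma> \<in> \<T>" for \<T> \<sigma>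
  proof -
    interpret gradient_obstacle \<Omega> \<T> k0 \<epsilon> w0 by (rule go[OF T])
    have "norm (gr (pi_h \<Omega> \<T> w0) \<sigma>) \<le> L * \<kappa>"
    proof (rule gr_le_shape[OF pi_h(1) \<sigma> lipschitz_on_nonneg[OF L] _ _ \<kappa>(2)[OF T \<sigma>]])
      fix p q assume pq: "p \<in> verts \<sigma>" "q \<in> verts \<sigma>"
      then have "p \<in> nodes \<T>" "q \<in> nodes \<T>" using \<sigma> by (auto simp: nodes_def)
      then show "pi_h \<Omega> \<T> w0 p - pi_h \<Omega> \<T> w0 q \<le> L * dist p q"
        using lipschitz_onD[OF L, of p q] subsetD[OF nodes_subset] by (auto simp: pi_h(2) dist_real_def)
    qed (use \<kappa> in simp)
    then show ?thesis by (simp add: B_def)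
  qed
  have solvable: "\<forall>\<T>\<in>F. \<forall>N t W Q. \<forall>n\<in>{1..N}.
      time_partition T N t \<and> W 0 = pi_h \<Omega> \<T> w0 \<and>
      (\<forall>m\<in>{1..<n}. Q_step \<Omega> \<T> k0 \<epsilon> w0 f t m (W (m - 1)) (W m) (Q m)) \<longrightarrow>
      (\<exists>Wn Qn. Q_step \<Omega> \<T> k0 \<epsilon> w0 f t n (W (n - 1)) Wn Qn)"
  proof (intro ballI allI impI; elim conjE)
    fix \<T> N t n W
    assume T: "\<T> \<in> F" and n: "n \<in> {1..N}" and tp: "time_partition T N t"
    show "\<exists>Wn Qn. Q_step \<Omega> \<T> k0 \<epsilon> w0 f t n (W (n - 1)) Wn Qn"
      by (rule gradient_obstacle.Q_step_solvable[OF go[OF T] f_int[OF tp n] time_partition_tau_pos[OF tp n]])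
  qed
  have stable: "\<exists>C::real. C > 0 \<and>
      (\<forall>\<T>\<in>F. \<forall>N t W Q. time_partition T N t \<and> solves_Q \<Omega> \<T> k0 \<epsilon> w0 f t N W Q \<longrightarrow>
         Max ((\<lambda>n. L2_norm \<Omega> (W n)) ` {0..N})
           + (\<Sum>n=1..N. (L2_norm \<Omega> (\<lambda>x. W n x - W (n - 1) x))\<^sup>2)
           + (\<Sum>n=1..N. tau t n * L1_norm \<Omega> (Q n)) \<le> C \<and>
         Max ((\<lambda>n. W1inf_norm \<Omega> (W n)) ` {0..N}) \<le> ereal C)"
  proof (intro exI[of _ C] conjI C_pos ballI allI impI; elim conjE)
    fix \<T> N t W Q
    assume T: "\<T> \<in> F" and tp: "time_partition T N t" and sol: "solves_Q \<Omega> \<T> k0 \<epsilon> w0 f t N W Q"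
    note bounds = gradient_obstacle.solves_Q_bounds[OF go[OF T] f_int[OF tp] time_partition_tau_pos[OF tp]
        A[OF tp] sol B gr_pi[OF T], folded H_def, folded E_def]
    show "Max ((\<lambda>n. L2_norm \<Omega> (W n)) ` {0..N})
           + (\<Sum>n=1..N. (L2_norm \<Omega> (\<lambda>x. W n x - W (n - 1) x))\<^sup>2)
           + (\<Sum>n=1..N. tau t n * L1_norm \<Omega> (Q n)) \<le> C"
      using bounds(1,2,3) unfolding C_def by linarith
    have "max H B \<le> C" by (simp add: C_def)
    then have "ereal (max H B) \<le> ereal C" by (simp only: ereal_less_eq)
    with bounds(4) show "Max ((\<lambda>n. W1inf_norm \<Omega> (W n)) ` {0..N}) \<le> ereal C" by (rule order.trans)
  qed
  have equivalent: "\<forall>\<T>\<in>F. \<forall>N t W Q. time_partition T N t \<longrightarrow>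
      (solves_Q \<Omega> \<T> k0 \<epsilon> w0 f t N W Q \<longleftrightarrow>
       solves_P \<Omega> \<T> k0 \<epsilon> w0 f t N W \<and> solves_M \<Omega> \<T> k0 \<epsilon> w0 f t N W Q)"
  proof (intro ballI allI impI)
    fix \<T> N t W Q assume T: "\<T> \<in> F" and tp: "time_partition T N t"
    show "solves_Q \<Omega> \<T> k0 \<epsilon> w0 f t N W Q \<longleftrightarrow>
       solves_P \<Omega> \<T> k0 \<epsilon> w0 f t N W \<and> solves_M \<Omega> \<T> k0 \<epsilon> w0 f t N W Q"
      by (rule gradient_obstacle.solves_Q_iff[OF go[OF T] f_int[OF tp] time_partition_tau_pos[OF tp]])
  qed
  have multiplier: "\<forall>\<T>\<in>F. \<forall>N t W Q. time_partition T N t \<and> solves_Q \<Omega> \<T> k0 \<epsilon> w0 f t N W Q \<longrightarrow>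
      (\<forall>n\<in>{1..N}. \<exists>\<Lambda>. lagrange_multiplier \<Omega> \<T> k0 \<epsilon> w0 f t W n \<Lambda> \<and>
         (\<forall>x. Q n x = - \<Lambda> x *\<^sub>R grad (W n) x))"
  proof (intro ballI allI impI; elim conjE)
    fix \<T> N t W Q n
    assume T: "\<T> \<in> F" and n: "n \<in> {1..N}" and tp: "time_partition T N t"
      and sol: "solves_Q \<Omega> \<T> k0 \<epsilon> w0 f t N W Q"
    have "Q_step \<Omega> \<T> k0 \<epsilon> w0 f t n (W (n - 1)) (W n) (Q n)" using sol n by (simp add: solves_Q_def)
    then show "\<exists>\<Lambda>. lagrange_multiplier \<Omega> \<T> k0 \<epsilon> w0 f t W n \<Lambda> \<and> (\<forall>x. Q n x = - \<Lambda> x *\<^sub>R grad (W n) x)"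
      by (rule gradient_obstacle.Q_step_multiplier[OF go[OF T] f_int[OF tp n] time_partition_tau_pos[OF tp n]])
  qed
  from solvable stable equivalent multiplier show ?thesis
    by (intro conjI)
qed

end
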